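(* Let $\mathcal G$ be an ultragraph satisfying Condition (RFUM2). If the ultragraph $C^*$-algebra $C^*(\mathcal G)$ is residually finite-dimensional, then $\mathcal G$ satisfies the graph-theoretic RFD conditions (B1)--(B4).
   Context: Ultragraphs. An ultragraph is a quadruple $\mathcal G=(G^0,\mathcal G^1,r,s)$ with $G^0$ a set of vertices, $\mathcal G^1$ a set of edges, $s:\mathcal G^1\to G^0$ and $r:\mathcal G^1\to\mathcal P(G^0)\setminus\{\emptyset\}$. $\mathcal G^0$ is the smallest collection of subsets of $G^0$ containing all singletons $\{v\}$ and all ranges $r(e)$ and closed under finite unions and finite intersections (with $\emptyset\in\mathcal G^0$). A path of length $n\ge1$ is a word $\alpha=e_1\cdots e_n$ of edges with $s(e_{i+1})\in r(e_i)$ for $1\le i<n$; $s(\alpha)=s(e_1)$, $r(\alpha)=r(e_n)$. A vertex $v$ is a sink if $s^{-1}(v)=\emptyset$, and regular if $0<|s^{-1}(v)|<\infty$. For $A\in\mathcal G^0$ let $\varepsilon(A)=\{e\in\mathcal G^1:s(e)\in A\}$; $A$ is an infinite emitter if $|\varepsilon(A)|=\infty$. $A\in\mathcal G^0$ is a minimal infinite emitter if $|\varepsilon(A)|=\infty$ and no proper subset $B\subsetneq A$ with $B\in\mathcal G^0$ is either an infinite emitter or an infinite set with $|\varepsilon(B)|<\infty$. $A\in\mathcal G^0$ is a minimal sink if $|A|=\infty$, $|\varepsilon(A)|<\infty$ and no proper subset $B\subsetneq A$ with $B\in\mathcal G^0$ is infinite. Condition (RFUM2): every range $r(e)$, $e\in\mathcal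 G^1$, is a finite union of minimal infinite emitters, minimal sinks, and singletons $\{v\}$ with $v$ a sink or a regular vertex. Terminal boundary sets. $\mathcal A\subseteq\mathcal G^0$ is the collection of all minimal infinite emitters, all minimal sinks, and all $\{v\}$ with $v$ a sink; its elements are terminal boundary sets. Cycles. A cycle is a path $c=e_1\cdots e_n$, $n\ge1$, with $s(e_1)\in r(e_n)$ and $s(e_1),\dots,s(e_n)$ distinct; the vertices on $c$ are the $s(e_i)$. An exit for $c$ is either an edge $f$ with $s(f)\in r(e_i)$ and $f\ne e_{i+1}$ for some $i$ (indices cyclic), or a sink $w\in r(e_i)$ for some $i$. Graph-theoretic RFD conditions. (B1) No infinite receivers: for every $v\in G^0$ the set $\{e\in\mathcal G^1:v\in r(e)\}$ is finite. (B2) No cycle has an exit. (B3) No infinite backward chains: there is no infinite sequence of distinct edges $e_1,e_2,e_3,\dots$ with $s(e_i)\in r(e_{i+1})$ for all $i\ge1$. (B4) Every $v\in G^0$ reaches a terminal boundary set (i.e. $\{v\}\in\mathcal A$, or there are a path $\alpha$ with $|\alpha|\ge1$, $s(\alpha)=v$, and $A\in\mathcal A$ with $A\subseteq r(\alpha)$) or reaches a cycle (i.e. $v$ lies on a cycle, or there is a path $\alpha$ with $|\alpha|\ge1$, $s(\alpha)=v$, such that $r(\alpha)$ contains a vertex lying on a cycle). Algebra. $C^*(\mathcal G)$ is the universal $C^*$-algebra generated by projections $p_A$ ($A\in\mathcal G^0$) and partial isometries $s_e$ ($e\in\mathcal G^1$) with mutually orthogonal ranges such that $p_\emptyset=0$,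 $p_Ap_B=p_{A\cap B}$, $p_{A\cup B}=p_A+p_B-p_{A\cap B}$, $s_e^*s_e=p_{r(e)}$, $s_es_e^*\le p_{s(e)}$, and $p_{\{v\}}=\sum_{s(e)=v}s_es_e^*$ for every regular vertex $v$. RFD. A $C^*$-algebra is residually finite-dimensional (RFD) if its finite-dimensional $*$-representations separate points. *)

theory Defs
  imports
    "HOL-Library.Poly_Mapping"
    "HOL-Analysis.Analysis"
    "Jordan_Normal_Form.Schur_Decomposition"
begin

section \<open>Ultragraphs\<close>

record ('v, 'e) ultragraph =
  verts :: "'v set"
  edges :: "'e set"
  src :: "'e \<Rightarrow> 'v"
  rng :: "'e \<Rightarrow> 'v set"

definition wf_ultragraph :: "('v, 'e) ultragraph \<Rightarrow> bool" where
  "wf_ultragraph G \<longleftrightarrow>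
     (\<forall>e\<in>edges G. src G e \<in> verts G \<and> rng G e \<subseteq> verts G \<and> rng G e \<noteq> {})"

inductive_set gen_verts :: "('v, 'e) ultragraph \<Rightarrow> 'v set set" for G where
  empty: "{} \<in> gen_verts G"
| singleton: "v \<in> verts G \<Longrightarrow> {v} \<in> gen_verts G"
| range: "e \<in> edges G \<Longrightarrow> rng G e \<in> gen_verts G"
| union: "A \<in> gen_verts G \<Longrightarrow> B \<in> gen_verts G \<Longrightarrow> A \<union> B \<in> gen_verts G"
| inter: "A \<in> gen_verts G \<Longrightarrow> B \<in> gen_verts G \<Longrightarrow> A \<inter> B \<in> gen_verts G"

definition emitted :: "('v, 'e) ultragraph \<Rightarrow> 'v set \<Rightarrow> 'e set" where
  "emitted G A = {e \<in> edges G. src G e \<in> A}"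

definition sink :: "('v, 'e) ultragraph \<Rightarrow> 'v \<Rightarrow> bool" where
  "sink G v \<longleftrightarrow> v \<in> verts G \<and> emitted G {v} = {}"

definition regular :: "('v, 'e) ultragraph \<Rightarrow> 'v \<Rightarrow> bool" where
  "regular G v \<longleftrightarrow> v \<in> verts G \<and> emitted G {v} \<noteq> {} \<and> finite (emitted G {v})"

definition infinite_emitter :: "('v, 'e) ultragraph \<Rightarrow> 'v set \<Rightarrow> bool" where
  "infinite_emitter G A \<longleftrightarrow> A \<in> gen_verts G \<and> infinite (emitted G A)"

definition minimal_infinite_emitter :: "('v, 'e) ultragraph \<Rightarrow> 'v set \<Rightarrow> bool" where
  "minimal_infinite_emitter G A \<longleftrightarrow>
     infinite_emitter G A \<and>
     (\<forall>B\<in>gen_verts G. B \<subset> A \<longrightarrow>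
        \<not> (infinite_emitter G B \<or> (infinite B \<and> finite (emitted G B))))"

definition minimal_sink :: "('v, 'e) ultragraph \<Rightarrow> 'v set \<Rightarrow> bool" where
  "minimal_sink G A \<longleftrightarrow>
     A \<in> gen_verts G \<and> infinite A \<and> finite (emitted G A) \<and>
     (\<forall>B\<in>gen_verts G. B \<subset> A \<longrightarrow> \<not> infinite B)"

definition RFUM2 :: "('v, 'e) ultragraph \<Rightarrow> bool" where
  "RFUM2 G \<longleftrightarrow>
     (\<forall>e\<in>edges G. \<exists>\<F>. finite \<F> \<and> rng G e = \<Union>\<F> \<and>
        (\<forall>A\<in>\<F>. minimal_infinite_emitter G A \<or> minimal_sink G A \<or>
                (\<exists>v. A = {v} \<and> (sink G v \<or> regular G v))))"

definition terminal_sets :: "('v, 'e) ultragraph \<Rightarrow> 'v set set" where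
  "terminal_sets G =
     {A. minimal_infinite_emitter G A} \<union> {A. minimal_sink G A} \<union> {{v} | v. sink G v}"

definition is_path :: "('v, 'e) ultragraph \<Rightarrow> 'e list \<Rightarrow> bool" where
  "is_path G \<alpha> \<longleftrightarrow> \<alpha> \<noteq> [] \<and> set \<alpha> \<subseteq> edges G \<and>
     (\<forall>i. Suc i < length \<alpha> \<longrightarrow> src G (\<alpha> ! Suc i) \<in> rng G (\<alpha> ! i))"

definition path_src :: "('v, 'e) ultragraph \<Rightarrow> 'e list \<Rightarrow> 'v" where
  "path_src G \<alpha> = src G (hd \<alpha>)"

definition path_rng :: "('v, 'e) ultragraph \<Rightarrow> 'e list \<Rightarrow> 'v set" where
  "path_rng G \<alpha> = rng G (last \<alpha>)"

definition is_cycle :: "('v, 'e) ultragraph \<Rightarrow> 'e list \<Rightarrow> bool" where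
  "is_cycle G c \<longleftrightarrow> is_path G c \<and> path_src G c \<in> path_rng G c \<and> distinct (map (src G) c)"

definition cycle_verts :: "('v, 'e) ultragraph \<Rightarrow> 'e list \<Rightarrow> 'v set" where
  "cycle_verts G c = src G ` set c"

definition has_exit :: "('v, 'e) ultragraph \<Rightarrow> 'e list \<Rightarrow> bool" where
  "has_exit G c \<longleftrightarrow>
     (\<exists>i<length c.
        (\<exists>f\<in>edges G. src G f \<in> rng G (c ! i) \<and> f \<noteq> c ! (Suc i mod length c)) \<or>
        (\<exists>w\<in>rng G (c ! i). sink G w))"

definition cond_B1 :: "('v, 'e) ultragraph \<Rightarrow> bool" where
  "cond_B1 G \<longleftrightarrow> (\<forall>v\<in>verts G. finite {e \<in> edges G. v \<in> rng G e})"

definition cond_B2 :: "('v, 'e) ultragraph \<Rightarrow> bool" where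
  "cond_B2 G \<longleftrightarrow> (\<forall>c. is_cycle G c \<longrightarrow> \<not> has_exit G c)"

definition cond_B3 :: "('v, 'e) ultragraph \<Rightarrow> bool" where
  "cond_B3 G \<longleftrightarrow>
     \<not> (\<exists>e :: nat \<Rightarrow> 'e. inj e \<and> (\<forall>i. e i \<in> edges G) \<and>
          (\<forall>i. src G (e i) \<in> rng G (e (Suc i))))"

definition reaches_terminal :: "('v, 'e) ultragraph \<Rightarrow> 'v \<Rightarrow> bool" where
  "reaches_terminal G v \<longleftrightarrow>
     {v} \<in> terminal_sets G \<or>
     (\<exists>\<alpha> A. is_path G \<alpha> \<and> path_src G \<alpha> = v \<and> A \<in> terminal_sets G \<and> A \<subseteq> path_rng G \<alpha>)"

definition reaches_cycle :: "('v, 'e) ultragraph \<Rightarrow> 'v \<Rightarrow> bool" where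
  "reaches_cycle G v \<longleftrightarrow>
     (\<exists>c. is_cycle G c \<and> v \<in> cycle_verts G c) \<or>
     (\<exists>\<alpha> c. is_path G \<alpha> \<and> path_src G \<alpha> = v \<and> is_cycle G c \<and>
            path_rng G \<alpha> \<inter> cycle_verts G c \<noteq> {})"

definition cond_B4 :: "('v, 'e) ultragraph \<Rightarrow> bool" where
  "cond_B4 G \<longleftrightarrow> (\<forall>v\<in>verts G. reaches_terminal G v \<or> reaches_cycle G v)"


section \<open>C*-algebras and residual finite-dimensionality\<close>

text \<open>C*-algebras need not be unital: the field \<open>one\<close>, inherited from the record of
  modules over a ring, carries no meaning here.\<close>

record 'a star_alg = "(complex, 'a) module" +
  star :: "'a \<Rightarrow> 'a"
  nrm :: "'a \<Rightarrow> real"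

locale cstar_algebra = abelian_group A for A :: "'a star_alg" (structure) +
  assumes mult_closed: "\<lbrakk>x \<in> carrier A; y \<in> carrier A\<rbrakk> \<Longrightarrow> x \<otimes> y \<in> carrier A"
    and mult_assoc: "\<lbrakk>x \<in> carrier A; y \<in> carrier A; z \<in> carrier A\<rbrakk>
          \<Longrightarrow> (x \<otimes> y) \<otimes> z = x \<otimes> (y \<otimes> z)"
    and distrib_right: "\<lbrakk>x \<in> carrier A; y \<in> carrier A; z \<in> carrier A\<rbrakk>
          \<Longrightarrow> (x \<oplus> y) \<otimes> z = (x \<otimes> z) \<oplus> (y \<otimes> z)"
    and distrib_left: "\<lbrakk>x \<in> carrier A; y \<in> carrier A; z \<in> carrier A\<rbrakk>
          \<Longrightarrow> z \<otimes> (x \<oplus> y) = (z \<otimes> x) \<oplus> (z \<otimes> y)"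
    and scale_closed: "x \<in> carrier A \<Longrightarrow> c \<odot> x \<in> carrier A"
    and scale_add_right: "\<lbrakk>x \<in> carrier A; y \<in> carrier A\<rbrakk> \<Longrightarrow> c \<odot> (x \<oplus> y) = (c \<odot> x) \<oplus> (c \<odot> y)"
    and scale_add_left: "x \<in> carrier A \<Longrightarrow> (c + d) \<odot> x = (c \<odot> x) \<oplus> (d \<odot> x)"
    and scale_scale: "x \<in> carrier A \<Longrightarrow> c \<odot> (d \<odot> x) = (c * d) \<odot> x"
    and scale_one: "x \<in> carrier A \<Longrightarrow> 1 \<odot> x = x"
    and scale_mult_left: "\<lbrakk>x \<in> carrier A; y \<in> carrier A\<rbrakk> \<Longrightarrow> (c \<odot> x) \<otimes> y = c \<odot> (x \<otimes> y)"
    and scale_mult_right: "\<lbrakk>x \<in> carrier A; y \<in> carrier A\<rbrakk> \<Longrightarrow> x \<otimes> (c \<odot> y) = c \<odot> (x \<otimes> y)"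
    and star_closed: "x \<in> carrier A \<Longrightarrow> star A x \<in> carrier A"
    and star_star: "x \<in> carrier A \<Longrightarrow> star A (star A x) = x"
    and star_add: "\<lbrakk>x \<in> carrier A; y \<in> carrier A\<rbrakk> \<Longrightarrow> star A (x \<oplus> y) = star A x \<oplus> star A y"
    and star_scale: "x \<in> carrier A \<Longrightarrow> star A (c \<odot> x) = cnj c \<odot> star A x"
    and star_mult: "\<lbrakk>x \<in> carrier A; y \<in> carrier A\<rbrakk> \<Longrightarrow> star A (x \<otimes> y) = star A y \<otimes> star A x"
    and nrm_eq_0: "x \<in> carrier A \<Longrightarrow> nrm A x = 0 \<longleftrightarrow> x = \<zero>"
    and nrm_add: "\<lbrakk>x \<in> carrier A; y \<in> carrier A\<rbrakk> \<Longrightarrow> nrm A (x \<oplus> y) \<le> nrm A x + nrm A y"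
    and nrm_scale: "x \<in> carrier A \<Longrightarrow> nrm A (c \<odot> x) = cmod c * nrm A x"
    and nrm_mult: "\<lbrakk>x \<in> carrier A; y \<in> carrier A\<rbrakk> \<Longrightarrow> nrm A (x \<otimes> y) \<le> nrm A x * nrm A y"
    and nrm_cstar: "x \<in> carrier A \<Longrightarrow> nrm A (star A x \<otimes> x) = (nrm A x)\<^sup>2"
    and complete: "\<lbrakk>\<And>n. X n \<in> carrier A;
          \<And>\<epsilon>. \<epsilon> > 0 \<Longrightarrow> \<exists>M::nat. \<forall>m\<ge>M. \<forall>n\<ge>M. nrm A (X m \<ominus> X n) < \<epsilon>\<rbrakk>
          \<Longrightarrow> \<exists>L\<in>carrier A. (\<lambda>n. nrm A (X n \<ominus> L)) \<longlonglongrightarrow> 0"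

definition star_hom :: "'a star_alg \<Rightarrow> 'b star_alg \<Rightarrow> ('a \<Rightarrow> 'b) \<Rightarrow> bool" where
  "star_hom A B \<pi> \<longleftrightarrow>
     (\<forall>x\<in>carrier A. \<pi> x \<in> carrier B) \<and>
     (\<forall>x\<in>carrier A. \<forall>y\<in>carrier A. \<pi> (x \<oplus>\<^bsub>A\<^esub> y) = \<pi> x \<oplus>\<^bsub>B\<^esub> \<pi> y) \<and>
     (\<forall>x\<in>carrier A. \<forall>y\<in>carrier A. \<pi> (x \<otimes>\<^bsub>A\<^esub> y) = \<pi> x \<otimes>\<^bsub>B\<^esub> \<pi> y) \<and>
     (\<forall>c. \<forall>x\<in>carrier A. \<pi> (c \<odot>\<^bsub>A\<^esub> x) = c \<odot>\<^bsub>B\<^esub> \<pi> x) \<and>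
     (\<forall>x\<in>carrier A. \<pi> (star A x) = star B (\<pi> x))"

text \<open>Every finite-dimensional Hilbert space is some \<open>\<complex>\<^sup>n\<close>, so its operators form
  the algebra of \<open>n \<times> n\<close> matrices. No non-degeneracy is required.\<close>

definition fd_rep :: "'a star_alg \<Rightarrow> nat \<Rightarrow> ('a \<Rightarrow> complex mat) \<Rightarrow> bool" where
  "fd_rep A n \<pi> \<longleftrightarrow>
     (\<forall>x\<in>carrier A. \<pi> x \<in> carrier_mat n n) \<and>
     (\<forall>x\<in>carrier A. \<forall>y\<in>carrier A. \<pi> (x \<oplus>\<^bsub>A\<^esub> y) = \<pi> x + \<pi> y) \<and>
     (\<forall>x\<in>carrier A. \<forall>y\<in>carrier A. \<pi> (x \<otimes>\<^bsub>A\<^esub> y) = \<pi> x * \<pi> y) \<and>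
     (\<forall>c. \<forall>x\<in>carrier A. \<pi> (c \<odot>\<^bsub>A\<^esub> x) = c \<cdot>\<^sub>m \<pi> x) \<and>
     (\<forall>x\<in>carrier A. \<pi> (star A x) = mat_adjoint (\<pi> x))"

definition RFD :: "'a star_alg \<Rightarrow> bool" where
  "RFD A \<longleftrightarrow>
     (\<forall>x\<in>carrier A. \<forall>y\<in>carrier A. x \<noteq> y \<longrightarrow> (\<exists>n \<pi>. fd_rep A n \<pi> \<and> \<pi> x \<noteq> \<pi> y))"


section \<open>Free *-algebras\<close>

text \<open>A letter is a generator \<open>g\<close>, encoded as \<open>(g, False)\<close>, or its adjoint, encoded as
  \<open>(g, True)\<close>. The convolution product of finitely supported functions on words is
  the product of noncommutative *-polynomials.\<close>

datatype 'g word = Word (letters: "('g \<times> bool) list")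

instantiation word :: (type) monoid_add
begin
definition zero_word :: "'a word" where "0 = Word []"
definition plus_word :: "'a word \<Rightarrow> 'a word \<Rightarrow> 'a word" where
  "u + v = Word (letters u @ letters v)"
instance by standard (auto simp: zero_word_def plus_word_def)
end

definition word_star :: "'g word \<Rightarrow> 'g word" where
  "word_star w = Word (rev (map (\<lambda>(g, b). (g, \<not> b)) (letters w)))"

type_synonym 'g free_alg = "'g word \<Rightarrow>\<^sub>0 complex"

definition gen :: "'g \<Rightarrow> 'g free_alg" where
  "gen g = Poly_Mapping.single (Word [(g, False)]) 1"

definition fscale :: "complex \<Rightarrow> 'g free_alg \<Rightarrow> 'g free_alg" where
  "fscale c f = Poly_Mapping.map ((*) c) f"

definition fstar :: "'g free_alg \<Rightarrow> 'g free_alg" where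
  "fstar f = Poly_Mapping.map cnj (Poly_Mapping.map_key word_star f)"

text \<open>The non-unital free *-algebra on \<open>X\<close>: the empty word is excluded.\<close>

definition free_on :: "'g set \<Rightarrow> 'g free_alg set" where
  "free_on X = {f. \<forall>w\<in>Poly_Mapping.keys f. letters w \<noteq> [] \<and> fst ` set (letters w) \<subseteq> X}"


section \<open>Universal C*-algebras\<close>

definition cstar_seminorm_on :: "'g free_alg set \<Rightarrow> ('g free_alg \<Rightarrow> real) \<Rightarrow> bool" where
  "cstar_seminorm_on F N \<longleftrightarrow>
     (\<forall>x\<in>F. \<forall>y\<in>F. N (x + y) \<le> N x + N y) \<and>
     (\<forall>c. \<forall>x\<in>F. N (fscale c x) = cmod c * N x) \<and>
     (\<forall>x\<in>F. \<forall>y\<in>F. N (x * y) \<le> N x * N y) \<and>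
     (\<forall>x\<in>F. N (fstar x * x) = (N x)\<^sup>2)"

definition seminorms :: "'g set \<Rightarrow> 'g free_alg set \<Rightarrow> ('g free_alg \<Rightarrow> real) set" where
  "seminorms X R = {N. cstar_seminorm_on (free_on X) N \<and> (\<forall>r\<in>R. N r = 0)}"

text \<open>The largest C*-seminorm vanishing on the relators \<open>R\<close>; meaningful when the
  generators are bounded uniformly over all these seminorms.\<close>

definition univ_nrm :: "'g set \<Rightarrow> 'g free_alg set \<Rightarrow> 'g free_alg \<Rightarrow> real" where
  "univ_nrm X R f = (SUP N\<in>seminorms X R. N f)"

text \<open>The Hausdorff completion of the *-algebra \<open>F\<close> in the seminorm \<open>N\<close>: Cauchy sequences
  modulo null sequences.\<close>

definition cauchy_seqs :: "'a::ring set \<Rightarrow> ('a \<Rightarrow> real) \<Rightarrow> (nat \<Rightarrow> 'a) set" where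
  "cauchy_seqs F N =
     {x. (\<forall>n. x n \<in> F) \<and> (\<forall>\<epsilon>>0. \<exists>M. \<forall>m\<ge>M. \<forall>n\<ge>M. N (x m - x n) < \<epsilon>)}"

definition cls :: "'a::ring set \<Rightarrow> ('a \<Rightarrow> real) \<Rightarrow> (nat \<Rightarrow> 'a) \<Rightarrow> (nat \<Rightarrow> 'a) set" where
  "cls F N x = {y \<in> cauchy_seqs F N. (\<lambda>n. N (x n - y n)) \<longlonglongrightarrow> 0}"

definition completion ::
  "'a::ring set \<Rightarrow> (complex \<Rightarrow> 'a \<Rightarrow> 'a) \<Rightarrow> ('a \<Rightarrow> 'a) \<Rightarrow> ('a \<Rightarrow> real) \<Rightarrow> (nat \<Rightarrow> 'a) set star_alg"
  where
  "completion F sc st N =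
     \<lparr>carrier = cls F N ` cauchy_seqs F N,
      monoid.mult = (\<lambda>X Y. \<Union>x\<in>X. \<Union>y\<in>Y. cls F N (\<lambda>n. x n * y n)),
      one = undefined,
      zero = cls F N (\<lambda>n. 0),
      add = (\<lambda>X Y. \<Union>x\<in>X. \<Union>y\<in>Y. cls F N (\<lambda>n. x n + y n)),
      smult = (\<lambda>c X. \<Union>x\<in>X. cls F N (\<lambda>n. sc c (x n))),
      star = (\<lambda>X. \<Union>x\<in>X. cls F N (\<lambda>n. st (x n))),
      nrm = (\<lambda>X. THE r. \<exists>x\<in>X. (\<lambda>n. N (x n)) \<longlonglongrightarrow> r)\<rparr>"

definition universal_cstar ::
  "'g set \<Rightarrow> 'g free_alg set \<Rightarrow> (nat \<Rightarrow> 'g free_alg) set star_alg" where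
  "universal_cstar X R = completion (free_on X) fscale fstar (univ_nrm X R)"

definition universal_elem :: "'g set \<Rightarrow> 'g free_alg set \<Rightarrow> 'g free_alg \<Rightarrow> (nat \<Rightarrow> 'g free_alg) set" where
  "universal_elem X R f = cls (free_on X) (univ_nrm X R) (\<lambda>n. f)"


section \<open>The C*-algebra of an ultragraph\<close>

text \<open>An inequality \<open>q \<le> p\<close> between projections is expressed as \<open>p q = q\<close>.\<close>

definition ck_family ::
  "('v, 'e) ultragraph \<Rightarrow> 'a star_alg \<Rightarrow> ('v set \<Rightarrow> 'a) \<Rightarrow> ('e \<Rightarrow> 'a) \<Rightarrow> bool" where
  "ck_family G B p s \<longleftrightarrow>
     (\<forall>A\<in>gen_verts G. p A \<in> carrier B \<and> p A \<otimes>\<^bsub>B\<^esub> p A = p A \<and> star B (p A) = p A) \<and>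
     (\<forall>e\<in>edges G. s e \<in> carrier B \<and> s e \<otimes>\<^bsub>B\<^esub> star B (s e) \<otimes>\<^bsub>B\<^esub> s e = s e) \<and>
     (\<forall>e\<in>edges G. \<forall>f\<in>edges G. e \<noteq> f \<longrightarrow>
        (s e \<otimes>\<^bsub>B\<^esub> star B (s e)) \<otimes>\<^bsub>B\<^esub> (s f \<otimes>\<^bsub>B\<^esub> star B (s f)) = \<zero>\<^bsub>B\<^esub>) \<and>
     p {} = \<zero>\<^bsub>B\<^esub> \<and>
     (\<forall>A\<in>gen_verts G. \<forall>A'\<in>gen_verts G. p A \<otimes>\<^bsub>B\<^esub> p A' = p (A \<inter> A')) \<and>
     (\<forall>A\<in>gen_verts G. \<forall>A'\<in>gen_verts G. p (A \<union> A') = p A \<oplus>\<^bsub>B\<^esub> p A' \<ominus>\<^bsub>B\<^esub> p (A \<inter> A')) \<and>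
     (\<forall>e\<in>edges G. star B (s e) \<otimes>\<^bsub>B\<^esub> s e = p (rng G e)) \<and>
     (\<forall>e\<in>edges G. p {src G e} \<otimes>\<^bsub>B\<^esub> (s e \<otimes>\<^bsub>B\<^esub> star B (s e)) = s e \<otimes>\<^bsub>B\<^esub> star B (s e)) \<and>
     (\<forall>v. regular G v \<longrightarrow>
        p {v} = (\<Oplus>\<^bsub>B\<^esub>e\<in>emitted G {v}. s e \<otimes>\<^bsub>B\<^esub> star B (s e)))"

datatype ('v, 'e) ug_gen = Proj "'v set" | Iso 'e

definition ug_gens :: "('v, 'e) ultragraph \<Rightarrow> ('v, 'e) ug_gen set" where
  "ug_gens G = Proj ` gen_verts G \<union> Iso ` edges G"

abbreviation fP :: "'v set \<Rightarrow> ('v, 'e) ug_gen free_alg" where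
  "fP A \<equiv> gen (Proj A)"

abbreviation fS :: "'e \<Rightarrow> ('v, 'e) ug_gen free_alg" where
  "fS e \<equiv> gen (Iso e)"

definition ug_relators :: "('v, 'e) ultragraph \<Rightarrow> ('v, 'e) ug_gen free_alg set" where
  "ug_relators G =
     {fP A * fP A - fP A | A. A \<in> gen_verts G} \<union>
     {fstar (fP A) - fP A | A. A \<in> gen_verts G} \<union>
     {fS e * fstar (fS e) * fS e - fS e | e. e \<in> edges G} \<union>
     {(fS e * fstar (fS e)) * (fS f * fstar (fS f)) | e f. e \<in> edges G \<and> f \<in> edges G \<and> e \<noteq> f} \<union>
     {fP {}} \<union>
     {fP A * fP B - fP (A \<inter> B) | A B. A \<in> gen_verts G \<and> B \<in> gen_verts G} \<union>
     {fP (A \<union> B) - (fP A + fP B - fP (A \<inter> B)) | A B. A \<in> gen_verts G \<and> B \<in> gen_verts G} \<union>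
     {fstar (fS e) * fS e - fP (rng G e) | e. e \<in> edges G} \<union>
     {fP {src G e} * (fS e * fstar (fS e)) - fS e * fstar (fS e) | e. e \<in> edges G} \<union>
     {fP {v} - (\<Sum>e\<in>emitted G {v}. fS e * fstar (fS e)) | v. regular G v}"

definition ultragraph_cstar ::
  "('v, 'e) ultragraph \<Rightarrow> (nat \<Rightarrow> ('v, 'e) ug_gen free_alg) set star_alg" where
  "ultragraph_cstar G = universal_cstar (ug_gens G) (ug_relators G)"

definition ug_proj :: "('v, 'e) ultragraph \<Rightarrow> 'v set \<Rightarrow> (nat \<Rightarrow> ('v, 'e) ug_gen free_alg) set" where
  "ug_proj G A = universal_elem (ug_gens G) (ug_relators G) (fP A)"

definition ug_iso :: "('v, 'e) ultragraph \<Rightarrow> 'e \<Rightarrow> (nat \<Rightarrow> ('v, 'e) ug_gen free_alg) set" where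
  "ug_iso G e = universal_elem (ug_gens G) (ug_relators G) (fS e)"


section \<open>The completion is a C*-algebra\<close>

locale cstar_seminormed =
  fixes F :: "'a::ring set" and sc :: "complex \<Rightarrow> 'a \<Rightarrow> 'a" and st :: "'a \<Rightarrow> 'a" and N :: "'a \<Rightarrow> real"
  assumes F_zero: "0 \<in> F"
    and F_add: "x \<in> F \<Longrightarrow> y \<in> F \<Longrightarrow> x + y \<in> F"
    and F_mult: "x \<in> F \<Longrightarrow> y \<in> F \<Longrightarrow> x * y \<in> F"
    and F_sc: "x \<in> F \<Longrightarrow> sc c x \<in> F"
    and F_st: "x \<in> F \<Longrightarrow> st x \<in> F"
    and sc_add_right: "sc c (x + y) = sc c x + sc c y"
    and sc_add_left: "sc (c + d) x = sc c x + sc d x"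
    and sc_sc: "sc c (sc d x) = sc (c * d) x"
    and sc_one: "sc 1 x = x"
    and sc_mult_left: "sc c x * y = sc c (x * y)"
    and sc_mult_right: "x * sc c y = sc c (x * y)"
    and st_add: "st (x + y) = st x + st y"
    and st_sc: "st (sc c x) = sc (cnj c) (st x)"
    and st_mult: "st (x * y) = st y * st x"
    and st_st: "st (st x) = x"
    and N_add: "x \<in> F \<Longrightarrow> y \<in> F \<Longrightarrow> N (x + y) \<le> N x + N y"
    and N_sc: "x \<in> F \<Longrightarrow> N (sc c x) = cmod c * N x"
    and N_mult: "x \<in> F \<Longrightarrow> y \<in> F \<Longrightarrow> N (x * y) \<le> N x * N y"
    and N_cstar: "x \<in> F \<Longrightarrow> N (st x * x) = (N x)\<^sup>2"
begin

lemma sc_0: "sc 0 x = 0"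
  using sc_add_left[of 0 0 x] by simp

lemma sc_minus1: "sc (-1) x = - x"
  using sc_add_left[of 1 "-1" x] by (simp add: sc_0 sc_one eq_neg_iff_add_eq_0 add.commute)

lemma F_uminus: "x \<in> F \<Longrightarrow> - x \<in> F"
  using F_sc[of x "-1"] by (simp add: sc_minus1)

lemma F_diff: "x \<in> F \<Longrightarrow> y \<in> F \<Longrightarrow> x - y \<in> F"
  using F_add[of x "- y"] F_uminus by simp

lemma sc_diff: "sc c (x - y) = sc c x - sc c y"
  using sc_add_right[of c "x - y" y] by simp

lemma st_diff: "st (x - y) = st x - st y"
  using st_add[of "x - y" y] by simp

lemma N_zero: "N 0 = 0"
  using N_sc[OF F_zero, of 0] by (simp add: sc_0)

lemma N_uminus: "x \<in> F \<Longrightarrow> N (- x) = N x"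
  using N_sc[of x "-1"] by (simp add: sc_minus1)

lemma N_nonneg: "x \<in> F \<Longrightarrow> N x \<ge> 0"
  using N_add[of x "- x"] by (simp add: N_zero N_uminus F_uminus)

lemma N_diff_commute: "x \<in> F \<Longrightarrow> y \<in> F \<Longrightarrow> N (x - y) = N (y - x)"
  using N_uminus[of "x - y"] F_diff by simp

lemma N_tri: "x \<in> F \<Longrightarrow> y \<in> F \<Longrightarrow> z \<in> F \<Longrightarrow> N (x - z) \<le> N (x - y) + N (y - z)"
  using N_add[of "x - y" "y - z"] F_diff by simp

lemma N_diff: "x \<in> F \<Longrightarrow> y \<in> F \<Longrightarrow> \<bar>N x - N y\<bar> \<le> N (x - y)"
  using N_add[of "x - y" y] N_add[of "y - x" x] N_diff_commute[of x y] F_diff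
  by (simp add: abs_le_iff)

lemma N_st_le: assumes "x \<in> F" shows "N x \<le> N (st x)"
proof (cases "N x = 0")
  case False
  then have "N x > 0" using N_nonneg[OF assms] by simp
  moreover have "N x * N x \<le> N (st x) * N x"
    using N_cstar[OF assms] N_mult[of "st x" x] assms F_st by (simp add: power2_eq_square)
  ultimately show ?thesis by simp
qed (use N_nonneg F_st assms in auto)

lemma N_st: "x \<in> F \<Longrightarrow> N (st x) = N x"
  using N_st_le[of x] N_st_le[of "st x"] F_st by (simp add: st_st)

abbreviation "cs \<equiv> cauchy_seqs F N"
abbreviation "cl \<equiv> cls F N"
abbreviation "A \<equiv> completion F sc st N"

lemma cs_F: "x \<in> cs \<Longrightarrow> x n \<in> F"
  by (simp add: cauchy_seqs_def)

lemma cs_iff: "x \<in> cs \<longleftrightarrow> (\<forall>n. x n \<in> F) \<and>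
  ((\<lambda>p. N (x (fst p) - x (snd p))) \<longlongrightarrow> 0) (sequentially \<times>\<^sub>F sequentially)"
proof -
  have "((\<lambda>p. N (x (fst p) - x (snd p))) \<longlongrightarrow> 0) (sequentially \<times>\<^sub>F sequentially)
    \<longleftrightarrow> (\<forall>\<epsilon>>0. \<exists>M. \<forall>m\<ge>M. \<forall>n\<ge>M. N (x m - x n) < \<epsilon>)" if "\<forall>n. x n \<in> F"
    unfolding tendsto_iff eventually_prod_sequentially
    using that by (simp add: N_nonneg F_diff dist_real_def) blast
  then show ?thesis by (auto simp: cauchy_seqs_def)
qed

lemma cs_lim: "x \<in> cs \<Longrightarrow> ((\<lambda>p. N (x (fst p) - x (snd p))) \<longlongrightarrow> 0) (sequentially \<times>\<^sub>F sequentially)"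
  by (simp add: cs_iff)

lemma cs_conv: assumes "x \<in> cs" shows "convergent (\<lambda>n. N (x n))"
proof -
  have "Cauchy (\<lambda>n. N (x n))"
    unfolding Cauchy_def dist_real_def
  proof (intro allI impI)
    fix e :: real assume "e > 0"
    then obtain M where "\<forall>m\<ge>M. \<forall>n\<ge>M. N (x m - x n) < e"
      using assms by (auto simp: cauchy_seqs_def)
    then show "\<exists>M. \<forall>m\<ge>M. \<forall>n\<ge>M. \<bar>N (x m) - N (x n)\<bar> < e"
      using N_diff cs_F[OF assms] by (meson le_less_trans)
  qed
  then show ?thesis by (simp add: Cauchy_convergent_iff)
qed

lemma cs_bounded: assumes "x \<in> cs" shows "\<exists>K\<ge>0. \<forall>n. N (x n) \<le> K"
proof -
  have "Bseq (\<lambda>n. N (x n))" using cs_conv[OF assms] by (rule convergent_imp_Bseq)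
  then show ?thesis by (auto simp: Bseq_def abs_le_iff intro: less_imp_le)
qed

lemma cs_const: "a \<in> F \<Longrightarrow> (\<lambda>n. a) \<in> cs"
  by (simp add: cs_iff N_zero)

lemma cs_add: assumes "x \<in> cs" "y \<in> cs" shows "(\<lambda>n. x n + y n) \<in> cs"
  unfolding cs_iff
proof (intro conjI allI)
  fix n show "x n + y n \<in> F" using assms by (simp add: cs_F F_add)
next
  have *: "((\<lambda>p. N (x (fst p) - x (snd p)) + N (y (fst p) - y (snd p))) \<longlongrightarrow> 0) (sequentially \<times>\<^sub>F sequentially)"
    using tendsto_add[OF cs_lim[OF assms(1)] cs_lim[OF assms(2)]] by simp
  show "((\<lambda>p. N (x (fst p) + y (fst p) - (x (snd p) + y (snd p)))) \<longlongrightarrow> 0) (sequentially \<times>\<^sub>F sequentially)"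
    apply (rule Lim_null_comparison[OF _ *], rule always_eventually)
    using assms by (auto simp: cs_F F_diff F_add N_nonneg add_diff_add intro!: N_add)
qed

lemma cs_sc: assumes "x \<in> cs" shows "(\<lambda>n. sc c (x n)) \<in> cs"
  unfolding cs_iff
proof (intro conjI allI)
  fix n show "sc c (x n) \<in> F" using assms by (simp add: cs_F F_sc)
next
  have "((\<lambda>p. cmod c * N (x (fst p) - x (snd p))) \<longlongrightarrow> 0) (sequentially \<times>\<^sub>F sequentially)"
    using tendsto_mult_left[OF cs_lim[OF assms], of "cmod c"] by simp
  then show "((\<lambda>p. N (sc c (x (fst p)) - sc c (x (snd p)))) \<longlongrightarrow> 0) (sequentially \<times>\<^sub>F sequentially)"
    using assms by (simp add: sc_diff[symmetric] N_sc cs_F F_diff)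
qed

lemma cs_st: assumes "x \<in> cs" shows "(\<lambda>n. st (x n)) \<in> cs"
  using assms by (simp add: cs_iff st_diff[symmetric] N_st F_diff F_st)

lemma N_mult_diff:
  assumes "a \<in> F" "b \<in> F" "c \<in> F" "d \<in> F"
  shows "N (a * b - c * d) \<le> N (a - c) * N b + N c * N (b - d)"
proof -
  have "a * b - c * d = (a - c) * b + c * (b - d)" by (simp add: algebra_simps)
  then have "N (a * b - c * d) \<le> N ((a - c) * b) + N (c * (b - d))"
    using assms by (simp add: N_add F_mult F_diff)
  also have "\<dots> \<le> N (a - c) * N b + N c * N (b - d)"
    using assms by (intro add_mono N_mult F_diff)
  finally show ?thesis .
qed

lemma cs_mult: assumes "x \<in> cs" "y \<in> cs" shows "(\<lambda>n. x n * y n) \<in> cs"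
  unfolding cs_iff
proof (intro conjI allI)
  fix n show "x n * y n \<in> F" using assms by (simp add: cs_F F_mult)
next
  obtain K where K: "K \<ge> 0" "\<And>n. N (x n) \<le> K" using cs_bounded[OF assms(1)] by blast
  obtain L where L: "L \<ge> 0" "\<And>n. N (y n) \<le> L" using cs_bounded[OF assms(2)] by blast
  have *: "((\<lambda>p. N (x (fst p) - x (snd p)) * L + K * N (y (fst p) - y (snd p))) \<longlongrightarrow> 0) (sequentially \<times>\<^sub>F sequentially)"
    using tendsto_add[OF tendsto_mult_right[OF cs_lim[OF assms(1)], of L] tendsto_mult_left[OF cs_lim[OF assms(2)], of K]] by simp
  have "N (x (fst p) * y (fst p) - x (snd p) * y (snd p)) \<le>
     N (x (fst p) - x (snd p)) * L + K * N (y (fst p) - y (snd p))" for p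
    by (rule order_trans[OF N_mult_diff add_mono[OF mult_left_mono mult_right_mono]])
       (use assms K L in \<open>auto simp: cs_F F_diff N_nonneg\<close>)
  then show "((\<lambda>p. N (x (fst p) * y (fst p) - (x (snd p) * y (snd p)))) \<longlongrightarrow> 0) (sequentially \<times>\<^sub>F sequentially)"
    using assms by (intro Lim_null_comparison[OF _ *] always_eventually) (auto simp: N_nonneg cs_F F_diff F_mult)
qed

definition eqv :: "(nat \<Rightarrow> 'a) \<Rightarrow> (nat \<Rightarrow> 'a) \<Rightarrow> bool" where
  "eqv x y \<longleftrightarrow> (\<lambda>n. N (x n - y n)) \<longlonglongrightarrow> 0"

lemma eqv_refl: "eqv x x" by (simp add: eqv_def N_zero)

lemma eqv_sym: "x \<in> cs \<Longrightarrow> y \<in> cs \<Longrightarrow> eqv x y \<Longrightarrow> eqv y x"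
  by (simp add: eqv_def N_diff_commute cs_F)

lemma eqv_trans: assumes "x \<in> cs" "y \<in> cs" "z \<in> cs" "eqv x y" "eqv y z" shows "eqv x z"
proof -
  have *: "(\<lambda>n. N (x n - y n) + N (y n - z n)) \<longlonglongrightarrow> 0"
    using tendsto_add[OF assms(4,5)[unfolded eqv_def]] by simp
  show ?thesis unfolding eqv_def
    using assms by (intro Lim_null_comparison[OF _ *] always_eventually) (auto simp: N_nonneg cs_F F_diff N_tri)
qed

lemma mem_cl: "y \<in> cl x \<longleftrightarrow> y \<in> cs \<and> eqv x y"
  by (simp add: cls_def eqv_def)

lemma cl_self: "x \<in> cs \<Longrightarrow> x \<in> cl x" by (simp add: mem_cl eqv_refl)

lemma cl_eq_iff: "x \<in> cs \<Longrightarrow> y \<in> cs \<Longrightarrow> cl x = cl y \<longleftrightarrow> eqv x y"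
  by (auto simp: mem_cl set_eq_iff intro: eqv_refl eqv_sym eqv_trans dest: spec[of _ y])

lemma eqv_add: assumes "x \<in> cs" "y \<in> cs" "x' \<in> cs" "y' \<in> cs" "eqv x x'" "eqv y y'"
  shows "eqv (\<lambda>n. x n + y n) (\<lambda>n. x' n + y' n)"
proof -
  have *: "(\<lambda>n. N (x n - x' n) + N (y n - y' n)) \<longlonglongrightarrow> 0"
    using tendsto_add[OF assms(5,6)[unfolded eqv_def]] by simp
  show ?thesis unfolding eqv_def
    using assms by (intro Lim_null_comparison[OF _ *] always_eventually)
      (auto simp: N_nonneg cs_F F_diff F_add add_diff_add intro!: N_add)
qed

lemma eqv_mult: assumes "x \<in> cs" "y \<in> cs" "x' \<in> cs" "y' \<in> cs" "eqv x x'" "eqv y y'"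
  shows "eqv (\<lambda>n. x n * y n) (\<lambda>n. x' n * y' n)"
proof -
  obtain K where K: "K \<ge> 0" "\<And>n. N (x' n) \<le> K" using cs_bounded[OF assms(3)] by blast
  obtain L where L: "L \<ge> 0" "\<And>n. N (y n) \<le> L" using cs_bounded[OF assms(2)] by blast
  have *: "(\<lambda>n. N (x n - x' n) * L + K * N (y n - y' n)) \<longlonglongrightarrow> 0"
    using tendsto_add[OF tendsto_mult_right[OF assms(5)[unfolded eqv_def], of L]
        tendsto_mult_left[OF assms(6)[unfolded eqv_def], of K]] by simp
  have "N (x n * y n - x' n * y' n) \<le> N (x n - x' n) * L + K * N (y n - y' n)" for n
    by (rule order_trans[OF N_mult_diff add_mono[OF mult_left_mono mult_right_mono]])
       (use assms K L in \<open>auto simp: cs_F F_diff N_nonneg\<close>)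
  then show ?thesis unfolding eqv_def
    using assms by (intro Lim_null_comparison[OF _ *] always_eventually) (auto simp: N_nonneg cs_F F_diff F_mult)
qed

lemma eqv_sc: assumes "x \<in> cs" "y \<in> cs" "eqv x y" shows "eqv (\<lambda>n. sc c (x n)) (\<lambda>n. sc c (y n))"
  using tendsto_mult_left[OF assms(3)[unfolded eqv_def], of "cmod c"] assms
  by (simp add: eqv_def sc_diff[symmetric] N_sc cs_F F_diff)

lemma eqv_st: assumes "x \<in> cs" "y \<in> cs" "eqv x y" shows "eqv (\<lambda>n. st (x n)) (\<lambda>n. st (y n))"
  using assms by (simp add: eqv_def st_diff[symmetric] N_st cs_F F_diff)

lemma carrier_A: "carrier A = cl ` cs" by (simp add: completion_def)

lemma zero_A: "\<zero>\<^bsub>A\<^esub> = cl (\<lambda>n. 0)" by (simp add: completion_def)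

lemma add_A: assumes "x \<in> cs" "y \<in> cs" shows "cl x \<oplus>\<^bsub>A\<^esub> cl y = cl (\<lambda>n. x n + y n)"
proof -
  have "cl x \<oplus>\<^bsub>A\<^esub> cl y = (\<Union>x'\<in>cl x. \<Union>y'\<in>cl y. cl (\<lambda>n. x' n + y' n))"
    by (simp add: completion_def)
  also have "\<dots> = (\<Union>x'\<in>cl x. \<Union>y'\<in>cl y. cl (\<lambda>n. x n + y n))"
    using assms by (intro SUP_cong refl, subst eq_commute, subst cl_eq_iff) (auto simp: mem_cl cs_add intro!: eqv_add)
  also have "\<dots> = cl (\<lambda>n. x n + y n)"
    using cl_self[OF assms(1)] cl_self[OF assms(2)] by auto
  finally show ?thesis .
qed

lemma mult_A: assumes "x \<in> cs" "y \<in> cs" shows "cl x \<otimes>\<^bsub>A\<^esub> cl y = cl (\<lambda>n. x n * y n)"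
proof -
  have "cl x \<otimes>\<^bsub>A\<^esub> cl y = (\<Union>x'\<in>cl x. \<Union>y'\<in>cl y. cl (\<lambda>n. x' n * y' n))"
    by (simp add: completion_def)
  also have "\<dots> = (\<Union>x'\<in>cl x. \<Union>y'\<in>cl y. cl (\<lambda>n. x n * y n))"
    using assms by (intro SUP_cong refl, subst eq_commute, subst cl_eq_iff) (auto simp: mem_cl cs_mult intro!: eqv_mult)
  also have "\<dots> = cl (\<lambda>n. x n * y n)"
    using cl_self[OF assms(1)] cl_self[OF assms(2)] by auto
  finally show ?thesis .
qed

lemma scale_A: assumes "x \<in> cs" shows "c \<odot>\<^bsub>A\<^esub> cl x = cl (\<lambda>n. sc c (x n))"
proof -
  have "c \<odot>\<^bsub>A\<^esub> cl x = (\<Union>x'\<in>cl x. cl (\<lambda>n. sc c (x' n)))"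
    by (simp add: completion_def)
  also have "\<dots> = (\<Union>x'\<in>cl x. cl (\<lambda>n. sc c (x n)))"
    using assms by (intro SUP_cong refl, subst eq_commute, subst cl_eq_iff) (auto simp: mem_cl cs_sc intro!: eqv_sc)
  also have "\<dots> = cl (\<lambda>n. sc c (x n))"
    using cl_self[OF assms(1)] by auto
  finally show ?thesis .
qed

lemma star_A: assumes "x \<in> cs" shows "star A (cl x) = cl (\<lambda>n. st (x n))"
proof -
  have "star A (cl x) = (\<Union>x'\<in>cl x. cl (\<lambda>n. st (x' n)))"
    by (simp add: completion_def)
  also have "\<dots> = (\<Union>x'\<in>cl x. cl (\<lambda>n. st (x n)))"
    using assms by (intro SUP_cong refl, subst eq_commute, subst cl_eq_iff) (auto simp: mem_cl cs_st intro!: eqv_st)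
  also have "\<dots> = cl (\<lambda>n. st (x n))"
    using cl_self[OF assms(1)] by auto
  finally show ?thesis .
qed

lemma nrm_A: assumes "x \<in> cs" shows "(\<lambda>n. N (x n)) \<longlonglongrightarrow> nrm A (cl x)"
proof -
  obtain r where r: "(\<lambda>n. N (x n)) \<longlonglongrightarrow> r" using cs_conv[OF assms] by (auto simp: convergent_def)
  have "(\<lambda>n. N (y n)) \<longlonglongrightarrow> r" if "y \<in> cl x" for y
  proof -
    have y: "y \<in> cs" "eqv x y" using that by (auto simp: mem_cl)
    have "(\<lambda>n. N (y n) - N (x n)) \<longlonglongrightarrow> 0"
      by (rule Lim_null_comparison[OF _ y(2)[unfolded eqv_def]], rule always_eventually)
         (use N_diff cs_F[OF assms] cs_F[OF y(1)] N_diff_commute in \<open>auto simp: abs_minus_commute\<close>)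
    from tendsto_add[OF this r] show ?thesis by simp
  qed
  then have "(THE r. \<exists>y\<in>cl x. (\<lambda>n. N (y n)) \<longlonglongrightarrow> r) = r"
    using cl_self[OF assms] r by (intro the_equality) (auto intro: LIMSEQ_unique)
  then show ?thesis using r by (simp add: completion_def)
qed

lemma nrm_A_const: "a \<in> F \<Longrightarrow> nrm A (cl (\<lambda>n. a)) = N a"
  using nrm_A[OF cs_const] LIMSEQ_unique tendsto_const by blast

lemma abelian_group_A: "abelian_group A"
proof (rule abelian_groupI)
  fix x y assume "x \<in> carrier A" "y \<in> carrier A"
  then show "x \<oplus>\<^bsub>A\<^esub> y \<in> carrier A" by (auto simp: carrier_A add_A cs_add)
next
  show "\<zero>\<^bsub>A\<^esub> \<in> carrier A" by (auto simp: carrier_A zero_A cs_const F_zero)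
next
  fix x y z assume "x \<in> carrier A" "y \<in> carrier A" "z \<in> carrier A"
  then show "x \<oplus>\<^bsub>A\<^esub> y \<oplus>\<^bsub>A\<^esub> z = x \<oplus>\<^bsub>A\<^esub> (y \<oplus>\<^bsub>A\<^esub> z)"
    by (auto simp: carrier_A add_A cs_add add.assoc)
next
  fix x y assume "x \<in> carrier A" "y \<in> carrier A"
  then show "x \<oplus>\<^bsub>A\<^esub> y = y \<oplus>\<^bsub>A\<^esub> x" by (auto simp: carrier_A add_A cs_add add.commute)
next
  fix x assume "x \<in> carrier A"
  then show "\<zero>\<^bsub>A\<^esub> \<oplus>\<^bsub>A\<^esub> x = x" by (auto simp: carrier_A zero_A add_A cs_const F_zero)
next
  fix x assume "x \<in> carrier A"
  then obtain u where u: "u \<in> cs" "x = cl u" by (auto simp: carrier_A)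
  have "cl (\<lambda>n. sc (-1) (u n)) \<oplus>\<^bsub>A\<^esub> x = \<zero>\<^bsub>A\<^esub>"
    using u by (simp add: add_A cs_sc zero_A) (simp add: sc_minus1)
  then show "\<exists>y\<in>carrier A. y \<oplus>\<^bsub>A\<^esub> x = \<zero>\<^bsub>A\<^esub>"
    using cs_sc[OF u(1)] by (auto simp: carrier_A)
qed

lemma cs_diff: "x \<in> cs \<Longrightarrow> y \<in> cs \<Longrightarrow> (\<lambda>n. x n - y n) \<in> cs"
  using cs_add[OF _ cs_sc[of y "-1"], of x] by (simp add: sc_minus1)

lemma minus_A: assumes "x \<in> cs" "y \<in> cs" shows "cl x \<ominus>\<^bsub>A\<^esub> cl y = cl (\<lambda>n. x n - y n)"
proof -
  interpret abelian_group A by (rule abelian_group_A)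
  have 1: "cl (\<lambda>n. x n - y n) \<oplus>\<^bsub>A\<^esub> cl y = cl x"
    using assms by (simp add: add_A cs_diff)
  have 2: "(a \<oplus>\<^bsub>A\<^esub> b) \<ominus>\<^bsub>A\<^esub> b = a" if "a \<in> carrier A" "b \<in> carrier A" for a b
    using that by (simp add: minus_eq a_assoc r_neg)
  have 3: "cl (\<lambda>n. x n - y n) \<in> carrier A" "cl y \<in> carrier A"
    using assms cs_diff by (auto simp: carrier_A)
  show ?thesis using 2[OF 3] unfolding 1 .
qed

lemma complete_A:
  assumes X: "\<And>n. X n \<in> carrier A"
    and C: "\<And>e. e > 0 \<Longrightarrow> \<exists>M::nat. \<forall>m\<ge>M. \<forall>n\<ge>M. nrm A (X m \<ominus>\<^bsub>A\<^esub> X n) < e"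
  shows "\<exists>L\<in>carrier A. (\<lambda>n. nrm A (X n \<ominus>\<^bsub>A\<^esub> L)) \<longlonglongrightarrow> 0"
proof -
  have "\<forall>n. \<exists>u. u \<in> cs \<and> X n = cl u" using X by (auto simp: carrier_A)
  then obtain x where x: "\<And>n. x n \<in> cs" "\<And>n. X n = cl (x n)" by metis
  have xF: "x n i \<in> F" for n i using cs_F[OF x(1)] .
  have "\<forall>n. \<exists>k. \<forall>i\<ge>k. \<forall>j\<ge>k. N (x n i - x n j) < inverse (real (Suc n))"
    using x(1) by (auto simp: cauchy_seqs_def)
  then obtain k where k: "\<And>n i j. i \<ge> k n \<Longrightarrow> j \<ge> k n \<Longrightarrow> N (x n i - x n j) < inverse (real (Suc n))"
    by metis
  define y where "y n = x n (k n)" for n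
  have yF: "y n \<in> F" for n by (simp add: y_def xF)
  have small: "\<exists>M. \<forall>n\<ge>M. inverse (real (Suc n)) < e" if "e > 0" for e :: real
    using order_tendstoD(2)[OF LIMSEQ_inverse_real_of_nat that] by (simp add: eventually_sequentially)
  have lim: "(\<lambda>i. N (x m i - x n i)) \<longlonglongrightarrow> nrm A (X m \<ominus>\<^bsub>A\<^esub> X n)" for m n
    using nrm_A[OF cs_diff[OF x(1) x(1)]] by (simp add: minus_A x)
  have ybound: "N (y m - x n i) \<le> inverse (real (Suc m)) + N (x m i - x n i)" if "i \<ge> k m" for m n i
    using N_tri[of "y m" "x m i" "x n i"] k[of m "k m" i] that xF yF by (simp add: y_def)
  have yC: "y \<in> cs"
    unfolding cauchy_seqs_def
  proof (intro CollectI conjI allI impI yF)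
    fix e :: real assume "e > 0"
    then obtain M1 where M1: "\<forall>n\<ge>M1. inverse (real (Suc n)) < e / 3" using small[of "e / 3"] by auto
    obtain M2 where M2: "\<forall>m\<ge>M2. \<forall>n\<ge>M2. nrm A (X m \<ominus>\<^bsub>A\<^esub> X n) < e / 3"
      using C[of "e / 3"] \<open>e > 0\<close> by auto
    have "N (y m - y n) < e" if "m \<ge> max M1 M2" "n \<ge> max M1 M2" for m n
    proof -
      have "\<forall>\<^sub>F i in sequentially. N (x m i - x n i) < e / 3"
        using order_tendstoD(2)[OF lim[of m n], of "e / 3"] M2 that by simp
      then have "\<forall>\<^sub>F i in sequentially. N (x m i - x n i) < e / 3 \<and> i \<ge> k m \<and> i \<ge> k n"
        by (intro eventually_conj eventually_ge_at_top)
      then obtain i where i: "N (x m i - x n i) < e / 3" "i \<ge> k m" "i \<ge> k n"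
        by (auto dest!: eventually_happens)
      have "N (y m - y n) \<le> N (y m - x n i) + N (x n i - y n)" by (rule N_tri[OF yF xF yF])
      also have "N (x n i - y n) < inverse (real (Suc n))" using k[of n i "k n"] i by (simp add: y_def)
      also have "N (y m - x n i) \<le> inverse (real (Suc m)) + N (x m i - x n i)" by (rule ybound[OF i(2)])
      finally have "N (y m - y n) < inverse (real (Suc m)) + N (x m i - x n i) + inverse (real (Suc n))" by simp
      moreover have "inverse (real (Suc m)) < e / 3" "inverse (real (Suc n)) < e / 3" using M1 that by auto
      ultimately show ?thesis using i(1) by linarith
    qed
    then show "\<exists>M. \<forall>m\<ge>M. \<forall>n\<ge>M. N (y m - y n) < e" by blast
  qed
  have "(\<lambda>n. nrm A (X n \<ominus>\<^bsub>A\<^esub> cl y)) \<longlonglongrightarrow> 0"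
  proof (rule LIMSEQ_I)
    fix e :: real assume "e > 0"
    then obtain M1 where M1: "\<forall>n\<ge>M1. inverse (real (Suc n)) < e / 4" using small[of "e / 4"] by auto
    obtain M2 where M2: "\<forall>m\<ge>M2. \<forall>n\<ge>M2. N (y m - y n) < e / 4"
      using yC \<open>e > 0\<close> unfolding cauchy_seqs_def by (fastforce dest: spec[of _ "e / 4"])
    have "norm (nrm A (X n \<ominus>\<^bsub>A\<^esub> cl y) - 0) < e" if n: "n \<ge> max M1 M2" for n
    proof -
      have l: "(\<lambda>i. N (x n i - y i)) \<longlonglongrightarrow> nrm A (X n \<ominus>\<^bsub>A\<^esub> cl y)"
        using nrm_A[OF cs_diff[OF x(1) yC]] by (simp add: minus_A x yC)
      have "N (x n i - y i) \<le> e / 2" if "i \<ge> max (k n) M2" for i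
      proof -
        have "N (x n i - y i) \<le> N (x n i - y n) + N (y n - y i)" by (rule N_tri[OF xF yF yF])
        moreover have "N (x n i - y n) < inverse (real (Suc n))" using k[of n i "k n"] that by (simp add: y_def)
        moreover have "inverse (real (Suc n)) < e / 4" using M1 n by auto
        moreover have "N (y n - y i) < e / 4" using M2 n that by auto
        ultimately show ?thesis by linarith
      qed
      then have "nrm A (X n \<ominus>\<^bsub>A\<^esub> cl y) \<le> e / 2" by (intro LIMSEQ_le_const2[OF l]) blast
      moreover have "nrm A (X n \<ominus>\<^bsub>A\<^esub> cl y) \<ge> 0"
        by (rule LIMSEQ_le_const[OF l]) (auto simp: N_nonneg F_diff xF yF)
      ultimately show ?thesis using \<open>e > 0\<close> by simp
    qed
    then show "\<exists>no. \<forall>n\<ge>no. norm (nrm A (X n \<ominus>\<^bsub>A\<^esub> cl y) - 0) < e" by blast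
  qed
  then show ?thesis using yC by (auto simp: carrier_A)
qed

lemma cstar_algebra_A: "cstar_algebra A"
proof (rule cstar_algebra.intro[OF abelian_group_A], unfold_locales, goal_cases)
  case (17 x)
  then obtain u where u: "u \<in> cs" "x = cl u" by (auto simp: carrier_A)
  have "nrm A x = 0 \<longleftrightarrow> (\<lambda>n. N (u n)) \<longlonglongrightarrow> 0"
    using nrm_A[OF u(1)] LIMSEQ_unique u(2) by auto
  also have "\<dots> \<longleftrightarrow> x = \<zero>\<^bsub>A\<^esub>"
    using u by (simp add: zero_A cl_eq_iff cs_const F_zero eqv_def)
  finally show ?case .
next
  case (18 x y)
  then obtain u v where u: "u \<in> cs" "x = cl u" and v: "v \<in> cs" "y = cl v" by (auto simp: carrier_A)
  show ?case unfolding u v add_A[OF u(1) v(1)]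
    by (rule LIMSEQ_le[OF nrm_A[OF cs_add[OF u(1) v(1)]] tendsto_add[OF nrm_A[OF u(1)] nrm_A[OF v(1)]]])
       (auto simp: N_add cs_F u v)
next
  case (19 x c)
  then obtain u where u: "u \<in> cs" "x = cl u" by (auto simp: carrier_A)
  have "(\<lambda>n. N (sc c (u n))) \<longlonglongrightarrow> cmod c * nrm A (cl u)"
    using tendsto_mult_left[OF nrm_A[OF u(1)], of "cmod c"] by (simp add: N_sc cs_F u)
  then show ?case using nrm_A[OF cs_sc[OF u(1)]] LIMSEQ_unique by (auto simp: u scale_A)
next
  case (20 x y)
  then obtain u v where u: "u \<in> cs" "x = cl u" and v: "v \<in> cs" "y = cl v" by (auto simp: carrier_A)
  show ?case unfolding u v mult_A[OF u(1) v(1)]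
    by (rule LIMSEQ_le[OF nrm_A[OF cs_mult[OF u(1) v(1)]] tendsto_mult[OF nrm_A[OF u(1)] nrm_A[OF v(1)]]])
       (auto simp: N_mult cs_F u v)
next
  case (21 x)
  then obtain u where u: "u \<in> cs" "x = cl u" by (auto simp: carrier_A)
  have "(\<lambda>n. N (st (u n) * u n)) \<longlonglongrightarrow> (nrm A (cl u))\<^sup>2"
    using tendsto_power[OF nrm_A[OF u(1)], of 2] by (simp add: N_cstar cs_F u)
  then show ?case using nrm_A[OF cs_mult[OF cs_st[OF u(1)] u(1)]] LIMSEQ_unique by (auto simp: u star_A mult_A cs_st)
next
  case (22 X)
  then show ?case using complete_A by blast
qed (auto simp: carrier_A add_A mult_A scale_A star_A cs_add cs_mult cs_sc cs_st mult.assoc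
      distrib_left distrib_right sc_add_right sc_add_left sc_sc sc_one sc_mult_left sc_mult_right
      st_st st_add st_sc st_mult)

end


section \<open>Bounded relators have a universal C*-algebra\<close>

lemma word_star_star [simp]: "word_star (word_star w) = w"
  by (simp add: word_star_def rev_map[symmetric] comp_def case_prod_beta)

lemma word_star_plus: "word_star (u + v) = word_star v + word_star u"
  by (simp add: word_star_def plus_word_def)

lemma inj_word_star: "inj word_star"
  by (metis injI word_star_star)

lemma fst_set_word_star [simp]: "fst ` set (letters (word_star w)) = fst ` set (letters w)"
  by (simp add: word_star_def image_image case_prod_beta)

lemma word_star_Nil_iff [simp]: "letters (word_star w) = [] \<longleftrightarrow> letters w = []"
  by (simp add: word_star_def)

lemma lookup_fscale [simp]: "Poly_Mapping.lookup (fscale c f) w = c * Poly_Mapping.lookup f w"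
  by (simp add: fscale_def Poly_Mapping.map.rep_eq when_def)

lemma lookup_fstar [simp]: "Poly_Mapping.lookup (fstar f) w = cnj (Poly_Mapping.lookup f (word_star w))"
  by (simp add: fstar_def Poly_Mapping.map.rep_eq map_key.rep_eq[OF inj_word_star] when_def)

lemma fscale_conv: "fscale c f = Poly_Mapping.single 0 c * f"
  by (simp add: fscale_def mult_map_scale_conv_mult)

lemma fscale_single: "fscale c (Poly_Mapping.single w d) = Poly_Mapping.single w (c * d)"
  by (rule poly_mapping_eqI) (simp add: lookup_single when_def)

lemma fstar_single: "fstar (Poly_Mapping.single w c) = Poly_Mapping.single (word_star w) (cnj c)"
  by (rule poly_mapping_eqI) (auto simp: lookup_single when_def)

lemma fstar_add: "fstar (f + g) = fstar f + fstar g"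
  by (rule poly_mapping_eqI) (simp add: lookup_add)

lemma fscale_add: "fscale c (f + g) = fscale c f + fscale c g"
  by (rule poly_mapping_eqI) (simp add: lookup_add algebra_simps)

lemma fstar_0 [simp]: "fstar 0 = 0" and fscale_0 [simp]: "fscale c 0 = 0"
  by (rule poly_mapping_eqI, simp)+

lemma free_induct_raw:
  assumes "P 0" "\<And>f g. P f \<Longrightarrow> P g \<Longrightarrow> P (f + g)"
    "\<And>w c. w \<in> Poly_Mapping.keys f \<Longrightarrow> P (Poly_Mapping.single w c)"
  shows "P (f :: 'g free_alg)"
proof -
  have "P (\<Sum>w\<in>S. Poly_Mapping.single w (Poly_Mapping.lookup f w))"
    if "finite S" "S \<subseteq> Poly_Mapping.keys f" for S
    using that by (induction S) (auto intro: assms)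
  moreover have "(\<Sum>w\<in>Poly_Mapping.keys f. Poly_Mapping.single w (Poly_Mapping.lookup f w)) = f"
    by (rule poly_mapping_eqI)
       (simp add: lookup_sum lookup_single when_def in_keys_iff)
  ultimately show ?thesis by (metis finite_keys order_refl)
qed

lemma fscale_mult_left: "fscale c f * g = fscale c (f * g)"
  by (simp add: fscale_conv mult.assoc)

lemma fscale_mult_right: "f * fscale c g = fscale c (f * g)"
proof -
  have "f * Poly_Mapping.single 0 c = Poly_Mapping.single 0 c * f"
    by (rule free_induct_raw[of _ f]) (simp_all add: distrib_left distrib_right mult_single mult.commute)
  then show ?thesis by (simp add: fscale_conv flip: mult.assoc)
qed

lemma fstar_mult: "fstar (f * g) = fstar g * fstar f"
proof -
  have "fstar (Poly_Mapping.single w c * g) = fstar g * fstar (Poly_Mapping.single w c)" for w c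
    by (rule free_induct_raw[of _ g])
       (simp_all add: distrib_left distrib_right fstar_add mult_single fstar_single word_star_plus mult.commute)
  then show ?thesis
    by - (rule free_induct_raw[of _ f], simp_all add: distrib_left distrib_right fstar_add)
qed

lemma free_on_0: "0 \<in> free_on X"
  by (simp add: free_on_def)

lemma free_on_add: "f \<in> free_on X \<Longrightarrow> g \<in> free_on X \<Longrightarrow> f + g \<in> free_on X"
  using keys_add[of f g] by (auto simp: free_on_def)

lemma free_on_fscale: "f \<in> free_on X \<Longrightarrow> fscale c f \<in> free_on X"
  by (auto simp: free_on_def in_keys_iff)

lemma free_on_fstar: assumes "f \<in> free_on X" shows "fstar f \<in> free_on X"
  unfolding free_on_def
proof (intro CollectI ballI)
  fix w assume "w \<in> Poly_Mapping.keys (fstar f)"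
  then have "word_star w \<in> Poly_Mapping.keys f" by (simp add: in_keys_iff)
  then have "letters (word_star w) \<noteq> [] \<and> fst ` set (letters (word_star w)) \<subseteq> X"
    using assms unfolding free_on_def by blast
  then show "letters w \<noteq> [] \<and> fst ` set (letters w) \<subseteq> X" by simp
qed

lemma free_on_mult: "f \<in> free_on X \<Longrightarrow> g \<in> free_on X \<Longrightarrow> f * g \<in> free_on X"
  using keys_mult[of f g] by (fastforce simp: free_on_def plus_word_def)

lemma free_on_gen: "x \<in> X \<Longrightarrow> gen x \<in> free_on X"
  by (simp add: free_on_def gen_def)

lemma free_on_uminus: "f \<in> free_on X \<Longrightarrow> - f \<in> free_on X"
  by (simp add: free_on_def in_keys_iff)

lemma free_on_diff: "f \<in> free_on X \<Longrightarrow> g \<in> free_on X \<Longrightarrow> f - g \<in> free_on X"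
  using free_on_add[of f X "- g"] free_on_uminus[of g X] by simp

lemma free_on_sum: "(\<And>i. i \<in> I \<Longrightarrow> f i \<in> free_on X) \<Longrightarrow> sum f I \<in> free_on X"
  by (induction I rule: infinite_finite_induct) (auto simp: free_on_0 free_on_add)

lemma word_induct:
  assumes "fst ` set (letters w) \<subseteq> X" "letters w \<noteq> []"
    and "\<And>x. x \<in> X \<Longrightarrow> P (gen x)" "\<And>x. x \<in> X \<Longrightarrow> P (fstar (gen x))"
    and "\<And>f g. f \<in> free_on X \<Longrightarrow> g \<in> free_on X \<Longrightarrow> P f \<Longrightarrow> P g \<Longrightarrow> P (f * g)"
  shows "P (Poly_Mapping.single w 1)"
proof -
  have letter: "P (Poly_Mapping.single (Word [a]) 1)" if "fst a \<in> X" for a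
    using assms(3,4)[of "fst a"] that
    by (cases a, cases "snd a") (auto simp: gen_def fstar_single word_star_def)
  have "P (Poly_Mapping.single (Word l) 1)" if "fst ` set l \<subseteq> X" "l \<noteq> []" for l
    using that
  proof (induction l)
    case (Cons a l)
    show ?case
    proof (cases "l = []")
      case False
      have "Poly_Mapping.single (Word (a # l)) (1::complex) = Poly_Mapping.single (Word [a]) 1 * Poly_Mapping.single (Word l) 1"
        by (simp add: mult_single plus_word_def)
      moreover have "P (\<dots>)"
        by (rule assms(5)) (use Cons False letter in \<open>auto simp: free_on_def\<close>)
      ultimately show ?thesis by simp
    qed (use Cons letter in auto)
  qed simp
  then show ?thesis using assms(1,2) by (cases w) auto
qed

lemma free_on_induct [consumes 1, case_names zero add scale mult gen star]:
  assumes "f \<in> free_on X" "P 0"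
    and "\<And>f g. f \<in> free_on X \<Longrightarrow> g \<in> free_on X \<Longrightarrow> P f \<Longrightarrow> P g \<Longrightarrow> P (f + g)"
    and "\<And>c f. f \<in> free_on X \<Longrightarrow> P f \<Longrightarrow> P (fscale c f)"
    and "\<And>f g. f \<in> free_on X \<Longrightarrow> g \<in> free_on X \<Longrightarrow> P f \<Longrightarrow> P g \<Longrightarrow> P (f * g)"
    and "\<And>x. x \<in> X \<Longrightarrow> P (gen x)" "\<And>x. x \<in> X \<Longrightarrow> P (fstar (gen x))"
  shows "P f"
proof -
  have "f \<in> free_on X \<and> P f"
  proof (rule free_induct_raw)
    show "0 \<in> free_on X \<and> P 0" using assms(2) by (simp add: free_on_0)
    show "f + g \<in> free_on X \<and> P (f + g)" if "f \<in> free_on X \<and> P f" "g \<in> free_on X \<and> P g" for f g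
      using that assms(3) free_on_add by blast
    fix w c assume "w \<in> Poly_Mapping.keys f"
    then have w: "fst ` set (letters w) \<subseteq> X" "letters w \<noteq> []" using assms(1) by (auto simp: free_on_def)
    then have 1: "Poly_Mapping.single w 1 \<in> free_on X" by (simp add: free_on_def)
    have "P (Poly_Mapping.single w 1)" by (rule word_induct[OF w assms(6,7,5)])
    then have "P (fscale c (Poly_Mapping.single w 1))" using assms(4) 1 by blast
    moreover have "fscale c (Poly_Mapping.single w 1) = Poly_Mapping.single w c" by (simp add: fscale_single)
    ultimately show "Poly_Mapping.single w c \<in> free_on X \<and> P (Poly_Mapping.single w c)"
      using free_on_fscale[OF 1, of c] by simp
  qed
  then show ?thesis ..
qed

lemma cstar_seminormedI:
  assumes "cstar_seminorm_on (free_on X) N"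
  shows "cstar_seminormed (free_on X) fscale fstar N"
proof
  show "fscale (c + d) x = fscale c x + fscale d x" for c d and x :: "'a free_alg"
    by (rule poly_mapping_eqI) (simp add: lookup_add algebra_simps)
  show "fscale c (fscale d x) = fscale (c * d) x" for c d and x :: "'a free_alg"
    by (rule poly_mapping_eqI) simp
  show "fscale 1 x = x" for x :: "'a free_alg"
    by (rule poly_mapping_eqI) simp
  show "fstar (fscale c x) = fscale (cnj c) (fstar x)" for c and x :: "'a free_alg"
    by (rule poly_mapping_eqI) simp
  show "fstar (fstar x) = x" for x :: "'a free_alg"
    by (rule poly_mapping_eqI) simp
qed (use assms in \<open>simp_all add: cstar_seminorm_on_def free_on_0 free_on_add free_on_mult free_on_fscale
    free_on_fstar fscale_add fscale_mult_left fscale_mult_right fstar_add fstar_mult\<close>)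

lemma cstar_seminorm_onI:
  assumes "cstar_seminormed (free_on X) fscale fstar N"
  shows "cstar_seminorm_on (free_on X) N"
proof -
  interpret cstar_seminormed "free_on X" fscale fstar N by fact
  show ?thesis by (simp add: cstar_seminorm_on_def N_add N_sc N_mult N_cstar)
qed

locale bounded_relators =
  fixes X :: "'g set" and R :: "'g free_alg set"
  assumes bounded_gen: "x \<in> X \<Longrightarrow> \<exists>K. \<forall>N\<in>seminorms X R. N (gen x) \<le> K"
    and R_sub: "R \<subseteq> free_on X"
begin

lemma seminormsD: "N \<in> seminorms X R \<Longrightarrow> cstar_seminormed (free_on X) fscale fstar N"
  by (simp add: seminorms_def cstar_seminormedI)

lemma zero_seminorm: "(\<lambda>f. 0) \<in> seminorms X R"
  by (simp add: seminorms_def cstar_seminorm_on_def)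

lemma bounded: "f \<in> free_on X \<Longrightarrow> \<exists>K. \<forall>N\<in>seminorms X R. N f \<le> K"
proof (induction rule: free_on_induct)
  case zero
  show ?case
    by (rule exI[of _ 0], rule ballI, rule eq_refl, rule cstar_seminormed.N_zero[OF seminormsD])
next
  case (add f g)
  then obtain K L where KL: "\<forall>N\<in>seminorms X R. N f \<le> K" "\<forall>N\<in>seminorms X R. N g \<le> L" by blast
  have "N (f + g) \<le> K + L" if "N \<in> seminorms X R" for N
    using cstar_seminormed.N_add[OF seminormsD[OF that] add.hyps] bspec[OF KL(1) that] bspec[OF KL(2) that]
    by linarith
  then show ?case by blast
next
  case (scale c f)
  then obtain K where K: "\<forall>N\<in>seminorms X R. N f \<le> K" by blast
  have "N (fscale c f) \<le> cmod c * K" if "N \<in> seminorms X R" for N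
    using cstar_seminormed.N_sc[OF seminormsD[OF that] scale.hyps] bspec[OF K that]
    by (simp add: mult_left_mono)
  then show ?case by blast
next
  case (mult f g)
  then obtain K L where KL: "\<forall>N\<in>seminorms X R. N f \<le> K" "\<forall>N\<in>seminorms X R. N g \<le> L" by blast
  have "N (f * g) \<le> \<bar>K\<bar> * \<bar>L\<bar>" if "N \<in> seminorms X R" for N
  proof -
    have "N (f * g) \<le> N f * N g" by (rule cstar_seminormed.N_mult[OF seminormsD[OF that] mult.hyps])
    also have "\<dots> \<le> \<bar>K\<bar> * \<bar>L\<bar>"
      using bspec[OF KL(1) that] bspec[OF KL(2) that] cstar_seminormed.N_nonneg[OF seminormsD[OF that] mult.hyps(2)]
      by (intro mult_mono) auto
    finally show ?thesis .
  qed
  then show ?case by blast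
next
  case (gen x)
  then show ?case by (rule bounded_gen)
next
  case (star x)
  obtain K where K: "\<forall>N\<in>seminorms X R. N (gen x) \<le> K" using bounded_gen[OF star] by blast
  have "N (fstar (gen x)) \<le> K" if "N \<in> seminorms X R" for N
    using cstar_seminormed.N_st[OF seminormsD[OF that] free_on_gen[OF star]] bspec[OF K that] by simp
  then show ?case by blast
qed

lemma bdd: "f \<in> free_on X \<Longrightarrow> bdd_above ((\<lambda>N. N f) ` seminorms X R)"
  using bounded by (fastforce simp: bdd_above_def)

lemma le_univ: "f \<in> free_on X \<Longrightarrow> N \<in> seminorms X R \<Longrightarrow> N f \<le> univ_nrm X R f"
  unfolding univ_nrm_def by (intro cSUP_upper bdd)

lemma univ_le: "(\<And>N. N \<in> seminorms X R \<Longrightarrow> N f \<le> K) \<Longrightarrow> univ_nrm X R f \<le> K"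
  unfolding univ_nrm_def by (rule cSUP_least) (use zero_seminorm in auto)

lemma univ_nonneg: "f \<in> free_on X \<Longrightarrow> 0 \<le> univ_nrm X R f"
  using le_univ[OF _ zero_seminorm] by simp

lemma univ_seminorm: "univ_nrm X R \<in> seminorms X R"
  unfolding seminorms_def cstar_seminorm_on_def
proof (intro CollectI conjI ballI allI)
  fix x y assume x: "x \<in> free_on X" and y: "y \<in> free_on X"
  show "univ_nrm X R (x + y) \<le> univ_nrm X R x + univ_nrm X R y"
  proof (rule univ_le)
    fix N assume N: "N \<in> seminorms X R"
    show "N (x + y) \<le> univ_nrm X R x + univ_nrm X R y"
      using cstar_seminormed.N_add[OF seminormsD[OF N] x y] le_univ[OF x N] le_univ[OF y N] by linarith
  qed
  show "univ_nrm X R (x * y) \<le> univ_nrm X R x * univ_nrm X R y"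
  proof (rule univ_le)
    fix N assume N: "N \<in> seminorms X R"
    have "N x * N y \<le> univ_nrm X R x * univ_nrm X R y"
      by (intro mult_mono le_univ x y N univ_nonneg cstar_seminormed.N_nonneg[OF seminormsD[OF N]])
    then show "N (x * y) \<le> univ_nrm X R x * univ_nrm X R y"
      using cstar_seminormed.N_mult[OF seminormsD[OF N] x y] by linarith
  qed
next
  have 1: "univ_nrm X R (fscale c x) \<le> cmod c * univ_nrm X R x" if "x \<in> free_on X" for c x
  proof (rule univ_le)
    fix N assume N: "N \<in> seminorms X R"
    show "N (fscale c x) \<le> cmod c * univ_nrm X R x"
      using cstar_seminormed.N_sc[OF seminormsD[OF N] that] le_univ[OF that N] by (simp add: mult_left_mono)
  qed
  fix c x assume x: "x \<in> free_on X"
  show "univ_nrm X R (fscale c x) = cmod c * univ_nrm X R x"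
  proof (cases "c = 0")
    case True
    then show ?thesis using 1[OF x, of c] univ_nonneg[OF free_on_fscale[OF x], of c] by simp
  next
    case False
    have "univ_nrm X R x = univ_nrm X R (fscale (1/c) (fscale c x))"
      using False by (intro arg_cong[of _ _ "univ_nrm X R"] poly_mapping_eqI) simp
    also have "\<dots> \<le> cmod (1/c) * univ_nrm X R (fscale c x)" by (rule 1[OF free_on_fscale[OF x]])
    finally have "cmod c * univ_nrm X R x \<le> univ_nrm X R (fscale c x)"
      using False by (simp add: norm_divide field_simps)
    then show ?thesis using 1[OF x, of c] by simp
  qed
next
  fix x assume x: "x \<in> free_on X"
  have xx: "fstar x * x \<in> free_on X" using x free_on_mult free_on_fstar by blast
  show "univ_nrm X R (fstar x * x) = (univ_nrm X R x)\<^sup>2"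
  proof (rule antisym)
    show "univ_nrm X R (fstar x * x) \<le> (univ_nrm X R x)\<^sup>2"
    proof (rule univ_le)
      fix N assume N: "N \<in> seminorms X R"
      show "N (fstar x * x) \<le> (univ_nrm X R x)\<^sup>2"
        using cstar_seminormed.N_cstar[OF seminormsD[OF N] x] le_univ[OF x N]
          cstar_seminormed.N_nonneg[OF seminormsD[OF N] x] by (simp add: power_mono)
    qed
    have "univ_nrm X R x \<le> sqrt (univ_nrm X R (fstar x * x))"
    proof (rule univ_le)
      fix N assume N: "N \<in> seminorms X R"
      have "(N x)\<^sup>2 \<le> univ_nrm X R (fstar x * x)"
        using le_univ[OF xx N] by (simp add: cstar_seminormed.N_cstar[OF seminormsD[OF N] x])
      then show "N x \<le> sqrt (univ_nrm X R (fstar x * x))" by (rule real_le_rsqrt)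
    qed
    then have "(univ_nrm X R x)\<^sup>2 \<le> (sqrt (univ_nrm X R (fstar x * x)))\<^sup>2"
      by (rule power_mono) (rule univ_nonneg[OF x])
    then show "(univ_nrm X R x)\<^sup>2 \<le> univ_nrm X R (fstar x * x)" by (simp add: univ_nonneg[OF xx])
  qed
next
  fix r assume r: "r \<in> R"
  have "univ_nrm X R r \<le> 0" by (rule univ_le) (use r in \<open>simp add: seminorms_def\<close>)
  then show "univ_nrm X R r = 0" using univ_nonneg[of r] r R_sub by force
qed

sublocale cstar_seminormed "free_on X" fscale fstar "univ_nrm X R"
  by (rule seminormsD[OF univ_seminorm])

abbreviation "U \<equiv> universal_cstar X R"
abbreviation "el \<equiv> universal_elem X R"

lemma cstar_algebra_U: "cstar_algebra U"
  unfolding universal_cstar_def by (rule cstar_algebra_A)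

lemma el_carrier: "f \<in> free_on X \<Longrightarrow> el f \<in> carrier U"
  by (simp add: universal_cstar_def universal_elem_def carrier_A cs_const)

lemma el_zero: "el 0 = \<zero>\<^bsub>U\<^esub>"
  by (simp add: universal_cstar_def universal_elem_def zero_A)

lemma el_add: "f \<in> free_on X \<Longrightarrow> g \<in> free_on X \<Longrightarrow> el (f + g) = el f \<oplus>\<^bsub>U\<^esub> el g"
  by (simp add: universal_cstar_def universal_elem_def add_A cs_const)

lemma el_diff: "f \<in> free_on X \<Longrightarrow> g \<in> free_on X \<Longrightarrow> el (f - g) = el f \<ominus>\<^bsub>U\<^esub> el g"
  by (simp add: universal_cstar_def universal_elem_def minus_A cs_const)

lemma el_mult: "f \<in> free_on X \<Longrightarrow> g \<in> free_on X \<Longrightarrow> el (f * g) = el f \<otimes>\<^bsub>U\<^esub> el g"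
  by (simp add: universal_cstar_def universal_elem_def mult_A cs_const)

lemma el_scale: "f \<in> free_on X \<Longrightarrow> el (fscale c f) = c \<odot>\<^bsub>U\<^esub> el f"
  by (simp add: universal_cstar_def universal_elem_def scale_A cs_const)

lemma el_star: "f \<in> free_on X \<Longrightarrow> el (fstar f) = star U (el f)"
  by (simp add: universal_cstar_def universal_elem_def star_A cs_const)

lemma el_nrm: "f \<in> free_on X \<Longrightarrow> nrm U (el f) = univ_nrm X R f"
  by (simp add: universal_cstar_def universal_elem_def nrm_A_const)

lemma el_sum: "finite I \<Longrightarrow> (\<And>i. i \<in> I \<Longrightarrow> f i \<in> free_on X) \<Longrightarrow> el (sum f I) = finsum U (\<lambda>i. el (f i)) I"
proof (induction I rule: finite_induct)
  interpret cstar_algebra U by (rule cstar_algebra_U)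
  case empty
  then show ?case by (simp add: el_zero)
next
  interpret cstar_algebra U by (rule cstar_algebra_U)
  case (insert i I)
  have "finsum U (\<lambda>i. el (f i)) (insert i I) = el (f i) \<oplus>\<^bsub>U\<^esub> finsum U (\<lambda>i. el (f i)) I"
    using insert by (intro finsum_insert) (auto intro: el_carrier)
  then show ?case using insert by (simp add: el_add free_on_sum)
qed

lemma el_relator: assumes "r \<in> R" shows "el r = \<zero>\<^bsub>U\<^esub>"
proof -
  have r: "r \<in> free_on X" using assms R_sub by blast
  have "univ_nrm X R r = 0" using univ_seminorm assms by (simp add: seminorms_def)
  then show ?thesis
    using cstar_algebra.nrm_eq_0[OF cstar_algebra_U el_carrier[OF r]] el_nrm[OF r] by simp
qed

lemma el_relator_diff:
  assumes "f - g \<in> R" "f \<in> free_on X" "g \<in> free_on X" shows "el f = el g"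
proof -
  interpret cstar_algebra U by (rule cstar_algebra_U)
  have "el f = el (f - g) \<oplus>\<^bsub>U\<^esub> el g" using el_add[of "f - g" g] assms free_on_diff[of f X g] by simp
  then show ?thesis using el_relator[OF assms(1)] el_carrier[OF assms(3)] by simp
qed

lemma el_dense: assumes "a \<in> carrier U"
  shows "\<exists>f. (\<forall>n. f n \<in> free_on X) \<and> (\<lambda>n. nrm U (el (f n) \<ominus>\<^bsub>U\<^esub> a)) \<longlonglongrightarrow> 0"
proof -
  obtain x where x: "x \<in> cs" "a = cl x" using assms by (auto simp: universal_cstar_def carrier_A)
  have eq: "el (x n) \<ominus>\<^bsub>U\<^esub> a = cl (\<lambda>i. x n - x i)" for n
    using minus_A[OF cs_const[OF cs_F[OF x(1)]] x(1)] by (simp add: x universal_cstar_def universal_elem_def)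
  have lim: "(\<lambda>i. univ_nrm X R (x n - x i)) \<longlonglongrightarrow> nrm U (el (x n) \<ominus>\<^bsub>U\<^esub> a)" for n
    unfolding eq using nrm_A[OF cs_diff[OF cs_const[OF cs_F[OF x(1)]] x(1)]] by (simp add: universal_cstar_def)
  have "(\<lambda>n. nrm U (el (x n) \<ominus>\<^bsub>U\<^esub> a)) \<longlonglongrightarrow> 0"
  proof (rule LIMSEQ_I)
    fix e :: real assume e: "e > 0"
    then obtain M where M: "\<forall>m\<ge>M. \<forall>n\<ge>M. univ_nrm X R (x m - x n) < e / 2"
      using x(1) unfolding cauchy_seqs_def by (fastforce dest: spec[of _ "e / 2"])
    have "norm (nrm U (el (x n) \<ominus>\<^bsub>U\<^esub> a) - 0) < e" if "n \<ge> M" for n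
    proof -
      have "nrm U (el (x n) \<ominus>\<^bsub>U\<^esub> a) \<le> e / 2"
        by (rule LIMSEQ_le_const2[OF lim]) (use M that in \<open>auto intro: less_imp_le\<close>)
      moreover have "nrm U (el (x n) \<ominus>\<^bsub>U\<^esub> a) \<ge> 0"
        by (rule LIMSEQ_le_const[OF lim]) (use x in \<open>auto simp: N_nonneg F_diff cs_F\<close>)
      ultimately show ?thesis using e by simp
    qed
    then show "\<exists>no. \<forall>n\<ge>no. norm (nrm U (el (x n) \<ominus>\<^bsub>U\<^esub> a) - 0) < e" by blast
  qed
  then show ?thesis using cs_F[OF x(1)] by blast
qed

end

lemma free_on_induct_single [consumes 1, case_names zero add single]:
  assumes f: "f \<in> free_on X" and 0: "P 0"
    and a: "\<And>f g. f \<in> free_on X \<Longrightarrow> g \<in> free_on X \<Longrightarrow> P f \<Longrightarrow> P g \<Longrightarrow> P (f + g)"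
    and s: "\<And>w c. letters w \<noteq> [] \<Longrightarrow> fst ` set (letters w) \<subseteq> X \<Longrightarrow> P (Poly_Mapping.single w c)"
  shows "P f"
proof -
  have "f \<in> free_on X \<and> P f"
  proof (rule free_induct_raw)
    show "0 \<in> free_on X \<and> P 0" using 0 by (simp add: free_on_0)
    show "f + g \<in> free_on X \<and> P (f + g)" if "f \<in> free_on X \<and> P f" "g \<in> free_on X \<and> P g" for f g
      using that a free_on_add by blast
    fix w c assume "w \<in> Poly_Mapping.keys f"
    then have w: "letters w \<noteq> []" "fst ` set (letters w) \<subseteq> X" using f unfolding free_on_def by blast+
    then show "Poly_Mapping.single w c \<in> free_on X \<and> P (Poly_Mapping.single w c)"
      using s[OF w] by (simp add: free_on_def)
  qed
  then show ?thesis ..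
qed

context cstar_algebra
begin

lemma scale_0: assumes "x \<in> carrier A" shows "0 \<odot> x = \<zero>"
proof -
  have "0 \<odot> x = 0 \<odot> x \<oplus> 0 \<odot> x"
    using scale_add_left[OF assms, of 0 0] by simp
  then show ?thesis using scale_closed[OF assms] by (simp only: add.l_cancel_one')
qed

lemma scale_m1: assumes "x \<in> carrier A" shows "(-1) \<odot> x = \<ominus> x"
proof -
  have "(-1) \<odot> x \<oplus> x = \<zero>"
    using scale_add_left[OF assms, of "-1" 1] scale_one[OF assms] scale_0[OF assms] by simp
  then show ?thesis using assms scale_closed minus_equality by metis
qed

lemma minus_scale: "\<lbrakk>x \<in> carrier A; y \<in> carrier A\<rbrakk> \<Longrightarrow> x \<ominus> y = x \<oplus> (-1) \<odot> y"
  by (simp add: scale_m1 minus_eq)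

lemma nrm_zero: "nrm A \<zero> = 0"
  by (simp add: nrm_eq_0)

lemma scale_zero: "c \<odot> \<zero> = \<zero>"
  using scale_scale[of \<zero> c 0] by (simp add: scale_0)

lemma mult_zero_left: assumes "x \<in> carrier A" shows "\<zero> \<otimes> x = \<zero>"
  using scale_mult_left[of \<zero> x 0] assms by (simp add: scale_0 mult_closed)

lemma mult_zero_right: assumes "x \<in> carrier A" shows "x \<otimes> \<zero> = \<zero>"
  using scale_mult_right[of x \<zero> 0] assms by (simp add: scale_0 mult_closed)

lemma star_zero: "star A \<zero> = \<zero>"
  using star_scale[of \<zero> 0] by (simp add: scale_0 star_closed)

lemma nrm_neg: "x \<in> carrier A \<Longrightarrow> nrm A (\<ominus> x) = nrm A x"
  using nrm_scale[of x "-1"] by (simp add: scale_m1)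

lemma nrm_nonneg: assumes "x \<in> carrier A" shows "nrm A x \<ge> 0"
proof -
  have "nrm A (x \<oplus> \<ominus> x) \<le> nrm A x + nrm A x"
    using nrm_add[of x "\<ominus> x"] assms by (simp add: nrm_neg)
  then show ?thesis using assms by (simp add: r_neg nrm_zero)
qed

lemma nrm_star_le: assumes "x \<in> carrier A" shows "nrm A x \<le> nrm A (star A x)"
proof (cases "nrm A x = 0")
  case False
  then have "nrm A x > 0" using nrm_nonneg[OF assms] by simp
  moreover have "nrm A x * nrm A x \<le> nrm A (star A x) * nrm A x"
    using nrm_cstar[OF assms] nrm_mult[of "star A x" x] assms star_closed by (simp add: power2_eq_square)
  ultimately show ?thesis by simp
qed (use nrm_nonneg star_closed assms in auto)

lemma nrm_star: "x \<in> carrier A \<Longrightarrow> nrm A (star A x) = nrm A x"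
  using nrm_star_le[of x] nrm_star_le[of "star A x"] star_closed by (simp add: star_star)

lemma nrm_minus_commute: assumes "x \<in> carrier A" "y \<in> carrier A" shows "nrm A (x \<ominus> y) = nrm A (y \<ominus> x)"
proof -
  have "\<ominus> (x \<ominus> y) = y \<ominus> x" using assms by (simp add: minus_eq minus_add a_comm)
  then show ?thesis using nrm_neg[of "x \<ominus> y"] assms by simp
qed

lemma nrm_tri:
  assumes "x \<in> carrier A" "y \<in> carrier A" "z \<in> carrier A"
  shows "nrm A (x \<ominus> z) \<le> nrm A (x \<ominus> y) + nrm A (y \<ominus> z)"
proof -
  have "(x \<ominus> y) \<oplus> (y \<ominus> z) = x \<ominus> z"
    using assms by (simp add: minus_eq a_assoc r_neg1 r_neg2)
  then show ?thesis using nrm_add[of "x \<ominus> y" "y \<ominus> z"] assms by simp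
qed

definition lim_to :: "(nat \<Rightarrow> 'a) \<Rightarrow> 'a \<Rightarrow> bool" where
  "lim_to x a \<longleftrightarrow> (\<forall>n. x n \<in> carrier A) \<and> a \<in> carrier A \<and> (\<lambda>n. nrm A (x n \<ominus> a)) \<longlonglongrightarrow> 0"

lemma lim_const: "a \<in> carrier A \<Longrightarrow> lim_to (\<lambda>n. a) a"
  by (simp add: lim_to_def r_neg minus_eq nrm_zero)

lemma lim_nrm: assumes "lim_to x a" shows "(\<lambda>n. nrm A (x n)) \<longlonglongrightarrow> nrm A a"
proof -
  have x: "x n \<in> carrier A" "a \<in> carrier A" for n using assms by (auto simp: lim_to_def)
  have z: "b \<ominus> \<zero> = b" if "b \<in> carrier A" for b using that by (simp add: minus_eq)
  have "\<bar>nrm A (x n) - nrm A a\<bar> \<le> nrm A (x n \<ominus> a)" for n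
    using nrm_tri[of "x n" a \<zero>] nrm_tri[of a "x n" \<zero>] nrm_minus_commute[of "x n" a] x z by simp
  then have "(\<lambda>n. nrm A (x n) - nrm A a) \<longlonglongrightarrow> 0"
    using assms by - (rule Lim_null_comparison[of _ "\<lambda>n. nrm A (x n \<ominus> a)"], rule always_eventually, auto simp: lim_to_def)
  then show ?thesis by (simp add: LIM_zero_iff)
qed

lemma lim_add: assumes "lim_to x a" "lim_to y b" shows "lim_to (\<lambda>n. x n \<oplus> y n) (a \<oplus> b)"
proof -
  have c: "x n \<in> carrier A" "y n \<in> carrier A" "a \<in> carrier A" "b \<in> carrier A" for n
    using assms by (auto simp: lim_to_def)
  have "(x n \<oplus> y n) \<ominus> (a \<oplus> b) = (x n \<ominus> a) \<oplus> (y n \<ominus> b)" for n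
    using c by (simp add: minus_eq minus_add a_ac)
  then have "nrm A ((x n \<oplus> y n) \<ominus> (a \<oplus> b)) \<le> nrm A (x n \<ominus> a) + nrm A (y n \<ominus> b)" for n
    using c nrm_add[of "x n \<ominus> a" "y n \<ominus> b"] by simp
  moreover have "(\<lambda>n. nrm A (x n \<ominus> a) + nrm A (y n \<ominus> b)) \<longlonglongrightarrow> 0"
    using tendsto_add[of "\<lambda>n. nrm A (x n \<ominus> a)" 0 _ "\<lambda>n. nrm A (y n \<ominus> b)" 0] assms by (simp add: lim_to_def)
  ultimately have "(\<lambda>n. nrm A ((x n \<oplus> y n) \<ominus> (a \<oplus> b))) \<longlonglongrightarrow> 0"
    using c by - (rule Lim_null_comparison[of _ "\<lambda>n. nrm A (x n \<ominus> a) + nrm A (y n \<ominus> b)"], rule always_eventually, auto simp: nrm_nonneg)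
  then show ?thesis using c by (simp add: lim_to_def)
qed

lemma lim_scale: assumes "lim_to x a" shows "lim_to (\<lambda>n. c \<odot> x n) (c \<odot> a)"
proof -
  have x: "x n \<in> carrier A" "a \<in> carrier A" for n using assms by (auto simp: lim_to_def)
  have "c \<odot> x n \<ominus> c \<odot> a = c \<odot> (x n \<ominus> a)" for n
    using x by (simp add: minus_scale scale_closed scale_add_right scale_scale mult.commute)
  then show ?thesis using assms tendsto_mult_left[of "\<lambda>n. nrm A (x n \<ominus> a)" 0 _ "cmod c"] x
    by (simp add: lim_to_def scale_closed nrm_scale)
qed

lemma lim_star: assumes "lim_to x a" shows "lim_to (\<lambda>n. star A (x n)) (star A a)"
proof -
  have x: "x n \<in> carrier A" "a \<in> carrier A" for n using assms by (auto simp: lim_to_def)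
  have "star A (x n) \<ominus> star A a = star A (x n \<ominus> a)" for n
    using x by (simp add: minus_scale scale_closed star_closed star_add star_scale)
  then show ?thesis using assms x by (simp add: lim_to_def star_closed nrm_star)
qed

lemma lim_mult: assumes "lim_to x a" "lim_to y b" shows "lim_to (\<lambda>n. x n \<otimes> y n) (a \<otimes> b)"
proof -
  have c: "x n \<in> carrier A" "y n \<in> carrier A" "a \<in> carrier A" "b \<in> carrier A" for n
    using assms by (auto simp: lim_to_def)
  have e: "x n \<otimes> y n \<ominus> a \<otimes> b = ((x n \<ominus> a) \<otimes> y n) \<oplus> (a \<otimes> (y n \<ominus> b))" for n
  proof -
    have "(x n \<ominus> a) \<otimes> y n = x n \<otimes> y n \<oplus> \<ominus> (a \<otimes> y n)"
      using c by (simp add: minus_scale distrib_right scale_closed scale_mult_left mult_closed flip: scale_m1)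
    moreover have "a \<otimes> (y n \<ominus> b) = a \<otimes> y n \<oplus> \<ominus> (a \<otimes> b)"
      using c by (simp add: minus_scale distrib_left scale_closed scale_mult_right mult_closed flip: scale_m1)
    ultimately show ?thesis using c by (simp add: minus_eq mult_closed a_assoc r_neg1)
  qed
  have "nrm A (x n \<otimes> y n \<ominus> a \<otimes> b) \<le> nrm A (x n \<ominus> a) * nrm A (y n) + nrm A a * nrm A (y n \<ominus> b)" for n
    unfolding e using c
    by (intro order_trans[OF nrm_add] add_mono nrm_mult) (auto simp: mult_closed)
  moreover have "(\<lambda>n. nrm A (x n \<ominus> a) * nrm A (y n) + nrm A a * nrm A (y n \<ominus> b)) \<longlonglongrightarrow> 0"
  proof -
    have "(\<lambda>n. nrm A (x n \<ominus> a) * nrm A (y n)) \<longlonglongrightarrow> 0 * nrm A b"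
      using assms lim_nrm[OF assms(2)] by (intro tendsto_mult) (auto simp: lim_to_def)
    moreover have "(\<lambda>n. nrm A a * nrm A (y n \<ominus> b)) \<longlonglongrightarrow> nrm A a * 0"
      using assms by (intro tendsto_mult) (auto simp: lim_to_def)
    ultimately show ?thesis using tendsto_add by fastforce
  qed
  ultimately have "(\<lambda>n. nrm A (x n \<otimes> y n \<ominus> a \<otimes> b)) \<longlonglongrightarrow> 0"
    using c by - (rule Lim_null_comparison[of _ "\<lambda>n. nrm A (x n \<ominus> a) * nrm A (y n) + nrm A a * nrm A (y n \<ominus> b)"], rule always_eventually, auto simp: nrm_nonneg mult_closed)
  then show ?thesis using c by (simp add: lim_to_def mult_closed)
qed

definition lval :: "('g \<Rightarrow> 'a) \<Rightarrow> 'g \<times> bool \<Rightarrow> 'a" where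
  "lval g a = (if snd a then star A (g (fst a)) else g (fst a))"

fun wval :: "('g \<Rightarrow> 'a) \<Rightarrow> ('g \<times> bool) list \<Rightarrow> 'a" where
  "wval g [] = \<zero>"
| "wval g [a] = lval g a"
| "wval g (a # b # l) = lval g a \<otimes> wval g (b # l)"

definition ev :: "('g \<Rightarrow> 'a) \<Rightarrow> 'g free_alg \<Rightarrow> 'a" where
  "ev g f = (\<Oplus>w\<in>Poly_Mapping.keys f. Poly_Mapping.lookup f w \<odot> wval g (letters w))"

context
  fixes g :: "'g \<Rightarrow> 'a" and X
  assumes g: "\<And>x. x \<in> X \<Longrightarrow> g x \<in> carrier A"
begin

lemma lval_closed: "fst a \<in> X \<Longrightarrow> lval g a \<in> carrier A"
  by (simp add: lval_def g star_closed)

lemma wval_Cons: "l \<noteq> [] \<Longrightarrow> wval g (a # l) = lval g a \<otimes> wval g l"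
  by (cases l) auto

lemma wval_closed: "fst ` set l \<subseteq> X \<Longrightarrow> wval g l \<in> carrier A"
proof (induction l)
  case (Cons a l)
  then show ?case by (cases "l = []") (simp_all add: wval_Cons lval_closed mult_closed)
qed simp

lemma wval_append:
  "fst ` set l \<subseteq> X \<Longrightarrow> fst ` set l' \<subseteq> X \<Longrightarrow> l \<noteq> [] \<Longrightarrow> l' \<noteq> [] \<Longrightarrow>
    wval g (l @ l') = wval g l \<otimes> wval g l'"
proof (induction l)
  case (Cons a l)
  then show ?case
    by (cases "l = []") (auto simp: wval_Cons mult_assoc lval_closed wval_closed)
qed simp

lemma lval_flip: "fst a \<in> X \<Longrightarrow> lval g (case a of (x, b) \<Rightarrow> (x, \<not> b)) = star A (lval g a)"
  by (cases a) (auto simp: lval_def star_star g)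

lemma wval_star:
  "fst ` set l \<subseteq> X \<Longrightarrow> l \<noteq> [] \<Longrightarrow> wval g (rev (map (\<lambda>(x, b). (x, \<not> b)) l)) = star A (wval g l)"
proof (induction l)
  case (Cons a l)
  show ?case
  proof (cases "l = []")
    case False
    have "fst ` set (rev (map (\<lambda>(x, b). (x, \<not> b)) l)) \<subseteq> X"
      using Cons by (auto simp: case_prod_beta)
    then show ?thesis
      using Cons False lval_flip[of a]
      by (simp add: wval_append wval_Cons star_mult lval_closed wval_closed case_prod_beta)
  qed (use Cons lval_flip[of a] in \<open>simp add: case_prod_beta\<close>)
qed simp

lemma ev_superset:
  assumes "finite S" "Poly_Mapping.keys f \<subseteq> S" "\<And>w. w \<in> S \<Longrightarrow> fst ` set (letters w) \<subseteq> X"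
  shows "ev g f = (\<Oplus>w\<in>S. Poly_Mapping.lookup f w \<odot> wval g (letters w))"
  unfolding ev_def using assms
  by (intro add.finprod_mono_neutral_cong_left)
     (auto simp: in_keys_iff scale_0 wval_closed scale_closed)

lemma keys_valid: "f \<in> free_on X \<Longrightarrow> w \<in> Poly_Mapping.keys f \<Longrightarrow> fst ` set (letters w) \<subseteq> X"
  unfolding free_on_def by blast

lemma ev_closed: "f \<in> free_on X \<Longrightarrow> ev g f \<in> carrier A"
  unfolding ev_def by (intro finsum_closed) (auto simp: scale_closed wval_closed keys_valid)

lemma ev_zero: "ev g 0 = \<zero>"
  by (simp add: ev_def)

lemma ev_single: assumes "fst ` set (letters w) \<subseteq> X"
  shows "ev g (Poly_Mapping.single w c) = c \<odot> wval g (letters w)"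
proof -
  have "ev g (Poly_Mapping.single w c) =
      (\<Oplus>v\<in>{w}. Poly_Mapping.lookup (Poly_Mapping.single w c) v \<odot> wval g (letters v))"
    by (rule ev_superset) (use assms in auto)
  then show ?thesis using assms by (simp add: wval_closed scale_closed)
qed

lemma ev_add: assumes "f \<in> free_on X" "h \<in> free_on X" shows "ev g (f + h) = ev g f \<oplus> ev g h"
proof -
  let ?S = "Poly_Mapping.keys f \<union> Poly_Mapping.keys h"
  have S: "fst ` set (letters w) \<subseteq> X" if "w \<in> ?S" for w
    using that assms keys_valid by blast
  have *: "ev g k = (\<Oplus>w\<in>?S. Poly_Mapping.lookup k w \<odot> wval g (letters w))"
    if "Poly_Mapping.keys k \<subseteq> ?S" for k
    by (rule ev_superset) (use S that in auto)
  let ?t = "\<lambda>k w. Poly_Mapping.lookup k w \<odot> wval g (letters w)"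
  have c: "?t k w \<in> carrier A" if "w \<in> ?S" for k w
    by (intro scale_closed wval_closed S that)
  have "ev g (f + h) = finsum A (?t (f + h)) ?S" by (rule *) (rule keys_add)
  also have "\<dots> = finsum A (\<lambda>w. ?t f w \<oplus> ?t h w) ?S"
  proof (rule finsum_cong'[OF refl])
    show "(\<lambda>w. ?t f w \<oplus> ?t h w) \<in> ?S \<rightarrow> carrier A" using c by blast
    show "?t (f + h) w = ?t f w \<oplus> ?t h w" if "w \<in> ?S" for w
      unfolding lookup_add by (rule scale_add_left[OF wval_closed[OF S[OF that]]])
  qed
  also have "\<dots> = finsum A (?t f) ?S \<oplus> finsum A (?t h) ?S"
    by (rule finsum_addf) (use c in auto)
  also have "\<dots> = ev g f \<oplus> ev g h" by (simp add: *)
  finally show ?thesis .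
qed

lemma ev_scale: "f \<in> free_on X \<Longrightarrow> ev g (fscale c f) = c \<odot> ev g f"
proof (induction rule: free_on_induct_single)
  case (add f h)
  then show ?case by (simp add: fscale_add ev_add free_on_fscale scale_add_right ev_closed)
next
  case (single w d)
  then show ?case by (simp add: fscale_single ev_single scale_scale wval_closed)
qed (simp add: ev_zero scale_zero)

lemma single_free: "letters w \<noteq> [] \<Longrightarrow> fst ` set (letters w) \<subseteq> X \<Longrightarrow> Poly_Mapping.single w c \<in> free_on X"
  by (simp add: free_on_def)

lemma ev_mult: "f \<in> free_on X \<Longrightarrow> h \<in> free_on X \<Longrightarrow> ev g (f * h) = ev g f \<otimes> ev g h"
proof (induction f rule: free_on_induct_single)
  case zero
  then show ?case by (simp add: ev_zero mult_zero_left ev_closed)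
next
  case (add f f')
  then show ?case by (simp add: Rings.distrib_right ev_add free_on_mult distrib_right ev_closed)
next
  case (single w c)
  note w = single(1,2)
  from single(3) show ?case
  proof (induction h rule: free_on_induct_single)
    case zero
    show ?case using single_free[OF w] by (simp add: ev_zero mult_zero_right ev_closed)
  next
    case (add f f')
    then show ?case using single_free[OF w]
      by (simp add: Rings.distrib_left ev_add free_on_mult distrib_left ev_closed)
  next
    case (single v d)
    then show ?case using w
      by (auto simp: mult_single ev_single plus_word_def wval_append wval_closed scale_mult_left
          scale_mult_right scale_scale scale_closed mult_closed image_Un mult.commute)
  qed
qed

lemma ev_star: "f \<in> free_on X \<Longrightarrow> ev g (fstar f) = star A (ev g f)"
proof (induction f rule: free_on_induct_single)
  case (add f f')
  then show ?case by (simp add: fstar_add ev_add free_on_fstar star_add ev_closed)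
next
  case (single w d)
  have "fst ` set (letters (word_star w)) \<subseteq> X" using single by simp
  then show ?case using single wval_star[of "letters w"]
    by (simp add: fstar_single ev_single star_scale wval_closed) (simp add: word_star_def)
qed (simp add: ev_zero star_zero)

lemma ev_gen: "x \<in> X \<Longrightarrow> ev g (gen x) = g x"
  by (simp add: gen_def ev_single lval_def scale_one g)

lemma ev_diff: assumes "f \<in> free_on X" "h \<in> free_on X" shows "ev g (f - h) = ev g f \<ominus> ev g h"
proof -
  have "f - h = f + fscale (-1) h"
    by (rule poly_mapping_eqI) (simp add: lookup_add lookup_minus)
  then have "ev g (f - h) = ev g (f + fscale (-1) h)" by (rule arg_cong)
  then show ?thesis using assms by (simp only: ev_add free_on_fscale ev_scale minus_scale ev_closed)
qed

lemma ev_sum: "finite I \<Longrightarrow> (\<And>i. i \<in> I \<Longrightarrow> f i \<in> free_on X) \<Longrightarrow> ev g (sum f I) = finsum A (\<lambda>i. ev g (f i)) I"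
proof (induction I rule: finite_induct)
  case (insert i I)
  have "finsum A (\<lambda>i. ev g (f i)) (insert i I) = ev g (f i) \<oplus> finsum A (\<lambda>i. ev g (f i)) I"
    using insert by (intro finsum_insert) (auto intro: ev_closed)
  then show ?case using insert by (simp add: ev_add free_on_sum)
qed (simp add: ev_zero)

lemma ev_seminorm: "cstar_seminorm_on (free_on X) (\<lambda>f. nrm A (ev g f))"
  by (auto simp: cstar_seminorm_on_def ev_add ev_scale ev_mult ev_star ev_closed free_on_fstar
      nrm_add nrm_scale nrm_mult nrm_cstar)

end

end

lemma (in bounded_relators) universal:
  assumes "cstar_algebra B" and g: "\<And>x. x \<in> X \<Longrightarrow> g x \<in> carrier B"
    and R: "\<And>r. r \<in> R \<Longrightarrow> cstar_algebra.ev B g r = \<zero>\<^bsub>B\<^esub>"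
  shows "\<exists>\<pi>. star_hom U B \<pi> \<and> (\<forall>x\<in>X. \<pi> (el (gen x)) = g x)"
proof -
  interpret B: cstar_algebra B by fact
  interpret U: cstar_algebra U by (rule cstar_algebra_U)
  have "(\<lambda>f. nrm B (B.ev g f)) \<in> seminorms X R"
    using B.ev_seminorm[OF g] R by (simp add: seminorms_def B.nrm_zero)
  then have le: "nrm B (B.ev g f) \<le> nrm U (el f)" if "f \<in> free_on X" for f
    using le_univ[OF that] el_nrm[OF that] by simp
  define rel where "rel a b \<longleftrightarrow> (\<exists>f. (\<forall>n. f n \<in> free_on X) \<and> U.lim_to (\<lambda>n. el (f n)) a \<and> B.lim_to (\<lambda>n. B.ev g (f n)) b)" for a b
  have rel_closed: "a \<in> carrier U" "b \<in> carrier B" if "rel a b" for a b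
    using that by (auto simp: rel_def U.lim_to_def B.lim_to_def)
  have rel_nrm: "nrm B b \<le> nrm U a" if "rel a b" for a b
  proof -
    obtain f where f: "\<And>n. f n \<in> free_on X" "U.lim_to (\<lambda>n. el (f n)) a" "B.lim_to (\<lambda>n. B.ev g (f n)) b"
      using \<open>rel a b\<close> by (auto simp: rel_def)
    show ?thesis by (rule LIMSEQ_le[OF B.lim_nrm[OF f(3)] U.lim_nrm[OF f(2)]]) (use le f(1) in blast)
  qed
  have rel_el: "rel (el f) (B.ev g f)" if "f \<in> free_on X" for f
    unfolding rel_def using that
    by (intro exI[of _ "\<lambda>n. f"]) (simp add: U.lim_const B.lim_const el_carrier B.ev_closed[OF g])
  have rel_add: "rel (a \<oplus>\<^bsub>U\<^esub> a') (b \<oplus>\<^bsub>B\<^esub> b')" if r: "rel a b" and r': "rel a' b'" for a b a' b'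
  proof -
    obtain f where f: "\<And>n. f n \<in> free_on X" "U.lim_to (\<lambda>n. el (f n)) a" "B.lim_to (\<lambda>n. B.ev g (f n)) b"
      using r by (auto simp: rel_def)
    obtain f' where f': "\<And>n. f' n \<in> free_on X" "U.lim_to (\<lambda>n. el (f' n)) a'" "B.lim_to (\<lambda>n. B.ev g (f' n)) b'"
      using r' by (auto simp: rel_def)
    show ?thesis unfolding rel_def
      using U.lim_add[OF f(2) f'(2)] B.lim_add[OF f(3) f'(3)] f(1) f'(1)
      by (intro exI[of _ "\<lambda>n. f n + f' n"]) (simp add: el_add B.ev_add[OF g] free_on_add)
  qed
  have rel_mult: "rel (a \<otimes>\<^bsub>U\<^esub> a') (b \<otimes>\<^bsub>B\<^esub> b')" if r: "rel a b" and r': "rel a' b'" for a b a' b'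
  proof -
    obtain f where f: "\<And>n. f n \<in> free_on X" "U.lim_to (\<lambda>n. el (f n)) a" "B.lim_to (\<lambda>n. B.ev g (f n)) b"
      using r by (auto simp: rel_def)
    obtain f' where f': "\<And>n. f' n \<in> free_on X" "U.lim_to (\<lambda>n. el (f' n)) a'" "B.lim_to (\<lambda>n. B.ev g (f' n)) b'"
      using r' by (auto simp: rel_def)
    show ?thesis unfolding rel_def
      using U.lim_mult[OF f(2) f'(2)] B.lim_mult[OF f(3) f'(3)] f(1) f'(1)
      by (intro exI[of _ "\<lambda>n. f n * f' n"]) (simp add: el_mult B.ev_mult[OF g] free_on_mult)
  qed
  have rel_scale: "rel (c \<odot>\<^bsub>U\<^esub> a) (c \<odot>\<^bsub>B\<^esub> b)" if r: "rel a b" for a b c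
  proof -
    obtain f where f: "\<And>n. f n \<in> free_on X" "U.lim_to (\<lambda>n. el (f n)) a" "B.lim_to (\<lambda>n. B.ev g (f n)) b"
      using r by (auto simp: rel_def)
    show ?thesis unfolding rel_def
      using U.lim_scale[OF f(2)] B.lim_scale[OF f(3)] f(1)
      by (intro exI[of _ "\<lambda>n. fscale c (f n)"]) (simp add: el_scale B.ev_scale[OF g] free_on_fscale)
  qed
  have rel_star: "rel (star U a) (star B b)" if r: "rel a b" for a b
  proof -
    obtain f where f: "\<And>n. f n \<in> free_on X" "U.lim_to (\<lambda>n. el (f n)) a" "B.lim_to (\<lambda>n. B.ev g (f n)) b"
      using r by (auto simp: rel_def)
    show ?thesis unfolding rel_def
      using U.lim_star[OF f(2)] B.lim_star[OF f(3)] f(1)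
      by (intro exI[of _ "\<lambda>n. fstar (f n)"]) (simp add: el_star B.ev_star[OF g] free_on_fstar)
  qed
  have rel_unique: "b = b'" if "rel a b" "rel a b'" for a b b'
  proof -
    have c: "a \<in> carrier U" "b \<in> carrier B" "b' \<in> carrier B" using that rel_closed by blast+
    have "rel (a \<ominus>\<^bsub>U\<^esub> a) (b \<ominus>\<^bsub>B\<^esub> b')"
      using rel_add[OF that(1) rel_scale[OF that(2), of "-1"]] c by (simp add: U.minus_scale B.minus_scale)
    then have "nrm B (b \<ominus>\<^bsub>B\<^esub> b') \<le> nrm U \<zero>\<^bsub>U\<^esub>"
      using rel_nrm c by (fastforce simp: U.minus_eq U.r_neg)
    then have "b \<ominus>\<^bsub>B\<^esub> b' = \<zero>\<^bsub>B\<^esub>"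
      using B.nrm_nonneg[of "b \<ominus>\<^bsub>B\<^esub> b'"] B.nrm_eq_0[of "b \<ominus>\<^bsub>B\<^esub> b'"] c by (simp add: U.nrm_zero)
    then show ?thesis using c by simp
  qed
  have rel_ex: "\<exists>b. rel a b" if a: "a \<in> carrier U" for a
  proof -
    obtain f where f: "\<And>n. f n \<in> free_on X" "(\<lambda>n. nrm U (el (f n) \<ominus>\<^bsub>U\<^esub> a)) \<longlonglongrightarrow> 0"
      using el_dense[OF a] by blast
    have "\<exists>L\<in>carrier B. (\<lambda>n. nrm B (B.ev g (f n) \<ominus>\<^bsub>B\<^esub> L)) \<longlonglongrightarrow> 0"
    proof (rule B.complete)
      show "B.ev g (f n) \<in> carrier B" for n by (rule B.ev_closed[OF g f(1)])
      fix e :: real assume "e > 0"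
      then obtain M where M: "\<forall>n\<ge>M. nrm U (el (f n) \<ominus>\<^bsub>U\<^esub> a) < e / 2"
        using order_tendstoD(2)[OF f(2), of "e / 2"] by (auto simp: eventually_sequentially)
      have "nrm B (B.ev g (f m) \<ominus>\<^bsub>B\<^esub> B.ev g (f n)) < e" if "m \<ge> M" "n \<ge> M" for m n
      proof -
        have "nrm B (B.ev g (f m) \<ominus>\<^bsub>B\<^esub> B.ev g (f n)) \<le> nrm U (el (f m) \<ominus>\<^bsub>U\<^esub> el (f n))"
          using le[OF free_on_diff[OF f(1)[of m] f(1)[of n]]] f(1) by (simp add: el_diff B.ev_diff[OF g])
        also have "\<dots> \<le> nrm U (el (f m) \<ominus>\<^bsub>U\<^esub> a) + nrm U (a \<ominus>\<^bsub>U\<^esub> el (f n))"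
          by (intro U.nrm_tri el_carrier f a)
        also have "\<dots> < e / 2 + e / 2"
          using M that U.nrm_minus_commute[OF a el_carrier[OF f(1)]] by (intro add_strict_mono) auto
        finally show ?thesis by simp
      qed
      then show "\<exists>M. \<forall>m\<ge>M. \<forall>n\<ge>M. nrm B (B.ev g (f m) \<ominus>\<^bsub>B\<^esub> B.ev g (f n)) < e" by blast
    qed
    then obtain L where "B.lim_to (\<lambda>n. B.ev g (f n)) L"
      using B.ev_closed[OF g f(1)] by (auto simp: B.lim_to_def)
    moreover have "U.lim_to (\<lambda>n. el (f n)) a" using f a by (simp add: U.lim_to_def el_carrier)
    ultimately show ?thesis using f(1) unfolding rel_def by blast
  qed
  define \<pi> where "\<pi> a = (THE b. rel a b)" for a
  have \<pi>_eq: "\<pi> a = b" if "rel a b" for a b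
    unfolding \<pi>_def using that rel_unique by blast
  have \<pi>: "rel a (\<pi> a)" if "a \<in> carrier U" for a
    using rel_ex[OF that] \<pi>_eq by blast
  have "star_hom U B \<pi>"
    unfolding star_hom_def
    by (intro conjI ballI allI \<pi>_eq rel_add rel_mult rel_scale rel_star \<pi>) (auto intro: rel_closed \<pi>)
  moreover have "\<pi> (el (gen x)) = g x" if "x \<in> X" for x
    using \<pi>_eq[OF rel_el[OF free_on_gen[OF that]]] B.ev_gen[OF g that] by simp
  ultimately show ?thesis by blast
qed

lemma (in bounded_relators) generated:
  assumes D: "D \<subseteq> carrier U" "\<And>x. x \<in> X \<Longrightarrow> el (gen x) \<in> D"
    and "\<And>a b. a \<in> D \<Longrightarrow> b \<in> D \<Longrightarrow> a \<oplus>\<^bsub>U\<^esub> b \<in> D" "\<And>a b. a \<in> D \<Longrightarrow> b \<in> D \<Longrightarrow> a \<otimes>\<^bsub>U\<^esub> b \<in> D"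
    and "\<And>c a. a \<in> D \<Longrightarrow> c \<odot>\<^bsub>U\<^esub> a \<in> D" "\<And>a. a \<in> D \<Longrightarrow> star U a \<in> D" "\<zero>\<^bsub>U\<^esub> \<in> D"
    and closed: "\<And>x a. (\<And>n::nat. x n \<in> D) \<Longrightarrow> a \<in> carrier U \<Longrightarrow> (\<lambda>n. nrm U (x n \<ominus>\<^bsub>U\<^esub> a)) \<longlonglongrightarrow> 0 \<Longrightarrow> a \<in> D"
  shows "D = carrier U"
proof -
  have "el f \<in> D" if "f \<in> free_on X" for f
    using that
  proof (induction rule: free_on_induct)
    case zero
    show ?case using assms(7) by (simp add: el_zero)
  next
    case (add f g)
    then show ?case using assms(3) by (simp add: el_add)
  next
    case (scale c f)
    then show ?case using assms(5) by (simp add: el_scale)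
  next
    case (mult f g)
    then show ?case using assms(4) by (simp add: el_mult)
  next
    case (gen x)
    then show ?case by (rule D(2))
  next
    case (star x)
    then show ?case using assms(6) D(2) by (simp add: el_star free_on_gen)
  qed
  note el_D = this
  have "a \<in> D" if a: "a \<in> carrier U" for a
  proof -
    obtain f where f: "\<And>n. f n \<in> free_on X" "(\<lambda>n. nrm U (el (f n) \<ominus>\<^bsub>U\<^esub> a)) \<longlonglongrightarrow> 0"
      using el_dense[OF a] by blast
    show ?thesis by (rule closed[OF el_D[OF f(1)] a f(2)])
  qed
  then show ?thesis using D(1) by blast
qed


section \<open>The universal property of the C*-algebra of an ultragraph\<close>

text \<open>The algebra defined above is a C*-algebra generated, as a C*-algebra, by a family
  satisfying the defining relations, and every such family in a C*-algebra is the image of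
  this one under a *-homomorphism.\<close>

context
  fixes G :: "('v, 'e) ultragraph"
  assumes wf: "wf_ultragraph G"
begin

lemma fP_free: "A \<in> gen_verts G \<Longrightarrow> fP A \<in> free_on (ug_gens G)"
  by (simp add: free_on_gen ug_gens_def)

lemma fS_free: "e \<in> edges G \<Longrightarrow> fS e \<in> free_on (ug_gens G)"
  by (simp add: free_on_gen ug_gens_def)

lemma src_gen_verts: "e \<in> edges G \<Longrightarrow> {src G e} \<in> gen_verts G"
  using wf by (auto simp: wf_ultragraph_def intro: gen_verts.intros)

lemma regular_gen_verts: "regular G v \<Longrightarrow> {v} \<in> gen_verts G"
  by (simp add: regular_def gen_verts.singleton)

lemmas ug_free = fP_free fS_free src_gen_verts gen_verts.empty gen_verts.range
  gen_verts.union gen_verts.inter free_on_mult free_on_fstar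
  free_on_diff free_on_add free_on_sum

lemma ug_relators_free: "ug_relators G \<subseteq> free_on (ug_gens G)"
  unfolding ug_relators_def
  by (auto intro!: ug_free intro: regular_gen_verts simp: emitted_def)

lemma ug_relI:
  shows "A \<in> gen_verts G \<Longrightarrow> fP A * fP A - fP A \<in> ug_relators G"
    and "A \<in> gen_verts G \<Longrightarrow> fstar (fP A) - fP A \<in> ug_relators G"
    and "e \<in> edges G \<Longrightarrow> fS e * fstar (fS e) * fS e - fS e \<in> ug_relators G"
    and "e \<in> edges G \<Longrightarrow> f \<in> edges G \<Longrightarrow> e \<noteq> f \<Longrightarrow> (fS e * fstar (fS e)) * (fS f * fstar (fS f)) \<in> ug_relators G"
    and "fP {} \<in> ug_relators G"
    and "A \<in> gen_verts G \<Longrightarrow> B \<in> gen_verts G \<Longrightarrow> fP A * fP B - fP (A \<inter> B) \<in> ug_relators G"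
    and "A \<in> gen_verts G \<Longrightarrow> B \<in> gen_verts G \<Longrightarrow> fP (A \<union> B) - (fP A + fP B - fP (A \<inter> B)) \<in> ug_relators G"
    and "e \<in> edges G \<Longrightarrow> fstar (fS e) * fS e - fP (rng G e) \<in> ug_relators G"
    and "e \<in> edges G \<Longrightarrow> fP {src G e} * (fS e * fstar (fS e)) - fS e * fstar (fS e) \<in> ug_relators G"
    and "regular G v \<Longrightarrow> fP {v} - (\<Sum>e\<in>emitted G {v}. fS e * fstar (fS e)) \<in> ug_relators G"
  unfolding ug_relators_def
  subgoal by (rule UnI1, rule UnI1, rule UnI1, rule UnI1, rule UnI1, rule UnI1, rule UnI1, rule UnI1, rule UnI1, blast)
  subgoal by (rule UnI1, rule UnI1, rule UnI1, rule UnI1, rule UnI1, rule UnI1, rule UnI1, rule UnI1, rule UnI2, blast)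
  subgoal by (rule UnI1, rule UnI1, rule UnI1, rule UnI1, rule UnI1, rule UnI1, rule UnI1, rule UnI2, blast)
  subgoal by (rule UnI1, rule UnI1, rule UnI1, rule UnI1, rule UnI1, rule UnI1, rule UnI2, blast)
  subgoal by (rule UnI1, rule UnI1, rule UnI1, rule UnI1, rule UnI1, rule UnI2, blast)
  subgoal by (rule UnI1, rule UnI1, rule UnI1, rule UnI1, rule UnI2, blast)
  subgoal by (rule UnI1, rule UnI1, rule UnI1, rule UnI2, blast)
  subgoal by (rule UnI1, rule UnI1, rule UnI2, blast)
  subgoal by (rule UnI1, rule UnI2, blast)
  subgoal by (rule UnI2, blast)
  done

lemma seminorm_fP:
  assumes N: "N \<in> seminorms (ug_gens G) (ug_relators G)" and A: "A \<in> gen_verts G"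
  shows "N (fP A) \<le> 1"
proof -
  interpret cstar_seminormed "free_on (ug_gens G)" fscale fstar N
    using N by (simp add: seminorms_def cstar_seminormedI)
  have F: "fP A \<in> free_on (ug_gens G)" by (rule fP_free[OF A])
  have "fP A * fP A - fP A \<in> ug_relators G" "fstar (fP A) - fP A \<in> ug_relators G"
    by (rule ug_relI(1)[OF A], rule ug_relI(2)[OF A])
  then have z: "N (fP A * fP A - fP A) = 0" "N (fstar (fP A) - fP A) = 0"
    using N by (auto simp: seminorms_def)
  have "(N (fP A))\<^sup>2 = N (fstar (fP A) * fP A)" using N_cstar[OF F] by simp
  also have "\<dots> \<le> N ((fstar (fP A) - fP A) * fP A) + N (fP A * fP A)"
    using N_add[of "(fstar (fP A) - fP A) * fP A" "fP A * fP A"] F by (simp add: F_mult F_diff F_st algebra_simps)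
  also have "N ((fstar (fP A) - fP A) * fP A) \<le> 0"
    using N_mult[of "fstar (fP A) - fP A" "fP A"] F z by (simp add: F_diff F_st)
  also have "N (fP A * fP A) \<le> N (fP A)"
    using N_diff[of "fP A * fP A" "fP A"] F z by (simp add: F_mult)
  finally have "N (fP A) * N (fP A) \<le> N (fP A)" by (simp add: power2_eq_square)
  then show ?thesis using N_nonneg[OF F] by (cases "N (fP A) = 0") auto
qed

lemma seminorm_fS:
  assumes N: "N \<in> seminorms (ug_gens G) (ug_relators G)" and e: "e \<in> edges G"
  shows "N (fS e) \<le> 1"
proof -
  interpret cstar_seminormed "free_on (ug_gens G)" fscale fstar N
    using N by (simp add: seminorms_def cstar_seminormedI)
  have r: "rng G e \<in> gen_verts G" using e by (rule gen_verts.range)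
  have "fstar (fS e) * fS e - fP (rng G e) \<in> ug_relators G"
    by (rule ug_relI(8)[OF e])
  then have z: "N (fstar (fS e) * fS e - fP (rng G e)) = 0" using N by (auto simp: seminorms_def)
  have "N (fstar (fS e) * fS e) \<le> N (fP (rng G e))"
    using N_diff[of "fstar (fS e) * fS e" "fP (rng G e)"] z fP_free[OF r] fS_free[OF e] by (simp add: F_mult F_st)
  also have "\<dots> \<le> 1" by (rule seminorm_fP[OF N r])
  finally have "(N (fS e))\<^sup>2 \<le> 1" using N_cstar[OF fS_free[OF e]] by simp
  then show ?thesis using power2_le_imp_le[of "N (fS e)" 1] by simp
qed

interpretation ug: bounded_relators "ug_gens G" "ug_relators G"
proof
  show "\<exists>K. \<forall>N\<in>seminorms (ug_gens G) (ug_relators G). N (gen x) \<le> K" if "x \<in> ug_gens G" for x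
    using that seminorm_fP seminorm_fS by (intro exI[of _ 1]) (auto simp: ug_gens_def)
qed (rule ug_relators_free)

theorem cstar_algebra_ultragraph_cstar: "cstar_algebra (ultragraph_cstar G)"
  unfolding ultragraph_cstar_def by (rule ug.cstar_algebra_U)

theorem ck_family_ultragraph_cstar: "ck_family G (ultragraph_cstar G) (ug_proj G) (ug_iso G)"
proof -
  have P: "fP A \<in> free_on (ug_gens G)" if "A \<in> gen_verts G" for A using that by (rule fP_free)
  have S: "fS e \<in> free_on (ug_gens G)" if "e \<in> edges G" for e using that by (rule fS_free)
  note eqI = ug.el_relator_diff
  show ?thesis
    unfolding ck_family_def ultragraph_cstar_def ug_proj_def ug_iso_def
  proof (intro conjI ballI allI impI)
    fix A assume A: "A \<in> gen_verts G"
    show "ug.el (fP A) \<in> carrier ug.U" by (rule ug.el_carrier[OF P[OF A]])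
    show "ug.el (fP A) \<otimes>\<^bsub>ug.U\<^esub> ug.el (fP A) = ug.el (fP A)"
      using P[OF A] eqI[OF ug_relI(1)[OF A]] by (simp add: ug.el_mult free_on_mult)
    show "star ug.U (ug.el (fP A)) = ug.el (fP A)"
      using P[OF A] eqI[OF ug_relI(2)[OF A]] by (simp add: ug.el_star free_on_fstar)
    fix B assume B: "B \<in> gen_verts G"
    have i: "A \<inter> B \<in> gen_verts G" and u: "A \<union> B \<in> gen_verts G" using A B by (auto intro: gen_verts.intros)
    have "fP A * fP B - fP (A \<inter> B) \<in> ug_relators G" by (rule ug_relI(6)[OF A B])
    from eqI[OF this] show "ug.el (fP A) \<otimes>\<^bsub>ug.U\<^esub> ug.el (fP B) = ug.el (fP (A \<inter> B))"
      using P[OF A] P[OF B] P[OF i] by (simp add: ug.el_mult free_on_mult)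
    have "fP (A \<union> B) - (fP A + fP B - fP (A \<inter> B)) \<in> ug_relators G" by (rule ug_relI(7)[OF A B])
    from eqI[OF this] show "ug.el (fP (A \<union> B)) = ug.el (fP A) \<oplus>\<^bsub>ug.U\<^esub> ug.el (fP B) \<ominus>\<^bsub>ug.U\<^esub> ug.el (fP (A \<inter> B))"
      using P[OF A] P[OF B] P[OF i] P[OF u] by (simp add: ug.el_add ug.el_diff free_on_add free_on_diff)
  next
    fix e assume e: "e \<in> edges G"
    have r: "rng G e \<in> gen_verts G" using e by (rule gen_verts.range)
    have sr: "{src G e} \<in> gen_verts G" using e by (rule src_gen_verts)
    show "ug.el (fS e) \<in> carrier ug.U" by (rule ug.el_carrier[OF S[OF e]])
    have "fS e * fstar (fS e) * fS e - fS e \<in> ug_relators G" by (rule ug_relI(3)[OF e])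
    from eqI[OF this] show "ug.el (fS e) \<otimes>\<^bsub>ug.U\<^esub> star ug.U (ug.el (fS e)) \<otimes>\<^bsub>ug.U\<^esub> ug.el (fS e) = ug.el (fS e)"
      using S[OF e] by (simp add: ug.el_mult ug.el_star free_on_mult free_on_fstar)
    have "fstar (fS e) * fS e - fP (rng G e) \<in> ug_relators G" by (rule ug_relI(8)[OF e])
    from eqI[OF this] show "star ug.U (ug.el (fS e)) \<otimes>\<^bsub>ug.U\<^esub> ug.el (fS e) = ug.el (fP (rng G e))"
      using S[OF e] P[OF r] by (simp add: ug.el_mult ug.el_star free_on_mult free_on_fstar)
    have "fP {src G e} * (fS e * fstar (fS e)) - fS e * fstar (fS e) \<in> ug_relators G" by (rule ug_relI(9)[OF e])
    from eqI[OF this] show "ug.el (fP {src G e}) \<otimes>\<^bsub>ug.U\<^esub> (ug.el (fS e) \<otimes>\<^bsub>ug.U\<^esub> star ug.U (ug.el (fS e)))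
        = ug.el (fS e) \<otimes>\<^bsub>ug.U\<^esub> star ug.U (ug.el (fS e))"
      using S[OF e] P[OF sr] by (simp add: ug.el_mult ug.el_star free_on_mult free_on_fstar)
    fix f assume f: "f \<in> edges G" "e \<noteq> f"
    have "(fS e * fstar (fS e)) * (fS f * fstar (fS f)) \<in> ug_relators G" by (rule ug_relI(4)[OF e f])
    from ug.el_relator[OF this] show "(ug.el (fS e) \<otimes>\<^bsub>ug.U\<^esub> star ug.U (ug.el (fS e)))
       \<otimes>\<^bsub>ug.U\<^esub> (ug.el (fS f) \<otimes>\<^bsub>ug.U\<^esub> star ug.U (ug.el (fS f))) = \<zero>\<^bsub>ug.U\<^esub>"
      using S[OF e] S[OF f(1)] by (simp add: ug.el_mult ug.el_star free_on_mult free_on_fstar)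
  next
    show "ug.el (fP {}) = \<zero>\<^bsub>ug.U\<^esub>" by (rule ug.el_relator) (rule ug_relI(5))
  next
    fix v assume v: "regular G v"
    interpret U: cstar_algebra ug.U by (rule ug.cstar_algebra_U)
    have vg: "{v} \<in> gen_verts G" and fin: "finite (emitted G {v})" using v by (auto simp: regular_def intro: gen_verts.intros)
    have Se: "fS e \<in> free_on (ug_gens G)" if "e \<in> emitted G {v}" for e using that S by (simp add: emitted_def)
    have SS: "fS e * fstar (fS e) \<in> free_on (ug_gens G)" if "e \<in> emitted G {v}" for e
      using Se[OF that] by (simp add: free_on_mult free_on_fstar)
    have "fP {v} - (\<Sum>e\<in>emitted G {v}. fS e * fstar (fS e)) \<in> ug_relators G" by (rule ug_relI(10)[OF v])
    from eqI[OF this P[OF vg] free_on_sum[OF SS]]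
    have "ug.el (fP {v}) = (\<Oplus>\<^bsub>ug.U\<^esub>e\<in>emitted G {v}. ug.el (fS e * fstar (fS e)))"
      using ug.el_sum[OF fin SS] by simp
    also have "\<dots> = (\<Oplus>\<^bsub>ug.U\<^esub>e\<in>emitted G {v}. ug.el (fS e) \<otimes>\<^bsub>ug.U\<^esub> star ug.U (ug.el (fS e)))"
      using Se by (intro U.finsum_cong') (auto simp: ug.el_mult ug.el_star free_on_fstar U.mult_closed U.star_closed ug.el_carrier)
    finally show "ug.el (fP {v}) = (\<Oplus>\<^bsub>ug.U\<^esub>e\<in>emitted G {v}. ug.el (fS e) \<otimes>\<^bsub>ug.U\<^esub> star ug.U (ug.el (fS e)))" .
  qed
qed

theorem ultragraph_cstar_generated:
  fixes C defines "C \<equiv> ultragraph_cstar G"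
  assumes "D \<subseteq> carrier C"
    and "\<And>A. A \<in> gen_verts G \<Longrightarrow> ug_proj G A \<in> D" "\<And>e. e \<in> edges G \<Longrightarrow> ug_iso G e \<in> D"
    and "\<And>a b. a \<in> D \<Longrightarrow> b \<in> D \<Longrightarrow> a \<oplus>\<^bsub>C\<^esub> b \<in> D" "\<And>a b. a \<in> D \<Longrightarrow> b \<in> D \<Longrightarrow> a \<otimes>\<^bsub>C\<^esub> b \<in> D"
    and "\<And>c a. a \<in> D \<Longrightarrow> c \<odot>\<^bsub>C\<^esub> a \<in> D" "\<And>a. a \<in> D \<Longrightarrow> star C a \<in> D" "\<zero>\<^bsub>C\<^esub> \<in> D"
    and "\<And>x a. (\<And>n::nat. x n \<in> D) \<Longrightarrow> a \<in> carrier C \<Longrightarrow> (\<lambda>n. nrm C (x n \<ominus>\<^bsub>C\<^esub> a)) \<longlonglongrightarrow> 0 \<Longrightarrow> a \<in> D"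
  shows "D = carrier C"
proof -
  note a = assms(2-)[unfolded C_def ultragraph_cstar_def ug_proj_def ug_iso_def]
  have "ug.el (gen x) \<in> D" if "x \<in> ug_gens G" for x
    using that a(2,3) unfolding ug_gens_def by blast
  from ug.generated[OF a(1) this a(4-9)] show ?thesis unfolding C_def ultragraph_cstar_def .
qed

theorem ultragraph_cstar_universal:
  assumes B: "cstar_algebra B" and ck: "ck_family G B p s"
  shows "\<exists>\<pi>. star_hom (ultragraph_cstar G) B \<pi> \<and>
    (\<forall>A\<in>gen_verts G. \<pi> (ug_proj G A) = p A) \<and> (\<forall>e\<in>edges G. \<pi> (ug_iso G e) = s e)"
proof -
  interpret B: cstar_algebra B by fact
  define g where "g = case_ug_gen p s"
  have g: "g x \<in> carrier B" if "x \<in> ug_gens G" for x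
    using that ck by (auto simp: ug_gens_def g_def ck_family_def)
  have P: "B.ev g (fP A) = p A" "p A \<in> carrier B" if "A \<in> gen_verts G" for A
    using B.ev_gen[where X = "ug_gens G" and g = g and x = "Proj A", OF g] ck that by (simp_all add: ug_gens_def g_def ck_family_def)
  have S: "B.ev g (fS e) = s e" "s e \<in> carrier B" if "e \<in> edges G" for e
    using B.ev_gen[where X = "ug_gens G" and g = g and x = "Iso e", OF g] ck that by (simp_all add: ug_gens_def g_def ck_family_def)
  note hom = B.ev_add[where X = "ug_gens G" and g = g, OF g] B.ev_mult[where X = "ug_gens G" and g = g, OF g] B.ev_star[where X = "ug_gens G" and g = g, OF g] B.ev_diff[where X = "ug_gens G" and g = g, OF g] ug_free P S
  have SS: "B.ev g (fS e * fstar (fS e)) = s e \<otimes>\<^bsub>B\<^esub> star B (s e)" if "e \<in> edges G" for e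
    using that by (simp add: hom)
  have SSc: "s e \<otimes>\<^bsub>B\<^esub> star B (s e) \<in> carrier B" if "e \<in> edges G" for e
    using that S by (simp add: B.mult_closed B.star_closed)
  have "B.ev g r = \<zero>\<^bsub>B\<^esub>" if "r \<in> ug_relators G" for r
    using that unfolding ug_relators_def
  proof (elim UnE, goal_cases)
    case 10
    then obtain v where v: "regular G v" "r = fP {v} - (\<Sum>e\<in>emitted G {v}. fS e * fstar (fS e))" by blast
    have vg: "{v} \<in> gen_verts G" and fin: "finite (emitted G {v})" using v by (auto simp: regular_def intro: gen_verts.intros)
    have e: "e \<in> edges G" if "e \<in> emitted G {v}" for e using that by (simp add: emitted_def)
    have "B.ev g (\<Sum>e\<in>emitted G {v}. fS e * fstar (fS e)) = (\<Oplus>\<^bsub>B\<^esub>e\<in>emitted G {v}. B.ev g (fS e * fstar (fS e)))"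
      by (rule B.ev_sum[where X = "ug_gens G" and g = g, OF g]) (use fin in \<open>auto intro!: ug_free e\<close>)
    also have "\<dots> = (\<Oplus>\<^bsub>B\<^esub>e\<in>emitted G {v}. s e \<otimes>\<^bsub>B\<^esub> star B (s e))"
      using e SS SSc by (intro B.finsum_cong') auto
    also have "\<dots> = p {v}" using ck v(1) by (simp add: ck_family_def)
    finally have "B.ev g (\<Sum>e\<in>emitted G {v}. fS e * fstar (fS e)) = p {v}" .
    moreover have "(\<Sum>e\<in>emitted G {v}. fS e * fstar (fS e)) \<in> free_on (ug_gens G)"
      by (auto intro!: ug_free e)
    ultimately show ?case using v P[OF vg] fP_free[OF vg] B.ev_diff[where X = "ug_gens G" and g = g, OF g]
      by (simp add: B.minus_eq B.r_neg)
  qed (use ck in \<open>auto simp: hom ck_family_def B.minus_eq B.r_neg B.mult_closed B.star_closed B.mult_assoc\<close>)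
  from ug.universal[OF B g this] obtain \<pi> where
    "star_hom ug.U B \<pi>" "\<forall>x\<in>ug_gens G. \<pi> (ug.el (gen x)) = g x" by blast
  then show ?thesis
    unfolding ultragraph_cstar_def ug_proj_def ug_iso_def
    by (intro exI[of _ \<pi>]) (auto simp: ug_gens_def g_def)
qed

end

end

theory Submission
  imports Defs
begin

text \<open>The vertex projections are nonzero: partial bijections of a set \<open>V \<times> K\<close> with \<open>K\<close> large
  represent the free *-algebra on the finitely supported functions, and the operator norm is
  an admissible seminorm.

  A finite-dimensional representation kills some member of every infinite family \<open>u\<^sub>k\<close> with
  \<open>u\<^sub>j\<^sup>* u\<^sub>k = 0\<close> for \<open>j \<noteq> k\<close>. If moreover all \<open>u\<^sub>k\<^sup>* u\<^sub>k\<close> equal the same \<open>x\<close>, it kills \<open>x\<close>, so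
  \<open>x = 0\<close> in an RFD algebra. An infinite receiver \<open>v\<close> of edges \<open>e\<^sub>k\<close> gives \<open>u\<^sub>k = s\<^sub>e\<^sub>k p\<^sub>v\<close>, a
  backward chain gives \<open>u\<^sub>k = s\<^sub>e\<^sub>k \<dots> s\<^sub>e\<^sub>0\<close>, and a cycle with partial isometry \<open>t\<close> and an exit \<open>z\<close>
  gives \<open>u\<^sub>k = t\<^sup>k z\<close>. For (B4), a representation that is nonzero at a vertex reaching neither
  a terminal set nor a cycle stays nonzero along an infinite path of distinct, hence
  orthogonal, vertices.\<close>

section \<open>Nonvanishing of the vertex projections\<close>

instantiation poly_mapping :: (type, real_inner) real_inner
begin

definition scaleR_poly_mapping :: "real \<Rightarrow> ('a \<Rightarrow>\<^sub>0 'b) \<Rightarrow> 'a \<Rightarrow>\<^sub>0 'b" where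
  "scaleR_poly_mapping r f = Poly_Mapping.map ((*\<^sub>R) r) f"

text \<open>For complex values \<open>inner\<close> is the real part of the Hermitian product, so
  this is the real part of the usual l^2 product. The terms outside the keys of \<open>f\<close>
  vanish.\<close>

definition inner_poly_mapping :: "('a \<Rightarrow>\<^sub>0 'b) \<Rightarrow> ('a \<Rightarrow>\<^sub>0 'b) \<Rightarrow> real" where
  "inner_poly_mapping f g =
     (\<Sum>x\<in>Poly_Mapping.keys f. inner (Poly_Mapping.lookup f x) (Poly_Mapping.lookup g x))"

definition norm_poly_mapping :: "('a \<Rightarrow>\<^sub>0 'b) \<Rightarrow> real" where
  "norm_poly_mapping f = sqrt (inner f f)"

definition sgn_poly_mapping :: "('a \<Rightarrow>\<^sub>0 'b) \<Rightarrow> 'a \<Rightarrow>\<^sub>0 'b" where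
  "sgn_poly_mapping f = inverse (norm f) *\<^sub>R f"

definition dist_poly_mapping :: "('a \<Rightarrow>\<^sub>0 'b) \<Rightarrow> ('a \<Rightarrow>\<^sub>0 'b) \<Rightarrow> real" where
  "dist_poly_mapping f g = norm (f - g)"

definition uniformity_poly_mapping :: "(('a \<Rightarrow>\<^sub>0 'b) \<times> ('a \<Rightarrow>\<^sub>0 'b)) filter" where
  "uniformity_poly_mapping = (INF e\<in>{0<..}. principal {(f, g). dist f g < e})"

definition open_poly_mapping :: "('a \<Rightarrow>\<^sub>0 'b) set \<Rightarrow> bool" where
  "open_poly_mapping S \<longleftrightarrow> (\<forall>f\<in>S. eventually (\<lambda>(f', g). f' = f \<longrightarrow> g \<in> S) uniformity)"

text \<open>Puts the sums for different functions over one common finite index set, where linearity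
  and symmetry are read off termwise.\<close>

lemma inner_poly_mapping_superset:
  assumes "finite S" "Poly_Mapping.keys f \<subseteq> S"
  shows "inner f g = (\<Sum>x\<in>S. inner (Poly_Mapping.lookup f x) (Poly_Mapping.lookup g x))"
  unfolding inner_poly_mapping_def
  by (rule sum.mono_neutral_left) (use assms in \<open>auto simp: in_keys_iff\<close>)

lemma lookup_scaleR [simp]: "Poly_Mapping.lookup (r *\<^sub>R f) x = r *\<^sub>R Poly_Mapping.lookup f x"
  by (simp add: scaleR_poly_mapping_def map.rep_eq when_def)

instance
proof
  fix a b :: real and f g h :: "'a \<Rightarrow>\<^sub>0 'b"
  show "a *\<^sub>R (f + g) = a *\<^sub>R f + a *\<^sub>R g"
    by (rule poly_mapping_eqI) (simp add: lookup_add scaleR_add_right)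
  show "(a + b) *\<^sub>R f = a *\<^sub>R f + b *\<^sub>R f"
    by (rule poly_mapping_eqI) (simp add: lookup_add scaleR_add_left)
  show "a *\<^sub>R b *\<^sub>R f = (a * b) *\<^sub>R f" "1 *\<^sub>R f = f"
    by (rule poly_mapping_eqI, simp)+
  let ?S = "Poly_Mapping.keys f \<union> Poly_Mapping.keys g \<union> Poly_Mapping.keys h"
  have S: "finite ?S" by simp
  have k: "Poly_Mapping.keys f \<subseteq> ?S" "Poly_Mapping.keys g \<subseteq> ?S" "Poly_Mapping.keys h \<subseteq> ?S"
    by auto
  have k2: "Poly_Mapping.keys (f + g) \<subseteq> ?S" using keys_add[of f g] by blast
  have k3: "Poly_Mapping.keys (a *\<^sub>R f) \<subseteq> ?S" by (auto simp: in_keys_iff)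
  show "inner f g = inner g f"
    unfolding inner_poly_mapping_superset[OF S k(1)] inner_poly_mapping_superset[OF S k(2)]
    by (simp add: inner_commute)
  show "inner (f + g) h = inner f h + inner g h"
    unfolding inner_poly_mapping_superset[OF S k(1)] inner_poly_mapping_superset[OF S k(2)]
      inner_poly_mapping_superset[OF S k2]
    by (simp add: lookup_add inner_add_left sum.distrib)
  show "inner (a *\<^sub>R f) g = a * inner f g"
    unfolding inner_poly_mapping_superset[OF S k(1)] inner_poly_mapping_superset[OF S k3]
    by (simp add: sum_distrib_left)
  show "0 \<le> inner f f" by (simp add: inner_poly_mapping_def sum_nonneg)
  show "(inner f f = 0) = (f = 0)"
    by (auto simp: inner_poly_mapping_def sum_nonneg_eq_0_iff in_keys_iff intro!: poly_mapping_eqI)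
qed (simp_all add: norm_poly_mapping_def sgn_poly_mapping_def dist_poly_mapping_def
    uniformity_poly_mapping_def open_poly_mapping_def)

end

lemma norm_single: "norm (Poly_Mapping.single x c) = norm c"
  by (cases "c = 0") (simp_all add: norm_eq_sqrt_inner inner_poly_mapping_def)

section \<open>The C*-seminorm of a *-representation by contractions\<close>

text \<open>The inner product space is a real one with a complex scaling \<open>cx\<close>. It need not be
  complete, since the adjoint of \<open>L (g, b)\<close> is given as \<open>L (g, \<not> b)\<close>.\<close>

locale star_rep =
  fixes cx :: "complex \<Rightarrow> 'h::real_inner \<Rightarrow> 'h"
    and L :: "'g \<times> bool \<Rightarrow> 'h \<Rightarrow> 'h"
  assumes cx_add_left: "cx (c + d) x = cx c x + cx d x"
    and cx_add: "cx c (x + y) = cx c x + cx c y"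
    and cx_cx: "cx c (cx d x) = cx (c * d) x"
    and cx_real: "cx (complex_of_real r) x = r *\<^sub>R x"
    and norm_cx: "norm (cx c x) = cmod c * norm x"
    and inner_cx: "inner (cx c x) y = inner x (cx (cnj c) y)"
    and L_add: "L a (x + y) = L a x + L a y"
    and L_cx: "L a (cx c x) = cx c (L a x)"
    and L_le: "norm (L a x) \<le> norm x"
    and L_adj: "inner (L (g, b) x) y = inner x (L (g, \<not> b) y)"
begin

definition op :: "'g word \<Rightarrow> 'h \<Rightarrow> 'h" where
  "op w x = foldr L (letters w) x"

definition rep :: "'g free_alg \<Rightarrow> 'h \<Rightarrow> 'h" where
  "rep f x = (\<Sum>w\<in>Poly_Mapping.keys f. cx (Poly_Mapping.lookup f w) (op w x))"

lemma cx_0 [simp]: "cx 0 x = 0" "cx c 0 = 0"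
  using cx_real[of 0 x] cx_add[of c 0 0] by simp_all

lemma cx_1 [simp]: "cx 1 x = x"
  using cx_real[of 1 x] by simp

lemma cx_sum: "cx c (sum f I) = (\<Sum>i\<in>I. cx c (f i))"
  by (induction I rule: infinite_finite_induct) (simp_all add: cx_add)

lemma op_add: "op w (x + y) = op w x + op w y"
proof -
  have "foldr L l (x + y) = foldr L l x + foldr L l y" for l
    by (induction l) (simp_all add: L_add)
  then show ?thesis by (simp add: op_def)
qed

lemma op_cx: "op w (cx c x) = cx c (op w x)"
proof -
  have "foldr L l (cx c x) = cx c (foldr L l x)" for l
    by (induction l) (simp_all add: L_cx)
  then show ?thesis by (simp add: op_def)
qed

lemma op_le: "norm (op w x) \<le> norm x"
proof -
  have "norm (foldr L l x) \<le> norm x" for l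
    by (induction l) (auto intro: order_trans[OF L_le])
  then show ?thesis by (simp add: op_def)
qed

lemma op_plus: "op (v + w) x = op v (op w x)"
  by (simp add: op_def plus_word_def)

lemma op_adj: "inner (op w x) y = inner x (op (word_star w) y)"
proof -
  have "inner (foldr L l x) y = inner x (foldr L (rev (map (\<lambda>(g, b). (g, \<not> b)) l)) y)" for l
    by (induction l arbitrary: y) (auto simp: L_adj)
  then show ?thesis by (simp add: op_def word_star_def)
qed

lemma rep_superset:
  assumes "finite S" "Poly_Mapping.keys f \<subseteq> S"
  shows "rep f x = (\<Sum>w\<in>S. cx (Poly_Mapping.lookup f w) (op w x))"
  unfolding rep_def by (rule sum.mono_neutral_left) (use assms in \<open>auto simp: in_keys_iff\<close>)

lemma rep_0 [simp]: "rep 0 x = 0"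
  by (simp add: rep_def)

lemma rep_plus: "rep (f + g) x = rep f x + rep g x"
proof -
  let ?S = "Poly_Mapping.keys f \<union> Poly_Mapping.keys g"
  have S: "finite ?S" "Poly_Mapping.keys f \<subseteq> ?S" "Poly_Mapping.keys g \<subseteq> ?S"
    "Poly_Mapping.keys (f + g) \<subseteq> ?S"
    using keys_add[of f g] by auto
  show ?thesis
    unfolding rep_superset[OF S(1,2)] rep_superset[OF S(1,3)] rep_superset[OF S(1,4)]
    by (simp add: lookup_add cx_add_left sum.distrib)
qed

lemma rep_single: "rep (Poly_Mapping.single w c) x = cx c (op w x)"
  by (cases "c = 0") (simp_all add: rep_def)

lemma rep_gen: "rep (gen g) x = L (g, False) x" "rep (fstar (gen g)) x = L (g, True) x"
  by (simp_all add: gen_def fstar_single rep_single op_def word_star_def)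

lemma rep_fscale: "rep (fscale c f) x = cx c (rep f x)"
  by (induction f rule: free_induct_raw)
     (simp_all add: fscale_add rep_plus cx_add fscale_single rep_single cx_cx)

lemma rep_diff: "rep (f - g) x = rep f x - rep g x"
  using rep_plus[of "f - g" g x] by simp

lemma rep_sum: "rep (sum f I) x = (\<Sum>i\<in>I. rep (f i) x)"
  by (induction I rule: infinite_finite_induct) (simp_all add: rep_plus)

lemma rep_add: "rep f (x + y) = rep f x + rep f y"
  by (simp add: rep_def op_add cx_add sum.distrib)

lemma rep_cx: "rep f (cx c x) = cx c (rep f x)"
  by (simp add: rep_def op_cx cx_sum cx_cx mult.commute)

text \<open>Both sides are additive in \<open>f\<close> and in \<open>g\<close>, which reduces the
  claim to two monomials, that is to \<open>op_plus\<close>.\<close>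

lemma rep_mult: "rep (f * g) x = rep f (rep g x)"
proof (induction f rule: free_induct_raw)
  case (3 v c)
  show ?case
  proof (induction g rule: free_induct_raw)
    case 1
    then show ?case using rep_cx[of _ 0 x] by simp
  next
    case (3 w d)
    show ?case by (simp add: mult_single rep_single op_plus op_cx cx_cx)
  qed (simp add: distrib_left rep_plus rep_add)
qed (simp_all add: distrib_right rep_plus)

lemma rep_adj: "inner (rep f x) y = inner x (rep (fstar f) y)"
  by (induction f rule: free_induct_raw)
     (simp_all add: fstar_add rep_plus inner_add fstar_single rep_single inner_cx op_adj op_cx[symmetric])

lemma bounded_linear_rep: "bounded_linear (rep f)"
proof (rule bounded_linear_intro)
  show "rep f (x + y) = rep f x + rep f y" for x y by (rule rep_add)
  show "rep f (r *\<^sub>R x) = r *\<^sub>R rep f x" for r x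
    using rep_cx[of f "complex_of_real r" x] by (simp add: cx_real)
  have "norm (rep f x) \<le> (\<Sum>w\<in>Poly_Mapping.keys f. cmod (Poly_Mapping.lookup f w) * norm x)" for x
    unfolding rep_def
    by (rule sum_norm_le) (simp add: norm_cx mult_left_mono op_le)
  then show "norm (rep f x) \<le> norm x * (\<Sum>w\<in>Poly_Mapping.keys f. cmod (Poly_Mapping.lookup f w))" for x
    by (simp add: sum_distrib_left mult.commute)
qed

text \<open>The supremum of \<open>norm (rep f x) / norm x\<close> does not see the scalar field, so
  the operator norm of a real linear map serves.\<close>

definition opnorm :: "'g free_alg \<Rightarrow> real" where
  "opnorm f = onorm (rep f)"

lemma rep_le: "norm (rep f x) \<le> opnorm f * norm x"
  unfolding opnorm_def by (rule onorm[OF bounded_linear_rep])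

lemma opnorm_nonneg: "opnorm f \<ge> 0"
  unfolding opnorm_def by (rule onorm_pos_le[OF bounded_linear_rep])

lemma opnorm_mult: "opnorm (f * g) \<le> opnorm f * opnorm g"
  using onorm_compose[OF bounded_linear_rep bounded_linear_rep, of f g]
  by (simp add: opnorm_def rep_mult[abs_def] o_def)

text \<open>The square of \<open>norm (rep f x)\<close> is the inner product of \<open>x\<close>
  with \<open>rep (fstar f * f) x\<close>, which Cauchy-Schwarz bounds. A free \<open>K\<close> lets
  one estimate give both the bound for the adjoint and half of the C*-identity.\<close>

lemma opnorm_le_sqrt:
  assumes "opnorm (fstar f * f) \<le> K" shows "(opnorm f)\<^sup>2 \<le> K"
proof -
  have K: "K \<ge> 0" using assms opnorm_nonneg order_trans by blast
  have "norm (rep f x) \<le> sqrt K * norm x" for x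
  proof (rule power2_le_imp_le)
    have "(norm (rep f x))\<^sup>2 = inner x (rep (fstar f * f) x)"
      by (simp add: power2_norm_eq_inner rep_adj rep_mult)
    also have "\<dots> \<le> norm x * norm (rep (fstar f * f) x)" by (rule norm_cauchy_schwarz)
    also have "\<dots> \<le> norm x * (K * norm x)"
      using rep_le[of "fstar f * f" x] assms by (meson mult_left_mono mult_right_mono norm_ge_zero order_trans)
    finally show "(norm (rep f x))\<^sup>2 \<le> (sqrt K * norm x)\<^sup>2"
      using K by (simp add: power_mult_distrib) (simp add: power2_eq_square mult_ac)
  qed (use K in simp)
  then have "opnorm f \<le> sqrt K" unfolding opnorm_def using K by (intro onorm_bound) auto
  then show ?thesis using K opnorm_nonneg[of f] power_mono[of "opnorm f" "sqrt K" 2] by simp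
qed

lemma opnorm_fstar_le: "opnorm (fstar f) \<le> opnorm f"
proof -
  have ss: "fstar (fstar f) = f" by (rule poly_mapping_eqI) simp
  have "(opnorm (fstar f))\<^sup>2 \<le> opnorm f * opnorm (fstar f)"
    by (rule opnorm_le_sqrt) (simp only: ss opnorm_mult)
  then show ?thesis using opnorm_nonneg[of "fstar f"] opnorm_nonneg[of f]
    by (cases "opnorm (fstar f) = 0") (simp_all add: power2_eq_square)
qed

lemma opnorm_cstar: "opnorm (fstar f * f) = (opnorm f)\<^sup>2"
proof (rule antisym)
  have "opnorm (fstar f * f) \<le> opnorm (fstar f) * opnorm f" by (rule opnorm_mult)
  also have "\<dots> \<le> (opnorm f)\<^sup>2"
    unfolding power2_eq_square by (intro mult_right_mono opnorm_fstar_le opnorm_nonneg)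
  finally show "opnorm (fstar f * f) \<le> (opnorm f)\<^sup>2" .
qed (rule opnorm_le_sqrt, simp)

lemma opnorm_add: "opnorm (f + g) \<le> opnorm f + opnorm g"
  using onorm_triangle[OF bounded_linear_rep bounded_linear_rep, of f g]
  by (simp add: opnorm_def rep_plus[abs_def])

lemma opnorm_fscale: "opnorm (fscale c f) = cmod c * opnorm f"
proof -
  have *: "opnorm (fscale c f) \<le> cmod c * opnorm f" for c f
    unfolding opnorm_def
  proof (rule onorm_bound)
    show "norm (rep (fscale c f) x) \<le> cmod c * onorm (rep f) * norm x" for x
      using mult_left_mono[OF rep_le[of f x], of "cmod c"]
      by (simp add: rep_fscale norm_cx opnorm_def mult.assoc)
  qed (simp add: opnorm_nonneg[unfolded opnorm_def])
  show ?thesis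
  proof (cases "c = 0")
    case True
    then show ?thesis using *[of 0 f] opnorm_nonneg[of "fscale 0 f"] by simp
  next
    case False
    \<comment> \<open>The opposite inequality is the same bound for the scalar
      \<open>inverse c\<close>.\<close>
    have "fscale (inverse c) (fscale c f) = f" by (rule poly_mapping_eqI) (simp add: False)
    then have "opnorm f \<le> inverse (cmod c) * opnorm (fscale c f)"
      using *[of "inverse c" "fscale c f"] by (simp add: norm_inverse)
    then show ?thesis using *[of c f] False by (simp add: field_simps)
  qed
qed

text \<open>Any representation killing the relators thus bounds the universal norm from below, once
  that supremum is finite.\<close>

lemma opnorm_seminorm:
  assumes "\<And>r x. r \<in> R \<Longrightarrow> rep r x = 0"
  shows "opnorm \<in> seminorms X R"
proof -
  have "opnorm r = 0" if "r \<in> R" for r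
  proof -
    have "rep r = (\<lambda>x. 0)" using assms[OF that] by auto
    then show ?thesis by (simp add: opnorm_def onorm_zero)
  qed
  then show ?thesis
    by (simp add: seminorms_def cstar_seminorm_on_def opnorm_add opnorm_fscale opnorm_mult opnorm_cstar)
qed

end

section \<open>Representations by partial bijections\<close>

text \<open>The graphs of \<open>g\<close> and \<open>h\<close> are transposes of each other, which
  makes both injective on their domains and the condition symmetric.\<close>

definition partial_inverse :: "('x \<Rightarrow> 'x option) \<Rightarrow> ('x \<Rightarrow> 'x option) \<Rightarrow> bool" where
  "partial_inverse g h \<longleftrightarrow> (\<forall>x y. g y = Some x \<longleftrightarrow> h x = Some y)"

lemma partial_inverseD: "partial_inverse g h \<Longrightarrow> g y = Some x \<Longrightarrow> h x = Some y"
  by (simp add: partial_inverse_def)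

text \<open>Composition with \<open>g\<close>, extended by zero. For a partial bijection
  \<open>g\<close> it sends the point mass at \<open>x\<close> to that at the \<open>y\<close> with
  \<open>g y = Some x\<close>, so the basis moves along the inverse of \<open>g\<close>.\<close>

definition pull :: "('x \<Rightarrow> 'x option) \<Rightarrow> ('x \<Rightarrow>\<^sub>0 complex) \<Rightarrow> 'x \<Rightarrow>\<^sub>0 complex" where
  "pull g \<xi> = Abs_poly_mapping (\<lambda>y. case g y of None \<Rightarrow> 0 | Some x \<Rightarrow> Poly_Mapping.lookup \<xi> x)"

text \<open>\<open>g\<close> is injective on its domain, so the preimage of the support of
  \<open>\<xi>\<close> is finite and \<open>Abs_poly_mapping\<close> is applied to a function of
  finite support.\<close>

lemma lookup_pull:
  assumes "partial_inverse g h"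
  shows "Poly_Mapping.lookup (pull g \<xi>) y = (case g y of None \<Rightarrow> 0 | Some x \<Rightarrow> Poly_Mapping.lookup \<xi> x)"
proof -
  have "inj_on g (dom g)"
    using assms by (auto simp: inj_on_def partial_inverse_def) (metis option.inject)
  then have "finite (g -` (Some ` Poly_Mapping.keys \<xi>) \<inter> dom g)"
    by (intro finite_vimage_IntI) auto
  moreover have "{y. (case g y of None \<Rightarrow> 0 | Some x \<Rightarrow> Poly_Mapping.lookup \<xi> x) \<noteq> 0}
    \<subseteq> g -` (Some ` Poly_Mapping.keys \<xi>) \<inter> dom g"
    by (auto simp: in_keys_iff split: option.splits)
  ultimately have "finite {y. (case g y of None \<Rightarrow> 0 | Some x \<Rightarrow> Poly_Mapping.lookup \<xi> x) \<noteq> 0}"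
    by (rule rev_finite_subset)
  then show ?thesis unfolding pull_def by (subst Abs_poly_mapping_inverse) simp_all
qed

text \<open>Once the points outside the domain of \<open>h\<close> are dropped, the substitution
  \<open>y = the (h x)\<close> matches the two sums term by term.\<close>

lemma inner_pull:
  assumes gh: "partial_inverse g h"
  shows "inner (pull g \<xi>) \<eta> = inner \<xi> (pull h \<eta>)"
proof -
  have hg: "partial_inverse h g" using gh by (auto simp: partial_inverse_def)
  have "inner \<xi> (pull h \<eta>) =
      (\<Sum>x\<in>{x\<in>Poly_Mapping.keys \<xi>. h x \<noteq> None}. inner (Poly_Mapping.lookup \<xi> x) (Poly_Mapping.lookup (pull h \<eta>) x))"
    unfolding inner_poly_mapping_def
    by (rule sum.mono_neutral_right) (auto simp: lookup_pull[OF hg])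
  also have "\<dots> = inner (pull g \<xi>) \<eta>"
    unfolding inner_poly_mapping_def
  proof (rule sum.reindex_bij_witness[where i = "\<lambda>y. the (g y)" and j = "\<lambda>x. the (h x)"], goal_cases)
    case (3 y)
    then obtain x where "g y = Some x" "Poly_Mapping.lookup \<xi> x \<noteq> 0"
      by (auto simp: in_keys_iff lookup_pull[OF gh] split: option.splits)
    with 3 show ?case using partial_inverseD[OF gh] by simp
  next
    case (4 y)
    then obtain x where "g y = Some x" "Poly_Mapping.lookup \<xi> x \<noteq> 0"
      by (auto simp: in_keys_iff lookup_pull[OF gh] split: option.splits)
    with 4 show ?case using partial_inverseD[OF gh] by (simp add: in_keys_iff)
  next
    case (1 x)
    then obtain y where "h x = Some y" by auto
    then show ?case using partial_inverseD[OF hg] by simp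
  next
    case (2 x)
    then obtain y where "h x = Some y" by auto
    with 2 show ?case using partial_inverseD[OF hg, of x y] by (simp add: in_keys_iff lookup_pull[OF gh])
  next
    case (5 x)
    then obtain y where "h x = Some y" by auto
    with 5 show ?case using partial_inverseD[OF hg, of x y] by (simp add: lookup_pull[OF gh] lookup_pull[OF hg])
  qed
  finally show ?thesis ..
qed

lemma norm_pull_le:
  assumes gh: "partial_inverse g h"
  shows "norm (pull g \<xi>) \<le> norm \<xi>"
proof -
  have hg: "partial_inverse h g" using gh by (auto simp: partial_inverse_def)
  have "(norm (pull g \<xi>))\<^sup>2 = inner \<xi> (pull h (pull g \<xi>))"
    by (simp add: power2_norm_eq_inner inner_pull[OF gh])
  \<comment> \<open>\<open>pull h\<close> after \<open>pull g\<close> restricts \<open>\<xi>\<close>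
    to the domain of \<open>h\<close>: each term is kept or becomes zero.\<close>
  also have "\<dots> \<le> inner \<xi> \<xi>"
    unfolding inner_poly_mapping_def
    by (rule sum_mono) (use partial_inverseD[OF hg] in
      \<open>auto simp: lookup_pull[OF gh] lookup_pull[OF hg] split: option.splits\<close>)
  finally show ?thesis by (simp add: power2_norm_eq_inner[symmetric])
qed

text \<open>To represent the free *-algebra it is enough to give each generator a partial bijection
  and its adjoint the inverse one.\<close>

lemma star_rep_pull:
  fixes \<gamma> :: "'g \<times> bool \<Rightarrow> 'x \<Rightarrow> 'x option"
  assumes "\<And>x b. partial_inverse (\<gamma> (x, b)) (\<gamma> (x, \<not> b))"
  shows "star_rep (\<lambda>c. Poly_Mapping.map ((*) c)) (\<lambda>a. pull (\<gamma> a))"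
proof -
  have pi: "partial_inverse (\<gamma> a) (\<gamma> (fst a, \<not> snd a))" for a using assms[of "fst a" "snd a"] by simp
  note lp = lookup_pull[OF pi]
  have lm: "Poly_Mapping.lookup (Poly_Mapping.map ((*) c) f) x = c * Poly_Mapping.lookup f x"
    for c :: complex and f :: "'x \<Rightarrow>\<^sub>0 complex" and x
    by (simp add: map.rep_eq when_def)
  have km: "Poly_Mapping.keys (Poly_Mapping.map ((*) c) f) \<subseteq> Poly_Mapping.keys f"
    for c :: complex and f :: "'x \<Rightarrow>\<^sub>0 complex"
    by (auto simp: in_keys_iff lm)
  show ?thesis
  proof
    fix c d :: complex and r :: real and f g :: "'x \<Rightarrow>\<^sub>0 complex" and a b x
    show "Poly_Mapping.map ((*) (c + d)) f = Poly_Mapping.map ((*) c) f + Poly_Mapping.map ((*) d) f"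
      "Poly_Mapping.map ((*) c) (f + g) = Poly_Mapping.map ((*) c) f + Poly_Mapping.map ((*) c) g"
      "Poly_Mapping.map ((*) c) (Poly_Mapping.map ((*) d) f) = Poly_Mapping.map ((*) (c * d)) f"
      by (rule poly_mapping_eqI, simp add: lm lookup_add algebra_simps)+
    show "Poly_Mapping.map ((*) (complex_of_real r)) f = r *\<^sub>R f"
      by (rule poly_mapping_eqI) (simp add: lm scaleR_conv_of_real)
    have "inner (Poly_Mapping.map ((*) c) f) (Poly_Mapping.map ((*) c) f) = (cmod c)\<^sup>2 * inner f f"
      unfolding inner_poly_mapping_superset[OF finite_keys km]
      by (simp add: inner_poly_mapping_def lm power2_norm_eq_inner[symmetric] norm_mult power_mult_distrib sum_distrib_left)
    then show "norm (Poly_Mapping.map ((*) c) f) = cmod c * norm f"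
      by (simp add: norm_eq_sqrt_inner real_sqrt_mult)
    show "inner (Poly_Mapping.map ((*) c) f) g = inner f (Poly_Mapping.map ((*) (cnj c)) g)"
      unfolding inner_poly_mapping_superset[OF finite_keys km]
      by (simp add: inner_poly_mapping_def lm inner_complex_def algebra_simps)
    show "pull (\<gamma> a) (f + g) = pull (\<gamma> a) f + pull (\<gamma> a) g"
      "pull (\<gamma> a) (Poly_Mapping.map ((*) c) f) = Poly_Mapping.map ((*) c) (pull (\<gamma> a) f)"
      by (rule poly_mapping_eqI, simp add: lm lookup_add lp split: option.splits)+
    show "norm (pull (\<gamma> a) f) \<le> norm f" by (rule norm_pull_le[OF pi])
    show "inner (pull (\<gamma> (x, b)) f) g = inner f (pull (\<gamma> (x, \<not> b)) g)" by (rule inner_pull[OF assms])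
  qed
qed

text \<open>Every fibre \<open>{v} \<times> UNIV\<close> is so large that it can be cut into as many copies of
  \<open>rng G e \<times> UNIV\<close> as there are edges \<open>e\<close> leaving \<open>v\<close>.\<close>

lemma ex_branching_system:
  includes cardinal_syntax
  fixes G :: "('v, 'e) ultragraph"
  assumes wf: "wf_ultragraph G"
  obtains F :: "'e \<Rightarrow> 'v \<times> ('v + 'e + nat) \<Rightarrow> 'v \<times> ('v + 'e + nat)"
  where "\<And>e. e \<in> edges G \<Longrightarrow> inj_on (F e) (rng G e \<times> UNIV)"
    and "\<And>e. e \<in> edges G \<Longrightarrow> F e ` (rng G e \<times> UNIV) \<subseteq> {src G e} \<times> UNIV"
    and "\<And>e f. e \<in> edges G \<Longrightarrow> f \<in> edges G \<Longrightarrow> e \<noteq> f \<Longrightarrow>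
      F e ` (rng G e \<times> UNIV) \<inter> F f ` (rng G f \<times> UNIV) = {}"
    and "\<And>v. emitted G {v} \<noteq> {} \<Longrightarrow> (\<Union>e\<in>emitted G {v}. F e ` (rng G e \<times> UNIV)) = {v} \<times> UNIV"
proof -
  \<comment> \<open>\<open>nat\<close> makes the fibre infinite; the summands \<open>'v\<close> and
    \<open>'e\<close> let it absorb products with ranges and with sets of emitted edges.\<close>
  let ?K = "UNIV :: ('v + 'e + nat) set"
  have inf: "infinite ?K" by simp
  have "|S| \<le>o |?K|" for S :: "'v set"
    by (rule card_of_ordLeqI[of Inl]) auto
  then have "|rng G e \<times> ?K| =o |?K|" if "e \<in> edges G" for e
    using that wf inf by (intro card_of_Times_infinite_simps(3)) (auto simp: wf_ultragraph_def)
  then have "\<forall>e\<in>edges G. \<exists>k. bij_betw k (rng G e \<times> ?K) ?K" by (simp add: card_of_ordIso)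
  then obtain k where k: "\<And>e. e \<in> edges G \<Longrightarrow> bij_betw (k e) (rng G e \<times> ?K) ?K" by metis
  have "|S| \<le>o |?K|" for S :: "'e set"
    by (rule card_of_ordLeqI[of "\<lambda>e. Inr (Inl e)"]) (auto simp: inj_on_def)
  then have "|?K \<times> emitted G {v}| =o |?K|" if "emitted G {v} \<noteq> {}" for v
    using that inf by (intro card_of_Times_infinite_simps(1)) auto
  then have "\<forall>v. emitted G {v} \<noteq> {} \<longrightarrow> (\<exists>h. bij_betw h (?K \<times> emitted G {v}) ?K)"
    by (simp add: card_of_ordIso)
  then obtain h where h: "\<And>v. emitted G {v} \<noteq> {} \<Longrightarrow> bij_betw (h v) (?K \<times> emitted G {v}) ?K" by metis
  \<comment> \<open>\<open>k e\<close> identifies the part over \<open>rng G e\<close> with one copy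
    of the fibre; \<open>h\<close> packs these copies, labelled by their edges, into the fibre over
    the source.\<close>
  define F where "F e x = (src G e, h (src G e) (k e x, e))" for e x
  have em: "e \<in> emitted G {src G e}" if "e \<in> edges G" for e using that by (simp add: emitted_def)
  have hi: "inj_on (h (src G e)) (?K \<times> emitted G {src G e})" if "e \<in> edges G" for e
    using h[of "src G e"] em[OF that] by (auto simp: bij_betw_def)
  have im: "F e ` (rng G e \<times> ?K) = (\<lambda>y. (src G e, h (src G e) (y, e))) ` ?K" if "e \<in> edges G" for e
  proof -
    have "F e ` (rng G e \<times> ?K) = (\<lambda>y. (src G e, h (src G e) (y, e))) ` k e ` (rng G e \<times> ?K)"
      by (simp add: F_def image_image)
    then show ?thesis using k[OF that] by (simp add: bij_betw_def)
  qed
  show ?thesis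
  proof
    fix e assume e: "e \<in> edges G"
    show "inj_on (F e) (rng G e \<times> ?K)"
    proof (rule inj_onI)
      fix x y assume xy: "x \<in> rng G e \<times> ?K" "y \<in> rng G e \<times> ?K" "F e x = F e y"
      then have "(k e x, e) = (k e y, e)"
        using em[OF e] by (intro inj_onD[OF hi[OF e]]) (auto simp: F_def)
      then show "x = y" using xy k[OF e] by (auto simp: bij_betw_def dest: inj_onD)
    qed
    show "F e ` (rng G e \<times> ?K) \<subseteq> {src G e} \<times> ?K" by (auto simp: F_def)
    fix f assume f: "f \<in> edges G" "e \<noteq> f"
    show "F e ` (rng G e \<times> ?K) \<inter> F f ` (rng G f \<times> ?K) = {}"
    proof (rule equals0I)
      fix z assume "z \<in> F e ` (rng G e \<times> ?K) \<inter> F f ` (rng G f \<times> ?K)"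
      then obtain a b where ab: "src G e = src G f" "h (src G e) (a, e) = h (src G e) (b, f)"
        by (auto simp: F_def)
      then have "(a, e) = (b, f)"
        using em[OF e] em[OF f(1)] by (intro inj_onD[OF hi[OF e]]) auto
      then show False using f by simp
    qed
  next
    fix v assume v: "emitted G {v} \<noteq> {}"
    have "(\<Union>e\<in>emitted G {v}. F e ` (rng G e \<times> ?K)) = (\<Union>e\<in>emitted G {v}. (\<lambda>y. (v, h v (y, e))) ` ?K)"
      by (rule SUP_cong[OF refl]) (auto simp: im emitted_def)
    also have "\<dots> = {v} \<times> h v ` (?K \<times> emitted G {v})" by auto
    also have "\<dots> = {v} \<times> ?K" using h[OF v] by (simp add: bij_betw_def)
    finally show "(\<Union>e\<in>emitted G {v}. F e ` (rng G e \<times> ?K)) = {v} \<times> ?K" .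
  qed
qed

text \<open>The edge \<open>e\<close> acts by \<open>F e\<close>, from the part over its range into
  the fibre over its source, and \<open>Proj A\<close> by restriction to the fibres over
  \<open>A\<close>. Disjoint images give orthogonal ranges; images filling a fibre give the relation
  at a regular vertex.\<close>

lemma ex_seminorm_fP_pos:
  fixes G :: "('v, 'e) ultragraph"
  assumes wf: "wf_ultragraph G"
  shows "\<exists>N\<in>seminorms (ug_gens G) (ug_relators G). \<forall>v. N (fP {v}) > 0"
proof -
  let ?K = "UNIV :: ('v + 'e + nat) set"
  obtain F :: "'e \<Rightarrow> 'v \<times> ('v + 'e + nat) \<Rightarrow> 'v \<times> ('v + 'e + nat)" where
    inj: "\<And>e. e \<in> edges G \<Longrightarrow> inj_on (F e) (rng G e \<times> ?K)" and
    sub: "\<And>e. e \<in> edges G \<Longrightarrow> F e ` (rng G e \<times> ?K) \<subseteq> {src G e} \<times> ?K" and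
    disj: "\<And>e f. e \<in> edges G \<Longrightarrow> f \<in> edges G \<Longrightarrow> e \<noteq> f \<Longrightarrow>
      F e ` (rng G e \<times> ?K) \<inter> F f ` (rng G f \<times> ?K) = {}" and
    cover: "\<And>v. emitted G {v} \<noteq> {} \<Longrightarrow> (\<Union>e\<in>emitted G {v}. F e ` (rng G e \<times> ?K)) = {v} \<times> ?K"
    by (rule ex_branching_system[OF wf]) blast
  define R where "R e = F e ` (rng G e \<times> ?K)" for e
  define I where "I e = inv_into (rng G e \<times> ?K) (F e)" for e
  have IF: "I e (F e x) = x" if "e \<in> edges G" "fst x \<in> rng G e" for e x
    unfolding I_def using inj[OF that(1)] that(2) by (intro inv_into_f_f) (auto simp: mem_Times_iff)
  have FI: "F e (I e y) = y" "fst (I e y) \<in> rng G e" if "y \<in> R e" for e y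
    using f_inv_into_f[of y "F e" "rng G e \<times> ?K"] inv_into_into[of y "F e" "rng G e \<times> ?K"] that
    unfolding I_def R_def by (simp_all add: mem_Times_iff)
  have FR: "F e x \<in> R e" if "fst x \<in> rng G e" for e x
    using that by (auto simp: R_def mem_Times_iff)
  \<comment> \<open>\<open>pull\<close> moves point masses along the inverse map, so
    \<open>Iso e\<close> gets \<open>I e\<close> and its adjoint gets \<open>F e\<close>. Names
    outside \<open>edges G\<close> get the empty map, which keeps the two letters inverse for every
    generator.\<close>
  define \<gamma> where "\<gamma> = (\<lambda>(g, b). case g of
      Proj A \<Rightarrow> \<lambda>y. if fst y \<in> A then Some y else None
    | Iso e \<Rightarrow> \<lambda>y. if b then if e \<in> edges G \<and> fst y \<in> rng G e then Some (F e y) else None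
        else if e \<in> edges G \<and> y \<in> R e then Some (I e y) else None)"
  have Iso: "(y \<in> R e \<and> I e y = x) = (fst x \<in> rng G e \<and> F e x = y)" if "e \<in> edges G" for e x y
    using IF[OF that] FI FR by blast
  have pi: "partial_inverse (\<gamma> (g, b)) (\<gamma> (g, \<not> b))" for g b
    unfolding partial_inverse_def
  proof (intro allI)
    fix x y
    show "(\<gamma> (g, b) y = Some x) = (\<gamma> (g, \<not> b) x = Some y)"
      using Iso[of _ y x] Iso[of _ x y] by (cases g; cases b) (auto simp: \<gamma>_def)
  qed
  interpret star_rep "\<lambda>c. Poly_Mapping.map ((*) c)" "\<lambda>a. pull (\<gamma> a)"
    by (rule star_rep_pull[OF pi])
  note lp = lookup_pull[OF pi]
  let ?l = Poly_Mapping.lookup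
  have P: "?l (rep (fP A) \<xi>) y = (if fst y \<in> A then ?l \<xi> y else 0)" for A \<xi> y
    by (simp add: rep_gen lp) (simp add: \<gamma>_def)
  have P': "?l (rep (fstar (fP A)) \<xi>) y = (if fst y \<in> A then ?l \<xi> y else 0)" for A \<xi> y
    by (simp add: rep_gen lookup_pull[OF pi[of _ True, simplified]] lp) (simp add: \<gamma>_def)
  have S: "?l (rep (fS e) \<xi>) y = (if y \<in> R e then ?l \<xi> (I e y) else 0)" if "e \<in> edges G" for e \<xi> y
    using that by (simp add: rep_gen lp) (simp add: \<gamma>_def)
  have S': "?l (rep (fstar (fS e)) \<xi>) y = (if fst y \<in> rng G e then ?l \<xi> (F e y) else 0)"
    if "e \<in> edges G" for e \<xi> y
    using that by (simp add: rep_gen lookup_pull[OF pi[of _ True, simplified]] lp) (simp add: \<gamma>_def)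
  have SS: "?l (rep (fS e) (rep (fstar (fS e)) \<xi>)) y = (if y \<in> R e then ?l \<xi> y else 0)"
    if "e \<in> edges G" for e \<xi> y
    using that by (simp add: S S' FI)
  have RI: "R e \<inter> R f = {}" if "e \<in> edges G" "f \<in> edges G" "e \<noteq> f" for e f
    using disj[OF that] by (simp add: R_def)
  have Rs: "fst y = src G e" if "e \<in> edges G" "y \<in> R e" for e y
    using sub[OF that(1)] that(2) by (auto simp: R_def)
  have Rs': "(v, k) \<in> R e \<Longrightarrow> e \<in> edges G \<Longrightarrow> v = src G e" for v k e
    using Rs[of e "(v, k)"] by simp
  have "rep r \<xi> = 0" if "r \<in> ug_relators G" for r \<xi>
    using that unfolding ug_relators_def
  proof (elim UnE, goal_cases)
    case 4
    then obtain e f where "r = (fS e * fstar (fS e)) * (fS f * fstar (fS f))" "e \<in> edges G" "f \<in> edges G" "e \<noteq> f"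
      by blast
    then show ?case using RI[of e f] by (auto intro!: poly_mapping_eqI simp: rep_mult SS)
  next
    case 10
    then obtain v where v: "regular G v" "r = fP {v} - (\<Sum>e\<in>emitted G {v}. fS e * fstar (fS e))" by blast
    then have fin: "finite (emitted G {v})" and ne: "emitted G {v} \<noteq> {}" by (auto simp: regular_def)
    have em: "e \<in> edges G" "src G e = v" if "e \<in> emitted G {v}" for e using that by (auto simp: emitted_def)
    show ?case
    proof (rule poly_mapping_eqI)
      fix y
      have "?l (rep (\<Sum>e\<in>emitted G {v}. fS e * fstar (fS e)) \<xi>) y = (\<Sum>e\<in>emitted G {v}. if y \<in> R e then ?l \<xi> y else 0)"
        unfolding rep_sum lookup_sum by (rule sum.cong) (auto simp: rep_mult SS em)
      also have "\<dots> = (if fst y = v then ?l \<xi> y else 0)"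
      proof (cases "fst y = v")
        case True
        then have "y \<in> (\<Union>e\<in>emitted G {v}. R e)" using cover[OF ne] by (auto simp: R_def mem_Times_iff)
        then obtain e where e: "e \<in> emitted G {v}" "y \<in> R e" by blast
        \<comment> \<open>The images of distinct edges are disjoint, so exactly the summand of
          \<open>e\<close> survives.\<close>
        have "(y \<in> R f) = (f = e)" if "f \<in> emitted G {v}" for f
          using RI[of e f] em that e by auto
        then have "(\<Sum>e\<in>emitted G {v}. if y \<in> R e then ?l \<xi> y else 0) = (\<Sum>f\<in>emitted G {v}. if f = e then ?l \<xi> y else 0)"
          by (intro sum.cong) auto
        then show ?thesis using fin e True by simp
      next
        case False
        then have "y \<notin> R e" if "e \<in> emitted G {v}" for e using Rs em that by metis
        then show ?thesis using False by (auto intro!: sum.neutral)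
      qed
      finally show "?l (rep r \<xi>) y = ?l 0 y" by (simp add: v rep_diff lookup_minus P)
    qed
  qed (auto intro!: poly_mapping_eqI simp: rep_mult rep_diff rep_plus lookup_minus lookup_add P P' SS S S' FI IF FR dest: Rs')
  then have "opnorm \<in> seminorms (ug_gens G) (ug_relators G)" by (rule opnorm_seminorm)
  moreover have "opnorm (fP {v}) > 0" for v
  proof -
    \<comment> \<open>Any point of the fibre over \<open>v\<close> would do; its point mass is a
      unit vector fixed by the projection.\<close>
    let ?\<xi> = "Poly_Mapping.single (v, Inr (Inr 0)) (1::complex) :: 'v \<times> ('v + 'e + nat) \<Rightarrow>\<^sub>0 complex"
    have "rep (fP {v}) ?\<xi> = ?\<xi>" by (rule poly_mapping_eqI) (auto simp: P lookup_single when_def)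
    then show ?thesis using rep_le[of "fP {v}" ?\<xi>] by (simp add: norm_single)
  qed
  ultimately show ?thesis by blast
qed

text \<open>The universal norm is the supremum of the admissible seminorms, one of which is positive
  at \<open>fP {v}\<close>.\<close>

lemma ug_proj_nonzero:
  assumes wf: "wf_ultragraph G" and v: "v \<in> verts G"
  shows "ug_proj G {v} \<noteq> \<zero>\<^bsub>ultragraph_cstar G\<^esub>"
proof
  interpret ug: bounded_relators "ug_gens G" "ug_relators G"
  proof
    show "\<exists>K. \<forall>N\<in>seminorms (ug_gens G) (ug_relators G). N (gen x) \<le> K" if "x \<in> ug_gens G" for x
      using that seminorm_fP[OF wf] seminorm_fS[OF wf] by (intro exI[of _ 1]) (auto simp: ug_gens_def)
  qed (rule ug_relators_free[OF wf])
  have f: "fP {v} \<in> free_on (ug_gens G)" by (intro fP_free[OF wf] gen_verts.singleton v)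
  obtain N where N: "N \<in> seminorms (ug_gens G) (ug_relators G)" "N (fP {v}) > 0"
    using ex_seminorm_fP_pos[OF wf] by blast
  assume "ug_proj G {v} = \<zero>\<^bsub>ultragraph_cstar G\<^esub>"
  then have "nrm (ultragraph_cstar G) (ug_proj G {v}) = 0"
    using cstar_algebra.nrm_zero[OF cstar_algebra_ultragraph_cstar[OF wf]] by simp
  then have "univ_nrm (ug_gens G) (ug_relators G) (fP {v}) = 0"
    unfolding ultragraph_cstar_def ug_proj_def ug.el_nrm[OF f] .
  then show False using ug.le_univ[OF f N(1)] N(2) by simp
qed

section \<open>Orthogonal families in RFD algebras\<close>

text \<open>A nonzero column from each matrix would give infinitely many nonzero pairwise orthogonal
  vectors in dimension \<open>n\<close>.\<close>

lemma orthogonal_columns_imp_zero: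
  fixes U :: "nat \<Rightarrow> complex mat"
  assumes U: "\<And>k. U k \<in> carrier_mat n n"
    and orth: "\<And>j k. j \<noteq> k \<Longrightarrow> mat_adjoint (U j) * U k = 0\<^sub>m n n"
  shows "\<exists>k. U k = 0\<^sub>m n n"
proof (rule ccontr)
  assume "\<not> ?thesis"
  then have "\<exists>i a. i < n \<and> a < n \<and> U k $$ (i, a) \<noteq> 0" for k
    using U[of k] by (metis carrier_matD eq_matI index_zero_mat)
  then obtain i a where ia: "\<And>k. i k < n" "\<And>k. a k < n" "\<And>k. U k $$ (i k, a k) \<noteq> 0" by metis
  \<comment> \<open>Nonzero columns, padded with a zero: \<open>n + 1\<close> orthogonal vectors in a hyperplane of \<open>\<complex>\<^bsup>n+1\<^esup>\<close>.\<close>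
  define c where "c k = vec (Suc n) (\<lambda>l. if l < n then U k $$ (l, a k) else 0)" for k
  define vs where "vs = map c [0..<Suc n]"
  have c: "c k \<in> carrier_vec (Suc n)" for k by (simp add: c_def)
  have dot: "c j \<bullet>c c k = (\<Sum>l<n. U j $$ (l, a j) * cnj (U k $$ (l, a k)))" for j k
    by (simp add: scalar_prod_def c_def lessThan_atLeast0)
  have "c j \<bullet>c c k = 0" if "j \<noteq> k" for j k
  proof -
    have "(mat_adjoint (U k) * U j) $$ (a k, a j) = (\<Sum>l<n. cnj (U k $$ (l, a k)) * U j $$ (l, a j))"
      using U[of j] U[of k] ia(2)
      by (simp add: mat_adjoint_def scalar_prod_def lessThan_atLeast0 mat_of_rows_def)
    then show ?thesis using orth[of k j] that ia(2) by (simp add: dot mult.commute)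
  qed
  moreover have "c k \<bullet>c c k \<noteq> 0" for k
  proof -
    have "c k $ i k \<noteq> 0" using ia(1)[of k] ia(3)[of k] by (simp add: c_def)
    then have "c k \<noteq> 0\<^sub>v (Suc n)" using ia(1)[of k] by auto
    then show ?thesis using conjugate_square_eq_0_vec[OF c] by simp
  qed
  ultimately have "corthogonal vs"
    by (intro corthogonalI) (auto simp: vs_def nth_append simp del: upt_Suc)
  moreover have "set vs \<subseteq> carrier_vec (Suc n)" using c by (auto simp: vs_def)
  \<comment> \<open>Nonzero orthogonal vectors have the dual system \<open>vec_inv\<close>, so their
    square matrix is invertible.\<close>
  ultimately have inv: "inverts_mat (mat_of_rows (Suc n) (map vec_inv vs)) (mat_of_cols (Suc n) vs)"
    by (rule corthogonal_inv)
  let ?W = "mat_of_rows (Suc n) (map vec_inv vs)" and ?V = "mat_of_cols (Suc n) vs"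
  have len: "length vs = Suc n" by (simp add: vs_def)
  have W: "?W \<in> carrier_mat (Suc n) (Suc n)" and V: "?V \<in> carrier_mat (Suc n) (Suc n)"
    using len by (simp_all add: mat_of_rows_def mat_of_cols_def)
  have "?W * ?V = 1\<^sub>m (Suc n)" using inv len by (simp add: inverts_mat_def)
  then have "?V * ?W = 1\<^sub>m (Suc n)" by (rule mat_mult_left_right_inverse[OF W V])
  then have "(?V * ?W) $$ (n, n) = 1" by simp
  \<comment> \<open>The padding makes the last row of \<open>?V\<close> zero, which an invertible
    matrix cannot have.\<close>
  moreover have "row ?V n = 0\<^sub>v (Suc n)"
    using len by (intro eq_vecI) (auto simp: mat_of_cols_def vs_def c_def simp del: upt_Suc)
  then have "(?V * ?W) $$ (n, n) = 0" using V W len by (simp add: scalar_prod_def)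
  ultimately show False by simp
qed

lemma fd_rep_carrier: "fd_rep A n \<pi> \<Longrightarrow> x \<in> carrier A \<Longrightarrow> \<pi> x \<in> carrier_mat n n"
  and fd_rep_add: "fd_rep A n \<pi> \<Longrightarrow> x \<in> carrier A \<Longrightarrow> y \<in> carrier A \<Longrightarrow> \<pi> (x \<oplus>\<^bsub>A\<^esub> y) = \<pi> x + \<pi> y"
  and fd_rep_mult: "fd_rep A n \<pi> \<Longrightarrow> x \<in> carrier A \<Longrightarrow> y \<in> carrier A \<Longrightarrow> \<pi> (x \<otimes>\<^bsub>A\<^esub> y) = \<pi> x * \<pi> y"
  and fd_rep_scale: "fd_rep A n \<pi> \<Longrightarrow> x \<in> carrier A \<Longrightarrow> \<pi> (c \<odot>\<^bsub>A\<^esub> x) = c \<cdot>\<^sub>m \<pi> x"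
  by (simp_all add: fd_rep_def)

lemma fd_rep_zero:
  assumes "cstar_algebra A" "fd_rep A n \<pi>"
  shows "\<pi> \<zero>\<^bsub>A\<^esub> = 0\<^sub>m n n"
proof -
  interpret cstar_algebra A by fact
  have "M \<in> carrier_mat n n \<Longrightarrow> 0 \<cdot>\<^sub>m M = 0\<^sub>m n n" for M :: "complex mat"
    by (intro eq_matI) auto
  then show ?thesis
    using fd_rep_scale[OF assms(2) zero_closed, of 0] fd_rep_carrier[OF assms(2) zero_closed]
    by (simp add: scale_0)
qed

context cstar_algebra
begin

lemma fd_rep_orthogonal_zero:
  assumes pi: "fd_rep A n \<pi>"
    and u: "\<And>k. u k \<in> carrier A"
    and orth: "\<And>j k. j \<noteq> k \<Longrightarrow> star A (u j) \<otimes> u k = \<zero>"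
  shows "\<exists>k::nat. \<pi> (u k) = \<pi> \<zero>"
proof -
  have z: "\<pi> \<zero> = 0\<^sub>m n n" by (rule fd_rep_zero[OF cstar_algebra_axioms pi])
  have "mat_adjoint (\<pi> (u j)) * \<pi> (u k) = 0\<^sub>m n n" if "j \<noteq> k" for j k
  proof -
    have "\<pi> (star A (u j) \<otimes> u k) = mat_adjoint (\<pi> (u j)) * \<pi> (u k)"
      using pi u[of j] u[of k] star_closed by (simp add: fd_rep_def)
    then show ?thesis using orth[OF that] z by simp
  qed
  moreover have "\<pi> (u k) \<in> carrier_mat n n" for k using pi u by (simp add: fd_rep_def)
  ultimately show ?thesis unfolding z by (rule orthogonal_columns_imp_zero[rotated])
qed

text \<open>Each representation kills some \<open>u k\<close>. The index depends on the
  representation, but \<open>x\<close> does not depend on the index, so every representation kills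
  \<open>x\<close>.\<close>

lemma RFD_orthogonal_zero:
  assumes rfd: "RFD A"
    and u: "\<And>k::nat. u k \<in> carrier A" and x: "x \<in> carrier A"
    and orth: "\<And>j k. j \<noteq> k \<Longrightarrow> star A (u j) \<otimes> u k = \<zero>"
    and norm: "\<And>k. star A (u k) \<otimes> u k = x"
  shows "x = \<zero>"
proof (rule ccontr)
  assume "x \<noteq> \<zero>"
  then have "\<exists>n \<pi>. fd_rep A n \<pi> \<and> \<pi> x \<noteq> \<pi> \<zero>" using rfd x by (simp add: RFD_def)
  then obtain n \<pi> where pi: "fd_rep A n \<pi>" "\<pi> x \<noteq> \<pi> \<zero>" by auto
  obtain k where k: "\<pi> (u k) = \<pi> \<zero>" using fd_rep_orthogonal_zero[of n \<pi> u, OF pi(1) u orth] by auto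
  have "\<pi> x = \<pi> (star A (u k)) * \<pi> (u k)"
    using pi(1) u[of k] star_closed by (simp add: fd_rep_def flip: norm[of k])
  also have "\<dots> = \<pi> (star A (u k) \<otimes> \<zero>)"
    unfolding k using pi(1) u[of k] star_closed zero_closed by (simp add: fd_rep_def)
  finally show False using pi(2) u star_closed by (simp add: mult_zero_right)
qed

end

section \<open>Cuntz-Krieger families in an RFD algebra\<close>

text \<open>Isolates what the graph arguments know about the algebra: the relations, nonzero vertex
  projections and RFD, without reference to the completion.\<close>

locale rfd_ck_algebra = cstar_algebra A for A :: "'a star_alg" (structure) +
  fixes G :: "('v, 'e) ultragraph" and p :: "'v set \<Rightarrow> 'a" and s :: "'e \<Rightarrow> 'a"
  assumes wf: "wf_ultragraph G"
    and ck: "ck_family G A p s"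
    and p_nonzero: "v \<in> verts G \<Longrightarrow> p {v} \<noteq> \<zero>"
    and rfd: "RFD A"
begin

lemma p_closed: "B \<in> gen_verts G \<Longrightarrow> p B \<in> carrier A"
  and p_star: "B \<in> gen_verts G \<Longrightarrow> star A (p B) = p B"
  and s_closed: "e \<in> edges G \<Longrightarrow> s e \<in> carrier A"
  and s_sstar_s: "e \<in> edges G \<Longrightarrow> s e \<otimes> star A (s e) \<otimes> s e = s e"
  and p_empty: "p {} = \<zero>"
  and p_mult: "B \<in> gen_verts G \<Longrightarrow> C \<in> gen_verts G \<Longrightarrow> p B \<otimes> p C = p (B \<inter> C)"
  and p_union: "B \<in> gen_verts G \<Longrightarrow> C \<in> gen_verts G \<Longrightarrow> p (B \<union> C) = p B \<oplus> p C \<ominus> p (B \<inter> C)"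
  and sstar_s: "e \<in> edges G \<Longrightarrow> star A (s e) \<otimes> s e = p (rng G e)"
  and p_regular: "regular G v \<Longrightarrow> p {v} = (\<Oplus>e\<in>emitted G {v}. s e \<otimes> star A (s e))"
  using ck by (simp_all add: ck_family_def)

lemma gv_src: "e \<in> edges G \<Longrightarrow> {src G e} \<in> gen_verts G"
  by (rule src_gen_verts[OF wf])

lemma rng_verts: "e \<in> edges G \<Longrightarrow> rng G e \<subseteq> verts G"
  using wf by (auto simp: wf_ultragraph_def)

lemmas gv = gen_verts.singleton gen_verts.range gen_verts.empty gv_src
lemmas cl = p_closed s_closed star_closed mult_closed gv

lemma s_p: "e \<in> edges G \<Longrightarrow> s e \<otimes> p (rng G e) = s e"
  using s_sstar_s[of e] by (simp add: sstar_s[symmetric] mult_assoc cl)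

text \<open>The relation concerns range projections; writing \<open>s e\<close> as
  \<open>s e \<otimes> star A (s e) \<otimes> s e\<close>, and likewise for \<open>f\<close>, brings
  their product into the middle.\<close>

lemma sstar_s_orth:
  assumes e: "e \<in> edges G" and f: "f \<in> edges G" and "e \<noteq> f"
  shows "star A (s e) \<otimes> s f = \<zero>"
proof -
  have "star A (s e) = star A (s e) \<otimes> (s e \<otimes> star A (s e))"
    using arg_cong[OF s_sstar_s[OF e], of "star A"] by (simp add: star_mult star_star cl e)
  then have "star A (s e) \<otimes> s f
      = (star A (s e) \<otimes> (s e \<otimes> star A (s e))) \<otimes> (s f \<otimes> star A (s f) \<otimes> s f)"
    using s_sstar_s[OF f] by simp
  also have "\<dots> = star A (s e) \<otimes> ((s e \<otimes> star A (s e)) \<otimes> (s f \<otimes> star A (s f))) \<otimes> s f"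
    by (simp add: mult_assoc cl e f)
  also have "(s e \<otimes> star A (s e)) \<otimes> (s f \<otimes> star A (s f)) = \<zero>"
    using ck assms unfolding ck_family_def by blast
  finally show ?thesis by (simp add: mult_zero_left mult_zero_right cl e f)
qed

lemma p_src_s:
  assumes e: "e \<in> edges G" shows "p {src G e} \<otimes> s e = s e"
proof -
  have "p {src G e} \<otimes> s e = p {src G e} \<otimes> (s e \<otimes> star A (s e)) \<otimes> s e"
    using s_sstar_s[OF e] by (simp add: mult_assoc cl e)
  also have "p {src G e} \<otimes> (s e \<otimes> star A (s e)) = s e \<otimes> star A (s e)"
    using ck e unfolding ck_family_def by blast
  finally show ?thesis by (simp add: s_sstar_s e)
qed

lemma p_s:
  assumes e: "e \<in> edges G" and B: "B \<in> gen_verts G"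
  shows "p B \<otimes> s e = (if src G e \<in> B then s e else \<zero>)"
proof -
  have "p B \<otimes> s e = p B \<otimes> (p {src G e} \<otimes> s e)" by (simp only: p_src_s[OF e])
  also have "\<dots> = (p B \<otimes> p {src G e}) \<otimes> s e" by (simp add: mult_assoc cl e B)
  also have "\<dots> = p (B \<inter> {src G e}) \<otimes> s e" by (simp only: p_mult[OF B gv_src[OF e]])
  finally show ?thesis using p_src_s[OF e] by (cases "src G e \<in> B") (simp_all add: p_empty mult_zero_left s_closed e)
qed

text \<open>A zero \<open>s e\<close> would make \<open>p (rng G e)\<close> zero, but this dominates
  the nonzero \<open>p {w}\<close> for \<open>w\<close> in the nonempty range.\<close>

lemma s_nonzero:
  assumes e: "e \<in> edges G" shows "s e \<noteq> \<zero>"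
proof
  assume "s e = \<zero>"
  then have z: "p (rng G e) = \<zero>" using sstar_s[OF e] by (simp add: mult_zero_right star_zero)
  have "rng G e \<noteq> {}" using wf e by (simp add: wf_ultragraph_def)
  then obtain w where w: "w \<in> rng G e" "w \<in> verts G" using rng_verts[OF e] by blast
  then have "p (rng G e) \<otimes> p {w} = p {w}" by (simp add: p_mult cl e)
  then show False using p_nonzero[of w] w by (simp add: z mult_zero_left cl)
qed

section \<open>Conditions (B1), (B3) and (B2) from orthogonal families\<close>

lemma no_infinite_receivers: "cond_B1 G"
  unfolding cond_B1_def
proof (intro ballI, rule ccontr)
  fix v assume v: "v \<in> verts G" and inf: "infinite {e \<in> edges G. v \<in> rng G e}"
  obtain e :: "nat \<Rightarrow> 'e" where inj: "inj e" and "range e \<subseteq> {e \<in> edges G. v \<in> rng G e}"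
    using infinite_countable_subset[OF inf] by blast
  then have e: "e k \<in> edges G" "v \<in> rng G (e k)" for k by auto
  \<comment> \<open>Cutting down by \<open>p {v}\<close> gives all members the same initial
    projection, whatever the ranges are.\<close>
  define u where "u k = s (e k) \<otimes> p {v}" for k
  have st: "star A (u j) \<otimes> u k = p {v} \<otimes> (star A (s (e j)) \<otimes> s (e k)) \<otimes> p {v}" for j k
    by (simp add: u_def star_mult p_star mult_assoc cl e v)
  have "p {v} = \<zero>"
  proof (rule RFD_orthogonal_zero[of u, OF rfd])
    show "star A (u j) \<otimes> u k = \<zero>" if "j \<noteq> k" for j k
      using that inj by (simp add: st sstar_s_orth inj_eq e mult_zero_left mult_zero_right cl v)
    show "star A (u k) \<otimes> u k = p {v}" for k
      using e by (simp add: st sstar_s p_mult cl v)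
  qed (simp_all add: u_def cl e v)
  then show False using p_nonzero v by blast
qed

lemma no_backward_chains: "cond_B3 G"
  unfolding cond_B3_def
proof
  assume "\<exists>e :: nat \<Rightarrow> 'e. inj e \<and> (\<forall>i. e i \<in> edges G) \<and> (\<forall>i. src G (e i) \<in> rng G (e (Suc i)))"
  then obtain e :: "nat \<Rightarrow> 'e" where inj: "inj e" and e: "\<And>i. e i \<in> edges G"
    and ch: "\<And>i. src G (e i) \<in> rng G (e (Suc i))" by blast
  define u where "u = rec_nat (s (e 0)) (\<lambda>k y. s (e (Suc k)) \<otimes> y)"
  have u: "u 0 = s (e 0)" "u (Suc k) = s (e (Suc k)) \<otimes> u k" for k by (simp_all add: u_def)
  have uc: "u k \<in> carrier A" for k by (induction k) (simp_all add: u cl e)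
  \<comment> \<open>The chain condition makes the initial projection of the next edge fix
    \<open>u k\<close>, so the products \<open>star A (u k) \<otimes> u k\<close> telescope.\<close>
  have pu: "p (rng G (e (Suc k))) \<otimes> u k = u k" for k
    by (cases k) (simp_all add: u mult_assoc[symmetric] p_s e ch cl uc)
  \<comment> \<open>Every product begins with its newest edge, and the edges are distinct: this is
    the source of orthogonality. For \<open>k = 0\<close> the cofactor is
    \<open>p (rng G (e 0))\<close>.\<close>
  have us: "\<exists>y\<in>carrier A. u k = s (e k) \<otimes> y" for k
  proof (cases k)
    case 0
    then show ?thesis using s_p[OF e, of 0] by (metis u(1) cl(1) e gen_verts.range)
  qed (use uc u in blast)
  have "p (rng G (e 0)) = \<zero>"
  proof (rule RFD_orthogonal_zero[of u, OF rfd uc])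
    fix j k :: nat assume "j \<noteq> k"
    obtain y z where yz: "y \<in> carrier A" "z \<in> carrier A" "u j = s (e j) \<otimes> y" "u k = s (e k) \<otimes> z"
      using us by metis
    then have "star A (u j) \<otimes> u k = star A y \<otimes> (star A (s (e j)) \<otimes> s (e k)) \<otimes> z"
      by (simp add: star_mult mult_assoc cl e)
    then show "star A (u j) \<otimes> u k = \<zero>"
      using \<open>j \<noteq> k\<close> inj yz by (simp add: sstar_s_orth e inj_eq mult_zero_left mult_zero_right cl)
  next
    show "star A (u k) \<otimes> u k = p (rng G (e 0))" for k
    proof (induction k)
      case (Suc k)
      have "star A (u (Suc k)) \<otimes> u (Suc k) = star A (u k) \<otimes> (star A (s (e (Suc k))) \<otimes> s (e (Suc k)) \<otimes> u k)"
        by (simp add: u star_mult mult_assoc cl e uc)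
      then show ?case using Suc by (simp add: sstar_s e pu)
    qed (simp add: u sstar_s e)
  qed (simp add: cl e)
  then have "s (e 0) = \<zero>" using s_p[OF e, of 0] by (simp add: mult_zero_right cl e)
  then show False using s_nonzero e by blast
qed

text \<open>With \<open>t\<close> the partial isometry of the cycle, \<open>t\<^sup>k \<otimes> z\<close> is the family of orthogonal partial
  isometries of the Wold decomposition.\<close>

lemma wold_zero:
  assumes t: "t \<in> carrier A" and z: "z \<in> carrier A" and q: "star A t \<otimes> t = q"
    and qt: "q \<otimes> t = t" and qz: "q \<otimes> z = z" and zt: "star A z \<otimes> t = \<zero>"
  shows "z = \<zero>"
proof -
  define u where "u k = (((\<otimes>) t) ^^ k) z" for k
  have u: "u 0 = z" "u (Suc k) = t \<otimes> u k" for k by (simp_all add: u_def)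
  have uc: "u k \<in> carrier A" for k by (induction k) (simp_all add: u cl t z)
  have qc: "q \<in> carrier A" using q t cl by blast
  have qu: "q \<otimes> u k = u k" for k
    by (cases k) (simp_all add: u qz mult_assoc[symmetric] qt qc t uc)
  \<comment> \<open>\<open>q\<close> fixes every \<open>u k\<close>, so \<open>t\<close> cancels and
    both indices drop by one.\<close>
  have step: "star A (u (Suc j)) \<otimes> u (Suc k) = star A (u j) \<otimes> u k" for j k
  proof -
    have "star A (u (Suc j)) \<otimes> u (Suc k) = star A (u j) \<otimes> ((star A t \<otimes> t) \<otimes> u k)"
      by (simp add: u star_mult mult_assoc cl t uc)
    then show ?thesis by (simp add: q qu)
  qed
  have z0: "star A (u 0) \<otimes> u (Suc k) = \<zero>" for k
    by (simp add: u mult_assoc[symmetric] zt cl t z uc mult_zero_left)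
  have lt: "star A (u j) \<otimes> u (j + Suc k) = \<zero>" for j k
    by (induction j) (simp_all add: step z0)
  have "star A z \<otimes> z = \<zero>"
  proof (rule RFD_orthogonal_zero[of u, OF rfd uc])
    fix j k :: nat assume "j \<noteq> k"
    then consider d where "k = j + Suc d" | d where "j = k + Suc d"
      using less_imp_Suc_add[of j k] less_imp_Suc_add[of k j] by (auto simp: neq_iff)
    then show "star A (u j) \<otimes> u k = \<zero>"
    proof cases
      case 2
      \<comment> \<open>Only increasing indices were treated; the other order is the
        adjoint.\<close>
      have "star A (u j) \<otimes> u k = star A (star A (u k) \<otimes> u j)"
        by (simp add: star_mult star_star cl uc)
      then show ?thesis using 2 lt[of k] by (simp add: star_zero)
    qed (use lt in simp)
  next
    show "star A (u k) \<otimes> u k = star A z \<otimes> z" for k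
      by (induction k) (simp_all add: step u(1))
  qed (simp add: cl z)
  then show ?thesis using nrm_cstar[OF z] nrm_eq_0[OF z] by (simp add: nrm_zero)
qed

lemma no_cycle_exits: "cond_B2 G"
  unfolding cond_B2_def
proof (intro allI impI notI)
  fix c assume c: "is_cycle G c" and "has_exit G c"
  then obtain i where i: "i < length c" and
    ex: "(\<exists>f\<in>edges G. src G f \<in> rng G (c ! i) \<and> f \<noteq> c ! (Suc i mod length c)) \<or>
        (\<exists>w\<in>rng G (c ! i). sink G w)" by (auto simp: has_exit_def)
  let ?n = "length c"
  \<comment> \<open>The cycle is read from the position after the exit: \<open>e 0\<close> follows
    \<open>c ! i\<close> on the cycle and is the edge that an exit avoids.\<close>
  define e where "e k = c ! ((Suc i + k) mod ?n)" for k
  have n: "?n > 0" using i by linarith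
  have e: "e k \<in> edges G" for k
    using c n by (auto simp: e_def is_cycle_def is_path_def intro!: nth_mem)
  have ch: "src G (e (Suc k)) \<in> rng G (e k)" for k
  proof (cases "Suc ((Suc i + k) mod ?n) = ?n")
    case True
    then have "(Suc i + Suc k) mod ?n = 0" by (simp add: mod_Suc)
    moreover have "c ! ((Suc i + k) mod ?n) = last c"
    proof -
      have "(Suc i + k) mod ?n = ?n - 1" using True by linarith
      moreover have "c \<noteq> []" using n by auto
      ultimately show ?thesis by (metis last_conv_nth)
    qed
    ultimately show ?thesis
      using c n by (simp add: e_def is_cycle_def path_src_def path_rng_def hd_conv_nth)
  next
    case False
    then have "(Suc i + Suc k) mod ?n = Suc ((Suc i + k) mod ?n)" by (simp add: mod_Suc)
    moreover have "Suc ((Suc i + k) mod ?n) < ?n" using False n by (simp add: Suc_lessI)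
    ultimately show ?thesis using c by (simp add: e_def is_cycle_def is_path_def)
  qed
  define w where "w = rec_nat (s (e 0)) (\<lambda>k y. y \<otimes> s (e (Suc k)))"
  have w: "w 0 = s (e 0)" "w (Suc k) = w k \<otimes> s (e (Suc k))" for k by (simp_all add: w_def)
  have wc: "w k \<in> carrier A" for k by (induction k) (simp_all add: w cl e)
  have ww: "star A (w k) \<otimes> w k = p (rng G (e k))" for k
  proof (induction k)
    case (Suc k)
    have "star A (w (Suc k)) \<otimes> w (Suc k) = star A (s (e (Suc k))) \<otimes> (star A (w k) \<otimes> w k \<otimes> s (e (Suc k)))"
      by (simp add: w star_mult mult_assoc cl e wc)
    then show ?case using ch[of k] by (simp add: Suc p_s sstar_s cl e)
  qed (simp add: w sstar_s e)
  have ws: "star A z \<otimes> s (e 0) = \<zero> \<Longrightarrow> star A z \<otimes> w k = \<zero>" if "z \<in> carrier A" for z k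
    by (induction k) (simp_all add: w mult_assoc[symmetric] cl wc that e mult_zero_left)
  \<comment> \<open>\<open>w m\<close> is one full turn: it starts with \<open>s (e 0)\<close> and
    ends with the edge \<open>c ! i\<close>, whose range gives its initial projection.\<close>
  define m where "m = ?n - 1"
  have "Suc i + m = i + ?n" "Suc i + Suc m = Suc i + 0 + ?n" using n by (simp_all add: m_def)
  then have em: "e m = c ! i" "e (Suc m) = e 0"
    unfolding e_def by (simp_all only: mod_add_self2 mod_less[OF i])
  have pw: "p (rng G (e m)) \<otimes> w k = w k" for k
    using ch[of m] by (induction k) (simp_all add: w em(2) p_s cl e wc mult_assoc[symmetric])
  \<comment> \<open>An element under the range of \<open>c ! i\<close> and orthogonal to the first
    edge is orthogonal to the whole turn, as \<open>wold_zero\<close> demands. Below,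
    \<open>z\<close> is \<open>s f\<close> or \<open>p {v}\<close>.\<close>
  have key: "z = \<zero>" if "z \<in> carrier A" "p (rng G (c ! i)) \<otimes> z = z" "star A z \<otimes> s (e 0) = \<zero>" for z
    using wold_zero[of "w m" z, OF wc that(1) ww] pw ws[OF that(1,3)] that(2) by (simp only: em)
  have ri: "rng G (c ! i) \<in> gen_verts G" using e[of m] em gv by simp
  from ex show False
  proof (elim disjE bexE conjE)
    fix f assume f: "f \<in> edges G" "src G f \<in> rng G (c ! i)" "f \<noteq> c ! (Suc i mod ?n)"
    have f0: "f \<noteq> e 0" using f(3) by (simp add: e_def)
    have "s f = \<zero>"
      by (rule key) (use f f0 ri e in \<open>simp_all add: cl p_s sstar_s_orth\<close>)
    then show False using s_nonzero f by blast
  next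
    fix v assume v: "v \<in> rng G (c ! i)" "sink G v"
    then have vv: "v \<in> verts G" "src G (e 0) \<noteq> v" using e[of 0] by (auto simp: sink_def emitted_def)
    have "p {v} = \<zero>"
      by (rule key) (use v vv ri e in \<open>simp_all add: cl p_s p_mult p_star\<close>)
    then show False using p_nonzero vv by blast
  qed
qed

section \<open>Condition (B4): following the support of a representation\<close>

text \<open>Induction by inclusion-exclusion; membership in \<open>gen_verts\<close> is carried
  along because the union relation asks for it.\<close>

lemma fd_rep_finite_set_zero:
  assumes pi: "fd_rep A n \<pi>" and B: "finite B" "B \<subseteq> verts G"
    and z: "\<And>w. w \<in> B \<Longrightarrow> \<pi> (p {w}) = 0\<^sub>m n n"
  shows "B \<in> gen_verts G \<and> \<pi> (p B) = 0\<^sub>m n n"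
  using B z
proof (induction B)
  case empty
  then show ?case using fd_rep_zero[OF cstar_algebra_axioms pi] by (simp add: p_empty gen_verts.empty)
next
  case (insert w B)
  then have gvs: "{w} \<in> gen_verts G" "B \<in> gen_verts G" and zs: "\<pi> (p {w}) = 0\<^sub>m n n" "\<pi> (p B) = 0\<^sub>m n n"
    by (auto intro: gen_verts.singleton)
  have "p ({w} \<union> B) = p {w} \<oplus> p B \<oplus> (- 1) \<odot> (p {w} \<otimes> p B)"
    using gvs by (simp add: p_union p_mult minus_scale cl gen_verts.inter del: Un_insert_left)
  moreover have "\<pi> (p {w} \<oplus> p B \<oplus> (- 1) \<odot> (p {w} \<otimes> p B)) = 0\<^sub>m n n"
    using gvs zs by (simp add: fd_rep_add[OF pi] fd_rep_mult[OF pi] fd_rep_scale[OF pi] cl scale_closed)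
  moreover have "{w} \<union> B \<in> gen_verts G" using gvs by (rule gen_verts.union)
  ultimately show ?case by (metis insert_is_Un)
qed

lemma fd_rep_finsum_zero:
  assumes pi: "fd_rep A n \<pi>" and "finite I"
    and "\<And>i. i \<in> I \<Longrightarrow> f i \<in> carrier A" "\<And>i. i \<in> I \<Longrightarrow> \<pi> (f i) = 0\<^sub>m n n"
  shows "\<pi> (\<Oplus>i\<in>I. f i) = 0\<^sub>m n n"
  using assms(2-)
proof (induction I)
  case empty
  then show ?case using fd_rep_zero[OF cstar_algebra_axioms pi] by simp
next
  case (insert i I)
  then have "f \<in> I \<rightarrow> carrier A" "f i \<in> carrier A" by auto
  then show ?case using insert by (simp add: fd_rep_add[OF pi] finsum_closed)
qed

text \<open>If every \<open>p {w}\<close> were killed, so would be \<open>p (rng G e)\<close> for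
  each finite range, then each \<open>s e \<otimes> star A (s e)\<close>, which factors through it,
  and then their sum \<open>p {v}\<close>.\<close>

lemma fd_rep_successor:
  assumes pi: "fd_rep A n \<pi>" and v: "regular G v" "\<pi> (p {v}) \<noteq> 0\<^sub>m n n"
    and fin: "\<And>e. e \<in> emitted G {v} \<Longrightarrow> finite (rng G e)"
  shows "\<exists>e\<in>emitted G {v}. \<exists>w\<in>rng G e. \<pi> (p {w}) \<noteq> 0\<^sub>m n n"
proof (rule ccontr)
  assume "\<not> ?thesis"
  then have z: "\<pi> (p {w}) = 0\<^sub>m n n" if "e \<in> emitted G {v}" "w \<in> rng G e" for e w using that by blast
  have em: "e \<in> edges G" if "e \<in> emitted G {v}" for e using that by (simp add: emitted_def)
  have "\<pi> (s e \<otimes> star A (s e)) = 0\<^sub>m n n" if e: "e \<in> emitted G {v}" for e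
  proof -
    have "\<pi> (p (rng G e)) = 0\<^sub>m n n"
      using fd_rep_finite_set_zero[OF pi fin[OF e] rng_verts[OF em[OF e]] z[OF e]] by simp
    moreover have "\<pi> (s e \<otimes> p (rng G e) \<otimes> star A (s e)) = \<pi> (s e) * \<pi> (p (rng G e)) * \<pi> (star A (s e))"
      and "\<pi> (s e) \<in> carrier_mat n n" "\<pi> (star A (s e)) \<in> carrier_mat n n"
      using em[OF e] by (simp_all add: fd_rep_mult[OF pi] fd_rep_carrier[OF pi] cl)
    ultimately show ?thesis using em[OF e] by (simp add: s_p)
  qed
  then have "\<pi> (p {v}) = 0\<^sub>m n n"
    unfolding p_regular[OF v(1)] using v(1) em
    by (intro fd_rep_finsum_zero[OF pi]) (auto simp: regular_def cl)
  then show False using v(2) by contradiction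
qed

lemma all_reach_terminal_or_cycle:
  assumes rfum2: "RFUM2 G"
  shows "cond_B4 G"
  unfolding cond_B4_def
proof (intro ballI, rule ccontr)
  fix v assume v: "v \<in> verts G" and "\<not> (reaches_terminal G v \<or> reaches_cycle G v)"
  then have nt: "\<not> reaches_terminal G v" and nc: "\<not> reaches_cycle G v" by auto
  \<comment> \<open>Paths have at least one edge, so \<open>v\<close> itself is added by
    hand.\<close>
  define reach where "reach w \<longleftrightarrow> w \<in> verts G \<and>
    (w = v \<or> (\<exists>\<alpha>. is_path G \<alpha> \<and> path_src G \<alpha> = v \<and> w \<in> path_rng G \<alpha>))" for w
  have nts: "{w} \<notin> terminal_sets G" if "reach w" for w
    using that nt by (auto simp: reach_def reaches_terminal_def)
  have reg: "regular G w" if w: "reach w" for w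
  proof -
    have wv: "{w} \<in> gen_verts G" using w by (simp add: reach_def gv)
    have "\<not> (infinite_emitter G B \<or> infinite B \<and> finite (emitted G B))" if "B \<subset> {w}" for B
    proof -
      have "B = {}" using that by blast
      then show ?thesis by (simp add: infinite_emitter_def emitted_def)
    qed
    \<comment> \<open>The empty set is the sole proper subset of a singleton, so a singleton
      infinite emitter is minimal, hence terminal.\<close>
    then have "infinite_emitter G {w} \<Longrightarrow> {w} \<in> terminal_sets G"
      unfolding terminal_sets_def minimal_infinite_emitter_def by blast
    then have "\<not> infinite_emitter G {w}" using nts[OF w] by blast
    moreover have "\<not> sink G w" using nts[OF w] by (auto simp: terminal_sets_def)
    ultimately show ?thesis using w wv by (auto simp: regular_def sink_def infinite_emitter_def reach_def)
  qed
  have ext: "\<exists>\<alpha>. is_path G \<alpha> \<and> path_src G \<alpha> = v \<and> path_rng G \<alpha> = rng G e"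
    if w: "reach w" and e: "e \<in> emitted G {w}" for w e
  proof (cases "w = v")
    case True
    then show ?thesis using e
      by (intro exI[of _ "[e]"]) (auto simp: is_path_def path_src_def path_rng_def emitted_def)
  next
    case False
    then obtain \<alpha> where a: "is_path G \<alpha>" "path_src G \<alpha> = v" "w \<in> path_rng G \<alpha>" using w by (auto simp: reach_def)
    have "src G ((\<alpha> @ [e]) ! Suc i) \<in> rng G ((\<alpha> @ [e]) ! i)" if i: "Suc i < length (\<alpha> @ [e])" for i
    proof (cases "Suc i < length \<alpha>")
      case True
      then show ?thesis using a(1) by (simp add: is_path_def nth_append)
    next
      case False
      then have "i = length \<alpha> - 1" "\<alpha> \<noteq> []" using i a(1) by (auto simp: is_path_def)
      then show ?thesis using a(3) e by (simp add: nth_append path_rng_def last_conv_nth emitted_def)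
    qed
    then show ?thesis using a e
      by (intro exI[of _ "\<alpha> @ [e]"]) (auto simp: is_path_def path_src_def path_rng_def emitted_def)
  qed
  have fin: "finite (rng G e)" if w: "reach w" and e: "e \<in> emitted G {w}" for w e
  proof -
    obtain \<alpha> where a: "is_path G \<alpha>" "path_src G \<alpha> = v" "path_rng G \<alpha> = rng G e" using ext[OF w e] by blast
    have "e \<in> edges G" using e by (simp add: emitted_def)
    from rfum2[unfolded RFUM2_def, rule_format, OF this]
    obtain \<F> where F: "finite \<F>" "rng G e = \<Union>\<F>" and
      FA: "\<forall>B\<in>\<F>. minimal_infinite_emitter G B \<or> minimal_sink G B \<or>
          (\<exists>v. B = {v} \<and> (sink G v \<or> regular G v))"
      by (elim exE conjE) rule
    \<comment> \<open>A minimal infinite emitter or minimal sink in this range would be a terminal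
      set reached from \<open>v\<close>; only singletons remain.\<close>
    have "finite B" if B: "B \<in> \<F>" for B
    proof -
      have "B \<notin> terminal_sets G" using nt a F(2) B unfolding reaches_terminal_def by blast
      then show ?thesis using FA B by (auto simp: terminal_sets_def)
    qed
    then show ?thesis using F by auto
  qed
  have "p {v} \<noteq> \<zero>" by (rule p_nonzero[OF v])
  then have "\<exists>n \<pi>. fd_rep A n \<pi> \<and> \<pi> (p {v}) \<noteq> \<pi> \<zero>" using rfd v by (simp add: RFD_def cl)
  then obtain n \<pi> where pi: "fd_rep A n \<pi>" and "\<pi> (p {v}) \<noteq> \<pi> \<zero>" by auto
  then have v0: "\<pi> (p {v}) \<noteq> 0\<^sub>m n n" using fd_rep_zero[OF cstar_algebra_axioms pi] by simp
  \<comment> \<open>Dependent choice follows nonzero vertex projections forward; the clause at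
    \<open>k = 0\<close> pins the start at \<open>v\<close>.\<close>
  have "\<exists>x. \<forall>k. (reach (x k) \<and> \<pi> (p {x k}) \<noteq> 0\<^sub>m n n \<and> (k = 0 \<longrightarrow> x k = v)) \<and>
    (\<exists>e\<in>emitted G {x k}. x (Suc k) \<in> rng G e)"
  proof (rule dependent_nat_choice)
    show "\<exists>w. reach w \<and> \<pi> (p {w}) \<noteq> 0\<^sub>m n n \<and> (0 = 0 \<longrightarrow> w = v)"
      using v v0 by (auto simp: reach_def)
  next
    fix w and k :: nat assume w: "reach w \<and> \<pi> (p {w}) \<noteq> 0\<^sub>m n n \<and> (k = 0 \<longrightarrow> w = v)"
    then have rw: "reach w" "\<pi> (p {w}) \<noteq> 0\<^sub>m n n" by simp_all
    obtain e u where eu: "e \<in> emitted G {w}" "u \<in> rng G e" "\<pi> (p {u}) \<noteq> 0\<^sub>m n n"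
      using fd_rep_successor[OF pi reg[OF rw(1)] rw(2) fin[OF rw(1)]] by blast
    moreover have "reach u"
      using ext[OF _ eu(1)] w eu rng_verts[of e] by (auto simp: reach_def emitted_def)
    ultimately show "\<exists>u. (reach u \<and> \<pi> (p {u}) \<noteq> 0\<^sub>m n n \<and> (Suc k = 0 \<longrightarrow> u = v)) \<and>
      (\<exists>e\<in>emitted G {w}. u \<in> rng G e)" by blast
  qed
  then obtain x where x: "\<And>k. reach (x k)" "\<And>k. \<pi> (p {x k}) \<noteq> 0\<^sub>m n n" "x 0 = v"
    "\<And>k. \<exists>e\<in>emitted G {x k}. x (Suc k) \<in> rng G e" by blast
  obtain e where "\<And>k. e k \<in> emitted G {x k} \<and> x (Suc k) \<in> rng G (e k)" using x(4) by metis
  then have e: "\<And>k. e k \<in> edges G" "\<And>k. src G (e k) = x k" "\<And>k. x (Suc k) \<in> rng G (e k)"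
    by (auto simp: emitted_def)
  have path: "is_path G (map e [i..<i + Suc d])" "path_src G (map e [i..<i + Suc d]) = x i"
    "path_rng G (map e [i..<i + Suc d]) = rng G (e (i + d))" for i d
    using e by (auto simp: is_path_def path_src_def path_rng_def hd_map last_map hd_upt simp del: upt_Suc)
  have "inj x"
  proof (rule ccontr)
    assume "\<not> inj x"
    then obtain i j where "i < j" "x i = x j" by (auto simp: inj_def) (metis linorder_neqE_nat)
    then have ex: "\<exists>d i. x i = x (i + Suc d)" by (metis less_imp_Suc_add add_Suc_right)
    \<comment> \<open>The shortest gap between equal vertices, over all starting points, makes the
      vertices in between distinct. Writing it as \<open>Suc d\<close> keeps it positive and counts
      the edges of the cycle.\<close>
    define d where "d = (LEAST d. \<exists>i. x i = x (i + Suc d))"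
    have "\<exists>i. x i = x (i + Suc d)" unfolding d_def by (rule LeastI_ex[OF ex])
    then obtain i where i: "x i = x (i + Suc d)" by blast
    have min: "\<not> (\<exists>i. x i = x (i + Suc d'))" if "d' < d" for d'
      using not_less_Least that unfolding d_def by blast
    let ?c = "map e [i..<i + Suc d]"
    have "inj_on x {i..<i + Suc d}"
    proof (rule linorder_inj_onI)
      fix a b assume ab: "a < b" "a \<in> {i..<i + Suc d}" "b \<in> {i..<i + Suc d}"
      then obtain d' where "b = a + Suc d'" by (metis less_imp_Suc_add add_Suc_right)
      then show "x a \<noteq> x b" using min[of d'] ab by auto
    qed auto
    then have "distinct (map (src G) ?c)" using e by (simp add: distinct_map comp_def del: upt_Suc)
    then have cyc: "is_cycle G ?c"
      using path[of i d] e(3)[of "i + d"] i by (simp add: is_cycle_def del: upt_Suc)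
    have xi: "x i \<in> cycle_verts G ?c" using e by (auto simp: cycle_verts_def image_image simp del: upt_Suc)
    \<comment> \<open>For \<open>i = 0\<close> the vertex \<open>v\<close> lies on the cycle;
      otherwise the first \<open>i\<close> edges form a path from \<open>v\<close> to it.\<close>
    show False
    proof (cases i)
      case 0
      then show False using nc cyc xi x(3) unfolding reaches_cycle_def by metis
    next
      case (Suc m)
      then have "x i \<in> path_rng G (map e [0..<0 + Suc m]) \<inter> cycle_verts G ?c"
        unfolding path using xi e(3)[of m] by simp
      then show False using nc cyc path[of 0 m] x(3) unfolding reaches_cycle_def by blast
    qed
  qed
  have xv: "x k \<in> verts G" for k using x(1)[of k] by (simp add: reach_def)
  \<comment> \<open>Distinct vertices have orthogonal projections, so the representation kills one
    of them, against the choice of \<open>x\<close>.\<close>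
  have "\<exists>k. \<pi> (p {x k}) = \<pi> \<zero>"
  proof (rule fd_rep_orthogonal_zero[of n \<pi> "\<lambda>k. p {x k}", OF pi])
    show "star A (p {x j}) \<otimes> p {x k} = \<zero>" if "j \<noteq> k" for j k
      using that \<open>inj x\<close> xv by (simp add: p_star p_mult p_empty inj_eq cl)
  qed (simp add: cl xv)
  then show False using x(2) fd_rep_zero[OF cstar_algebra_axioms pi] by simp
qed

end

theorem theorem7p2:
  fixes G :: "('v, 'e) ultragraph"
  assumes "wf_ultragraph G"
    and "RFUM2 G"
    and "RFD (ultragraph_cstar G)"
  shows "cond_B1 G \<and> cond_B2 G \<and> cond_B3 G \<and> cond_B4 G"
proof -
  interpret cstar_algebra "ultragraph_cstar G"
    by (rule cstar_algebra_ultragraph_cstar[OF assms(1)])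
  interpret rfd_ck_algebra "ultragraph_cstar G" G "ug_proj G" "ug_iso G"
    by unfold_locales
      (use assms(1,3) ck_family_ultragraph_cstar[OF assms(1)] ug_proj_nonzero[OF assms(1)] in auto)
  show ?thesis
    using no_infinite_receivers no_cycle_exits no_backward_chains
      all_reach_terminal_or_cycle[OF assms(2)] by blast
qed

end
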